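(* Let $t\ge 2$ and let $X_N=\{x_1,\dots,x_N\}\subset\mathbb S^2$ be a spherical $t$-design consisting of $N$ distinct points. Then there exists a convex polytope $P_X\subset\mathbb R^3$ with nonempty interior, unique up to translation among convex bodies with nonempty interior, whose surface area measure is $$S_{P_X}=4\pi\mu_X=\frac{4\pi}{N}\sum_{j=1}^N\delta_{x_j}.$$ Consequently, $P_X$ has exactly $N$ facets, the outer unit normal of the $j$th facet is $x_j$, every facet has area $4\pi/N$, and $\operatorname{Area}(\partial P_X)=4\pi$.
   Context: Let $\omega$ be the standard surface area measure on the unit sphere $\mathbb S^2\subset\mathbb R^3$, $\sigma=\omega/(4\pi)$ its normalization, and $\Pi_t(\mathbb S^2)$ the space of restrictions to $\mathbb S^2$ of real polynomials in three variables of total degree at most $t$. A finite set $X_N=\{x_1,\dots,x_N\}\subset\mathbb S^2$ of distinct points is a spherical $t$-design if $\frac1N\sum_{j=1}^N p(x_j)=\int_{\mathbb S^2}p\,d\sigma$ for every $p\in\Pi_t(\mathbb S^2)$. Its empirical measure is $\mu_X=\frac1N\sum_{j=1}^N\delta_{x_j}$. The surface area measure $S_K$ of a convex body $K\subset\mathbb R^3$ (compact convex set with nonempty interior) is the push-forward of surface area on $\partial K$ under the outer unit normal map; for a polytope with facets $F_j$ and outer unit normals $u_j$, $S_P=\sum_j\operatorname{Area}(F_j)\delta_{u_j}$. *)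

theory Defs
  imports "HOL-Analysis.Analysis"
begin

text \<open>The weight \<open>pi / 4 * diam\<^sup>2\<close> is the area of a disc of that diameter; with this
  normalization the measure agrees with the usual area on planes and on smooth surfaces.
  The covering sets have to be bounded because \<open>diameter\<close> is unspecified on unbounded sets.\<close>

definition area_pre :: "real \<Rightarrow> (real^3) set \<Rightarrow> ennreal" where
  "area_pre \<delta> A =
     (INF C \<in> {C :: nat \<Rightarrow> (real^3) set. A \<subseteq> (\<Union>i. C i) \<and> (\<forall>i. bounded (C i) \<and> diameter (C i) \<le> \<delta>)}.
        \<Sum>i. ennreal (pi / 4 * (diameter (C i))\<^sup>2))"

definition area_outer :: "(real^3) set \<Rightarrow> ennreal" where
  "area_outer A = (SUP \<delta> \<in> {0<..}. area_pre \<delta> A)"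

definition area_measure :: "(real^3) measure" where
  "area_measure = measure_of UNIV (sets borel) area_outer"

text \<open>\<open>area_outer\<close> is a metric outer measure, so \<open>measure_of\<close> above yields a genuine measure
  (\<open>emeasure_area_measure\<close> below).\<close>

lemma area_pre_le:
  assumes "A \<subseteq> (\<Union>i. C i)" "\<And>i. bounded (C i)" "\<And>i. diameter (C i) \<le> \<delta>"
  shows "area_pre \<delta> A \<le> (\<Sum>i. ennreal (pi / 4 * (diameter (C i))\<^sup>2))"
  unfolding area_pre_def using assms by (intro INF_lower) auto

lemma area_pre_less:
  assumes "area_pre \<delta> A < e"
  obtains C where "A \<subseteq> (\<Union>i. C i)" "\<And>i. bounded (C i)" "\<And>i. diameter (C i) \<le> \<delta>"
    "(\<Sum>i. ennreal (pi / 4 * (diameter (C i))\<^sup>2)) < e"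
  using assms unfolding area_pre_def INF_less_iff by auto

lemma area_pre_mono: "A \<subseteq> B \<Longrightarrow> area_pre \<delta> A \<le> area_pre \<delta> B"
  unfolding area_pre_def by (rule INF_superset_mono) auto

lemma area_pre_antimono: "\<delta> \<le> \<delta>' \<Longrightarrow> area_pre \<delta>' A \<le> area_pre \<delta> A"
  unfolding area_pre_def by (rule INF_superset_mono) (auto intro: order_trans)

lemma area_pre_le_outer: "0 < \<delta> \<Longrightarrow> area_pre \<delta> A \<le> area_outer A"
  unfolding area_outer_def by (rule SUP_upper) auto

lemma area_outer_mono: "A \<subseteq> B \<Longrightarrow> area_outer A \<le> area_outer B"
  unfolding area_outer_def by (intro SUP_mono) (auto intro: area_pre_mono)

lemma area_outer_empty: "area_outer {} = 0"
proof -
  have "area_pre \<delta> {} = 0" if "\<delta> > 0" for \<delta>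
    using area_pre_le[of "{}" "\<lambda>_. {}" \<delta>] that by simp
  then show ?thesis
    unfolding area_outer_def by (simp cong: SUP_cong_simp)
qed

lemma area_pre_subadditive:
  fixes A :: "nat \<Rightarrow> (real^3) set"
  shows "area_pre \<delta> (\<Union>i. A i) \<le> (\<Sum>n. area_pre \<delta> (A n))"
proof (rule ennreal_le_epsilon)
  fix e :: real assume "0 < e" "(\<Sum>n. area_pre \<delta> (A n)) < top"
  then have *: "\<And>n. area_pre \<delta> (A n) < area_pre \<delta> (A n) + e * (1/2)^Suc n"
    by (auto simp add: less_top dest!: ennreal_suminf_lessD)
  have "\<forall>n. \<exists>C. A n \<subseteq> (\<Union>i. C i) \<and> (\<forall>i. bounded (C i)) \<and> (\<forall>i. diameter (C i) \<le> \<delta>) \<and>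
      (\<Sum>i. ennreal (pi / 4 * (diameter (C i))\<^sup>2)) \<le> area_pre \<delta> (A n) + e * (1/2)^Suc n"
    using area_pre_less[OF *] by (metis less_imp_le)
  then obtain B where B: "\<And>n. A n \<subseteq> (\<Union>i. B n i)" "\<And>n i. bounded (B n i)"
      "\<And>n i. diameter (B n i) \<le> \<delta>"
      "\<And>n. (\<Sum>i. ennreal (pi / 4 * (diameter (B n i))\<^sup>2)) \<le> area_pre \<delta> (A n) + e * (1/2)^Suc n"
    by metis
  define C where "C = case_prod B \<circ> prod_decode"
  have "(\<Union>i. A i) \<subseteq> (\<Union>i. C i)"
  proof
    fix y assume "y \<in> (\<Union>i. A i)"
    then obtain n i where "y \<in> B n i" using B(1) by blast
    then have "y \<in> C (prod_encode (n, i))" by (simp add: C_def)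
    then show "y \<in> (\<Union>i. C i)" by blast
  qed
  then have "area_pre \<delta> (\<Union>i. A i) \<le> (\<Sum>i. ennreal (pi / 4 * (diameter (C i))\<^sup>2))"
    by (rule area_pre_le) (simp_all only: C_def case_prod_beta comp_def B(2,3))
  also have "\<dots> = (\<Sum>n. \<Sum>i. ennreal (pi / 4 * (diameter (B n i))\<^sup>2))"
    unfolding C_def comp_def
    by (rule suminf_ennreal_2dimen[where f = "\<lambda>p. ennreal (pi / 4 * (diameter (case_prod B p))\<^sup>2)"])
      simp
  also have "\<dots> \<le> (\<Sum>n. area_pre \<delta> (A n) + e * (1/2) ^ Suc n)"
    by (intro suminf_le B) auto
  also have "\<dots> = (\<Sum>n. area_pre \<delta> (A n)) + (\<Sum>n. ennreal e * ennreal ((1/2) ^ Suc n))"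
    using \<open>0 < e\<close> by (subst suminf_add[symmetric])
      (auto simp del: ennreal_suminf_cmult simp add: ennreal_mult[symmetric])
  also have "\<dots> = (\<Sum>n. area_pre \<delta> (A n)) + e"
    unfolding ennreal_suminf_cmult
    by (subst suminf_ennreal_eq[OF zero_le_power power_half_series]) auto
  finally show "area_pre \<delta> (\<Union>i. A i) \<le> (\<Sum>n. area_pre \<delta> (A n)) + e" .
qed

lemma area_outer_subadditive:
  fixes A :: "nat \<Rightarrow> (real^3) set"
  shows "area_outer (\<Union>i. A i) \<le> (\<Sum>n. area_outer (A n))"
  unfolding area_outer_def[of "\<Union>i. A i"]
proof (rule SUP_least)
  fix \<delta> :: real assume "\<delta> \<in> {0<..}"
  then have "(\<Sum>n. area_pre \<delta> (A n)) \<le> (\<Sum>n. area_outer (A n))"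
    by (intro suminf_le area_pre_le_outer) auto
  with area_pre_subadditive show "area_pre \<delta> (\<Union>i. A i) \<le> (\<Sum>n. area_outer (A n))"
    by (rule order_trans)
qed

lemma outer_measure_space_area_outer: "outer_measure_space (Pow UNIV) area_outer"
  by (auto simp: outer_measure_space_def positive_def increasing_def countably_subadditive_def
      area_outer_empty area_outer_mono area_outer_subadditive)

lemma area_outer_Un_le: "area_outer (A \<union> B) \<le> area_outer A + area_outer B"
proof -
  have "subadditive (Pow UNIV) area_outer"
    using outer_measure_space_area_outer 
      ring_of_sets.countably_subadditive_subadditive[OF algebra.axioms(1)[OF algebra_Pow]]
    by (metis outer_measure_space_def)
  then have "area_outer (A \<union> (B - A)) \<le> area_outer A + area_outer (B - A)"
    unfolding subadditive_def by blast
  also have "\<dots> \<le> area_outer A + area_outer B"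
    by (intro add_left_mono area_outer_mono) auto
  finally show ?thesis by simp
qed

lemma area_pre_separated:
  assumes d: "\<And>x y. x \<in> A \<Longrightarrow> y \<in> B \<Longrightarrow> \<delta> < dist x y" and "0 < \<delta>"
  shows "area_pre \<delta> A + area_pre \<delta> B \<le> area_pre \<delta> (A \<union> B)"
  unfolding area_pre_def[of _ "A \<union> B"]
proof (rule INF_greatest, safe)
  fix C :: "nat \<Rightarrow> (real^3) set"
  assume C: "A \<union> B \<subseteq> (\<Union>i. C i)" "\<forall>i. bounded (C i) \<and> diameter (C i) \<le> \<delta>"
  define g where "g S = ennreal (pi / 4 * (diameter S)\<^sup>2)" for S :: "(real^3) set"
  have g0: "g {} = 0" by (simp add: g_def)
  define CA where "CA i = (if C i \<inter> A = {} then {} else C i)" for i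
  define CB where "CB i = (if C i \<inter> B = {} then {} else C i)" for i
  have disj: "CA i = {} \<or> CB i = {}" for i
  proof (rule ccontr)
    assume "\<not> ?thesis"
    then obtain x y where "x \<in> C i" "x \<in> A" "y \<in> C i" "y \<in> B"
      by (auto simp: CA_def CB_def split: if_splits)
    moreover have "dist x y \<le> diameter (C i)"
      using C(2) calculation by (intro diameter_bounded_bound) auto
    moreover have "diameter (C i) \<le> \<delta>" using C(2) by auto
    ultimately show False using d[of x y] by auto
  qed
  have sub: "A \<subseteq> (\<Union>i. CA i)" "B \<subseteq> (\<Union>i. CB i)"
    using C(1) by (force simp: CA_def CB_def)+
  have bd: "bounded (CA i)" "diameter (CA i) \<le> \<delta>" "bounded (CB i)" "diameter (CB i) \<le> \<delta>" for i
    using C(2) \<open>0 < \<delta>\<close> by (auto simp: CA_def CB_def)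
  have "area_pre \<delta> A \<le> (\<Sum>i. g (CA i))"
    unfolding g_def using sub bd by (intro area_pre_le)
  moreover have "area_pre \<delta> B \<le> (\<Sum>i. g (CB i))"
    unfolding g_def using sub bd by (intro area_pre_le)
  ultimately have "area_pre \<delta> A + area_pre \<delta> B \<le> (\<Sum>i. g (CA i)) + (\<Sum>i. g (CB i))"
    by (rule add_mono)
  also have "\<dots> = (\<Sum>i. g (CA i) + g (CB i))"
    by (rule suminf_add) auto
  also have "\<dots> \<le> (\<Sum>i. g (C i))"
  proof (rule suminf_le)
    fix i show "g (CA i) + g (CB i) \<le> g (C i)"
      using disj[of i] by (cases "C i \<inter> A = {}"; cases "C i \<inter> B = {}") (auto simp: CA_def CB_def g0)
  qed auto
  finally show "area_pre \<delta> A + area_pre \<delta> B \<le> (\<Sum>i. ennreal (pi / 4 * (diameter (C i))\<^sup>2))"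
    by (simp add: g_def)
qed

lemma area_outer_separated:
  assumes d: "\<And>x y. x \<in> A \<Longrightarrow> y \<in> B \<Longrightarrow> d \<le> dist x y" and "0 < d"
  shows "area_outer A + area_outer B \<le> area_outer (A \<union> B)"
proof -
  have *: "area_pre \<delta> A + area_pre \<delta>' B \<le> area_outer (A \<union> B)" if "0 < \<delta>" "0 < \<delta>'" for \<delta> \<delta>'
  proof -
    define m where "m = min (d/2) (min \<delta> \<delta>')"
    have m: "0 < m" "m < d" "m \<le> \<delta>" "m \<le> \<delta>'" using that \<open>0 < d\<close> by (auto simp: m_def)
    have "area_pre \<delta> A + area_pre \<delta>' B \<le> area_pre m A + area_pre m B"
      using m by (intro add_mono area_pre_antimono)
    also have "\<dots> \<le> area_pre m (A \<union> B)"
      using m d by (intro area_pre_separated) (auto intro: less_le_trans)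
    also have "\<dots> \<le> area_outer (A \<union> B)"
      using m by (intro area_pre_le_outer)
    finally show ?thesis .
  qed
  have ne: "{0::real<..} \<noteq> {}" by (auto intro: exI[of _ 1])
  show ?thesis
  proof -
    have "area_pre \<delta> A + area_outer B \<le> area_outer (A \<union> B)" if "0 < \<delta>" for \<delta>
      unfolding area_outer_def[of B] ennreal_SUP_add_right[OF ne]
      using * that by (intro SUP_least) auto
    then show ?thesis
      unfolding area_outer_def[of A] ennreal_SUP_add_left[OF ne, symmetric]
      by (intro SUP_least) auto
  qed
qed

lemma area_outer_closed_split:
  fixes S :: "(real^3) set"
  assumes "closed S"
  shows "area_outer (A \<inter> S) + area_outer (A - S) \<le> area_outer A"
proof (cases "S = {} \<or> area_outer A = top")
  case True
  then show ?thesis by (auto simp: area_outer_empty)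
next
  case False
  then have S: "S \<noteq> {}" and fin: "area_outer A < top" by (auto simp: less_top)
  define D where "D n = {x \<in> A. inverse (real (Suc n)) \<le> infdist x S}" for n
  define R where "R k = D (Suc k) - D k" for k
  have lip: "infdist x S - infdist y S \<le> dist x y" for x y
    using infdist_triangle[of x S y] by linarith
  have DA: "D n \<subseteq> A" and RA: "R n \<subseteq> A" for n by (auto simp: D_def R_def)
  have D: "area_outer (A \<inter> S) + area_outer (D n) \<le> area_outer A" for n
  proof -
    have "area_outer (A \<inter> S) + area_outer (D n) \<le> area_outer ((A \<inter> S) \<union> D n)"
    proof (rule area_outer_separated[where d = "inverse (real (Suc n))"])
      fix x y assume "x \<in> A \<inter> S" "y \<in> D n"
      then show "inverse (real (Suc n)) \<le> dist x y"
        using lip[of y x] by (auto simp: D_def dist_commute)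
    qed simp
    also have "\<dots> \<le> area_outer A" using DA by (intro area_outer_mono) auto
    finally show ?thesis .
  qed
  have Rlow: "inverse (real (Suc (Suc k))) \<le> infdist x S" if "x \<in> R k" for x k
    using that by (auto simp: R_def D_def)
  have Rup: "infdist x S < inverse (real (Suc k))" if "x \<in> R k" for x k
    using that by (auto simp: R_def D_def)
  have Rsep: "\<exists>d>0. \<forall>x y. x \<in> (\<Union>i<n. R (2*i+p)) \<longrightarrow> y \<in> R (2*n+p) \<longrightarrow> d \<le> dist x y" for n p
  proof (intro exI conjI allI impI)
    let ?d = "inverse (real (2*n+p)) - inverse (real (Suc (2*n+p)))"
    let ?e = "if n = 0 then 1 else ?d"
    show "0 < ?e" by (auto intro!: less_imp_inverse_less)
    fix x y assume "x \<in> (\<Union>i<n. R (2*i+p))" "y \<in> R (2*n+p)"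
    then obtain i where i: "i < n" "x \<in> R (2*i+p)" by auto
    have "inverse (real (2*n+p)) \<le> inverse (real (Suc (Suc (2*i+p))))"
      using i by (intro le_imp_inverse_le) auto
    then have "?d \<le> infdist x S - infdist y S"
      using Rlow[OF i(2)] Rup[OF \<open>y \<in> R (2*n+p)\<close>] by linarith
    then show "?e \<le> dist x y" using lip[of x y] i by auto
  qed
  have Rsum: "(\<Sum>i<n. area_outer (R (2*i+p))) \<le> area_outer (\<Union>i<n. R (2*i+p))" for n p
  proof (induction n)
    case 0
    then show ?case by simp
  next
    case (Suc n)
    obtain d where d: "d > 0"
      and sep: "\<forall>x y. x \<in> (\<Union>i<n. R (2*i+p)) \<longrightarrow> y \<in> R (2*n+p) \<longrightarrow> d \<le> dist x y"
      using Rsep[of p n] by (elim exE conjE)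
    have "(\<Sum>i<Suc n. area_outer (R (2*i+p)))
        \<le> area_outer (\<Union>i<n. R (2*i+p)) + area_outer (R (2*n+p))"
      using add_right_mono[OF Suc.IH, of "area_outer (R (2*n+p))"] by simp
    also have "\<dots> \<le> area_outer ((\<Union>i<n. R (2*i+p)) \<union> R (2*n+p))"
      by (rule area_outer_separated[OF sep[rule_format] d])
    also have "(\<Union>i<n. R (2*i+p)) \<union> R (2*n+p) = (\<Union>i<Suc n. R (2*i+p))"
      by (auto simp: lessThan_Suc)
    finally show ?case .
  qed
  have Rsum': "(\<Sum>i<n. area_outer (R (2*i+p))) \<le> area_outer A" for n p
    using Rsum[of p n] area_outer_mono[of "\<Union>i<n. R (2*i+p)" A] RA by (meson UN_least order_trans)
  have "(\<Sum>k<n. area_outer (R k)) \<le> 2 * area_outer A" for n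
  proof -
    have "(\<Sum>k<n. area_outer (R k)) \<le> (\<Sum>k<2*n. area_outer (R k))"
      by (intro sum_mono2) auto
    also have "\<dots> = (\<Sum>i<n. area_outer (R (2*i+0))) + (\<Sum>i<n. area_outer (R (2*i+1)))"
      by (induction n) (auto simp: algebra_simps)
    also have "\<dots> \<le> area_outer A + area_outer A" by (intro add_mono Rsum')
    finally show ?thesis by (simp add: mult_2)
  qed
  then have "(\<Sum>k. area_outer (R k)) \<le> 2 * area_outer A"
    by (intro suminf_le_const) auto
  then have sumfin: "(\<Sum>k. area_outer (R k)) < top"
    using fin by (auto intro: le_less_trans simp: ennreal_mult_less_top)
  have tail: "area_outer (A - S) \<le> area_outer (D n) + (\<Sum>k. area_outer (R (k + n)))" for n
  proof -
    have "A - S \<subseteq> D n \<union> (\<Union>k. R (k + n))"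
    proof
      fix x assume x: "x \<in> A - S"
      then have "0 < infdist x S" using infdist_pos_not_in_closed[OF \<open>closed S\<close> S] by auto
      then obtain m where "inverse (real (Suc m)) < infdist x S" using reals_Archimedean by blast
      then have "x \<in> D m" using x by (auto simp: D_def)
      then have "x \<in> D n \<union> (\<Union>k. R (k + n))"
      proof (induction m)
        case 0
        have "inverse (real (Suc n)) \<le> inverse (real (Suc 0))" by (intro le_imp_inverse_le) auto
        then show ?case using 0 by (auto simp: D_def)
      next
        case (Suc m)
        show ?case
        proof (cases "x \<in> D m")
          case True
          then show ?thesis by (rule Suc.IH)
        next
          case False
          then have xR: "x \<in> R m" using Suc.prems by (auto simp: R_def)
          show ?thesis
          proof (cases "n \<le> m")
            case True
            then show ?thesis using xR by (auto intro!: exI[of _ "m - n"])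
          next
            case False
            then have "inverse (real (Suc n)) \<le> inverse (real (Suc (Suc m)))"
              by (intro le_imp_inverse_le) auto
            also have "\<dots> \<le> infdist x S" using Suc.prems by (simp add: D_def)
            finally show ?thesis using x by (simp add: D_def)
          qed
        qed
      qed
      then show "x \<in> D n \<union> (\<Union>k. R (k + n))" .
    qed
    then have "area_outer (A - S) \<le> area_outer (D n \<union> (\<Union>k. R (k + n)))"
      by (rule area_outer_mono)
    also have "\<dots> \<le> area_outer (D n) + area_outer (\<Union>k. R (k + n))"
      by (rule area_outer_Un_le)
    also have "\<dots> \<le> area_outer (D n) + (\<Sum>k. area_outer (R (k + n)))"
      by (intro add_left_mono area_outer_subadditive)
    finally show ?thesis .
  qed
  have le: "area_outer (A \<inter> S) + area_outer (A - S) \<le> area_outer A + (\<Sum>k. area_outer (R (k + n)))" for n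
  proof -
    have "area_outer (A \<inter> S) + area_outer (A - S)
        \<le> area_outer (A \<inter> S) + (area_outer (D n) + (\<Sum>k. area_outer (R (k + n))))"
      by (intro add_left_mono tail)
    also have "\<dots> \<le> area_outer A + (\<Sum>k. area_outer (R (k + n)))"
      using add_right_mono[OF D[of n]] by (simp add: add.assoc)
    finally show ?thesis .
  qed
  define r where "r k = enn2real (area_outer (R k))" for k
  have Rk: "area_outer (R k) < top" for k
    using fin area_outer_mono[OF RA] by (meson le_less_trans)
  then have r: "area_outer (R k) = ennreal (r k)" "0 \<le> r k" for k
    by (auto simp: r_def)
  have "summable r"
    using sumfin r by (auto intro!: summable_suminf_not_top)
  then have "(\<Sum>k. area_outer (R (k + n))) = ennreal (\<Sum>k. r (k + n))" for n
    unfolding r(1) using r(2) by (intro suminf_ennreal2) (auto simp: summable_iff_shift)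
  moreover have "(\<lambda>n. \<Sum>k. r (k + n)) \<longlonglongrightarrow> 0"
    by (rule suminf_exist_split2[OF \<open>summable r\<close>])
  then have "(\<lambda>n. ennreal (\<Sum>k. r (k + n))) \<longlonglongrightarrow> ennreal 0" by (rule tendsto_ennrealI)
  ultimately have "(\<lambda>n. area_outer A + (\<Sum>k. area_outer (R (k + n)))) \<longlonglongrightarrow> area_outer A + 0"
    by (intro tendsto_add) auto
  then show ?thesis
    using le by (auto intro: LIMSEQ_le_const)
qed

lemma measure_space_area_outer: "measure_space UNIV (sets borel) area_outer"
proof -
  let ?L = "lambda_system UNIV (Pow UNIV) area_outer"
  have L: "measure_space UNIV ?L area_outer"
    using sigma_algebra.caratheodory_lemma[OF sigma_algebra_Pow outer_measure_space_area_outer] .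
  have "Collect closed \<subseteq> ?L"
  proof
    fix S :: "(real^3) set" assume "S \<in> Collect closed"
    moreover have "area_outer A \<le> area_outer (A \<inter> S) + area_outer (A - S)" for A
      using area_outer_Un_le[of "A \<inter> S" "A - S"] by (simp add: Int_Diff_Un)
    ultimately show "S \<in> ?L"
      by (subst algebra.lambda_system_eq[OF algebra_Pow])
        (auto intro!: antisym area_outer_closed_split)
  qed
  then have "sets borel \<subseteq> ?L"
    unfolding borel_eq_closed
    using sigma_algebra.sigma_sets_subset[of UNIV ?L "Collect closed"] L
    by (auto simp: measure_space_def)
  then show ?thesis
    using L measure_space_def sets.sigma_algebra_axioms[of "borel :: (real^3) measure"]
    by (auto simp: measure_space_def countably_additive_def positive_def)
qed

lemma space_area_measure: "space area_measure = UNIV"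
  and sets_area_measure: "sets area_measure = sets borel"
  unfolding area_measure_def
  using sets.sigma_sets_eq[of "borel :: (real^3) measure"] by (auto simp: space_measure_of_conv)

lemma emeasure_area_measure: "A \<in> sets borel \<Longrightarrow> emeasure area_measure A = area_outer A"
  using measure_space_area_outer
  unfolding area_measure_def by (intro emeasure_measure_of_sigma) (auto simp: measure_space_def)

abbreviation borel_sphere :: "(real^3) measure" where
  "borel_sphere \<equiv> restrict_space borel (sphere 0 1)"

definition sphere_area :: "(real^3) measure" where
  "sphere_area = restrict_space area_measure (sphere 0 1)"

definition sphere_sigma :: "(real^3) measure" where
  "sphere_sigma = scale_measure (ennreal (1 / (4 * pi))) sphere_area"

text \<open>Total degree at most \<open>t\<close>; the coefficient family \<open>c\<close> is indexed by the exponents.\<close>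

definition polynomials3 :: "nat \<Rightarrow> (real^3 \<Rightarrow> real) set" where
  "polynomials3 t = range (\<lambda>c y. \<Sum>(i, j, k) \<in> {(i, j, k). i + j + k \<le> t}.
     c i j k * (y $ 1) ^ i * (y $ 2) ^ j * (y $ 3) ^ k)"

definition sphere_polynomials :: "nat \<Rightarrow> (real^3 \<Rightarrow> real) set" where
  "sphere_polynomials t = (\<lambda>p. restrict p (sphere 0 1)) ` polynomials3 t"

lemma finite_exponents3: "finite {(i, j, k). i + j + k \<le> (t::nat)}"
  by (rule finite_subset[of _ "{..t} \<times> {..t} \<times> {..t}"]) auto

definition spherical_design :: "nat \<Rightarrow> (real^3) set \<Rightarrow> bool" where
  "spherical_design t X \<longleftrightarrow> finite X \<and> X \<noteq> {} \<and> X \<subseteq> sphere 0 1 \<and>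
     (\<forall>p \<in> sphere_polynomials t. (\<Sum>y\<in>X. p y) / real (card X) = (\<integral>y. p y \<partial>sphere_sigma))"

definition empirical_measure :: "(real^3) set \<Rightarrow> (real^3) measure" where
  "empirical_measure X = distr (uniform_count_measure X) borel_sphere (\<lambda>y. y)"

lemma emeasure_empirical_measure:
  assumes "finite X" "X \<subseteq> sphere 0 1" "A \<in> sets borel_sphere"
  shows "emeasure (empirical_measure X) A = (\<Sum>y\<in>X. ennreal (1 / real (card X)) * indicator A y)"
proof -
  have m: "(\<lambda>y. y) \<in> measurable (uniform_count_measure X) borel_sphere"
    using assms by (auto simp: measurable_def uniform_count_measure_def
        space_point_measure sets_point_measure space_restrict_space)
  have "emeasure (empirical_measure X) A = emeasure (uniform_count_measure X) (A \<inter> X)"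
    unfolding empirical_measure_def using assms(3) m
    by (subst emeasure_distr) (auto simp: space_uniform_count_measure)
  also have "\<dots> = (\<Sum>y\<in>A \<inter> X. ennreal (1 / real (card X)))"
    unfolding uniform_count_measure_def using assms(1)
    by (subst emeasure_point_measure_finite) auto
  also have "\<dots> = (\<Sum>y\<in>X. ennreal (1 / real (card X)) * indicator A y)"
    using assms(1) by (intro sum.mono_neutral_cong_left) auto
  finally show ?thesis .
qed

definition convex_body :: "(real^3) set \<Rightarrow> bool" where
  "convex_body K \<longleftrightarrow> compact K \<and> convex K \<and> interior K \<noteq> {}"

definition outer_unit_normal :: "(real^3) set \<Rightarrow> real^3 \<Rightarrow> real^3 \<Rightarrow> bool" where
  "outer_unit_normal K y u \<longleftrightarrow> norm u = 1 \<and> (\<forall>z\<in>K. u \<bullet> (z - y) \<le> 0)"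

text \<open>The outer unit normal map lives on the boundary points with exactly one outer unit
  normal; for a convex body this is all of the boundary up to a set of area zero.\<close>

definition regular_boundary :: "(real^3) set \<Rightarrow> (real^3) set" where
  "regular_boundary K = {y \<in> frontier K. \<exists>!u. outer_unit_normal K y u}"

definition normal_map :: "(real^3) set \<Rightarrow> real^3 \<Rightarrow> real^3" where
  "normal_map K y = (THE u. outer_unit_normal K y u)"

definition surface_area_measure :: "(real^3) set \<Rightarrow> (real^3) measure" where
  "surface_area_measure K =
     distr (restrict_space area_measure (regular_boundary K)) borel_sphere (normal_map K)"

text \<open>The push-forward is well formed: its domain is a Borel set and the normal map is
  measurable.\<close>

lemma closed_normal_graph:
  "closed {p :: (real^3) \<times> 'a::topological_space. outer_unit_normal K (fst p) (f (snd p))}"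
  if "continuous_on UNIV f"
proof -
  have "{p. outer_unit_normal K (fst p) (f (snd p))} =
      {p. norm (f (snd p)) = 1} \<inter> (\<Inter>z\<in>K. {p. f (snd p) \<bullet> (z - fst p) \<le> 0})"
    by (auto simp: outer_unit_normal_def)
  moreover have "continuous_on UNIV (\<lambda>p :: (real^3) \<times> 'a. f (snd p))"
    by (rule continuous_on_compose2[OF that]) (auto intro: continuous_intros)
  ultimately show ?thesis
    by (auto intro!: closed_Int closed_INT closed_Collect_eq closed_Collect_le continuous_intros)
qed

lemma closed_projection_compact:
  fixes G :: "((real^3) \<times> 'a::metric_space) set"
  assumes "compact T" "closed G"
  shows "closed {y. \<exists>u\<in>T. (y, u) \<in> G}"
proof -
  have "closed (fst ` (G \<inter> (UNIV \<times> T)))"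
    unfolding closed_sequential_limits
  proof (intro allI impI, elim conjE)
    fix y l assume y: "\<forall>n. y n \<in> fst ` (G \<inter> (UNIV \<times> T))" and l: "y \<longlonglongrightarrow> l"
    then have "\<forall>n. \<exists>u. (y n, u) \<in> G \<and> u \<in> T" by fastforce
    then obtain u where u: "\<And>n. (y n, u n) \<in> G" "\<And>n. u n \<in> T" by metis
    then obtain v s where v: "v \<in> T" "strict_mono s" "(u \<circ> s) \<longlonglongrightarrow> v"
      using \<open>compact T\<close> unfolding compact_def by blast
    have "(\<lambda>n. ((y \<circ> s) n, (u \<circ> s) n)) \<longlonglongrightarrow> (l, v)"
      using v(3) LIMSEQ_subseq_LIMSEQ[OF l v(2)] by (rule tendsto_Pair[rotated])
    then have "(l, v) \<in> G"
      using u(1) by (auto intro: closed_sequentially[OF \<open>closed G\<close>, rotated] simp del: split_paired_All)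
    then show "l \<in> fst ` (G \<inter> (UNIV \<times> T))" using v(1) by force
  qed
  moreover have "fst ` (G \<inter> (UNIV \<times> T)) = {y. \<exists>u\<in>T. (y, u) \<in> G}" by force
  ultimately show ?thesis by simp
qed

lemma closed_normal_preimage:
  assumes "closed C"
  shows "closed {y. \<exists>u\<in>C. outer_unit_normal K y u}"
proof -
  have "closed {y. \<exists>u\<in>C \<inter> sphere 0 1. (y, u) \<in> {p. outer_unit_normal K (fst p) (id (snd p))}}"
    using assms by (intro closed_projection_compact closed_normal_graph)
      (auto intro: closed_Int_compact simp: id_def)
  moreover have "{y. \<exists>u\<in>C \<inter> sphere 0 1. (y, u) \<in> {p. outer_unit_normal K (fst p) (id (snd p))}}
      = {y. \<exists>u\<in>C. outer_unit_normal K y u}"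
    by (auto simp: outer_unit_normal_def)
  ultimately show ?thesis by simp
qed

lemma regular_boundary_borel: "regular_boundary K \<in> sets borel"
proof -
  define T :: "nat \<Rightarrow> ((real^3) \<times> (real^3)) set" where
    "T n = (sphere 0 1 \<times> sphere 0 1) \<inter> {q. inverse (real (Suc n)) \<le> dist (fst q) (snd q)}" for n
  define G where "G = {p. outer_unit_normal K (fst p) (fst (snd p))} \<inter>
    {p. outer_unit_normal K (fst p) (snd (snd p))}"
  have "closed G"
    unfolding G_def
    by (intro closed_Int closed_normal_graph continuous_intros)
  have "compact (T n)" for n
    unfolding T_def
    by (intro compact_Int_closed compact_Times closed_Collect_le continuous_intros) auto
  then have cl: "closed {y. \<exists>q\<in>T n. (y, q) \<in> G}" for n
    using \<open>closed G\<close> by (rule closed_projection_compact)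
  have "regular_boundary K = frontier K \<inter> {y. \<exists>u\<in>UNIV. outer_unit_normal K y u}
      - (\<Union>n. {y. \<exists>q\<in>T n. (y, q) \<in> G})" (is "_ = ?R")
  proof
    show "regular_boundary K \<subseteq> ?R"
    proof
      fix y assume y: "y \<in> regular_boundary K"
      then obtain u where u: "outer_unit_normal K y u"
        and unique: "\<And>v. outer_unit_normal K y v \<Longrightarrow> v = u"
        by (auto simp: regular_boundary_def)
      have "(y, q) \<notin> G" if "q \<in> T n" for q n
      proof
        assume "(y, q) \<in> G"
        then have "fst q = u" "snd q = u" using unique by (auto simp: G_def)
        then have "inverse (real (Suc n)) \<le> 0" using that by (auto simp: T_def)
        moreover have "0 < inverse (real (Suc n))" by simp
        ultimately show False by linarith
      qed
      with u y show "y \<in> ?R" by (auto simp: regular_boundary_def)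
    qed
    show "?R \<subseteq> regular_boundary K"
    proof
      fix y assume y: "y \<in> ?R"
      then obtain u where u: "outer_unit_normal K y u" by auto
      have "v = u" if v: "outer_unit_normal K y v" for v
      proof (rule ccontr)
        assume "v \<noteq> u"
        then obtain n where "inverse (real (Suc n)) < dist u v"
          using reals_Archimedean[of "dist u v"] by auto
        then have "(u, v) \<in> T n" "(y, (u, v)) \<in> G"
          using u v by (auto simp: T_def G_def outer_unit_normal_def)
        then show False using y by blast
      qed
      with u y show "y \<in> regular_boundary K" by (auto simp: regular_boundary_def)
    qed
  qed
  also have "\<dots> \<in> sets borel"
    using cl closed_normal_preimage[of UNIV K]
    by (intro sets.Diff sets.Int sets.countable_UN) (auto intro: borel_closed)
  finally show ?thesis .
qed

lemma normal_map_eq: "y \<in> regular_boundary K \<Longrightarrow> outer_unit_normal K y u \<longleftrightarrow> normal_map K y = u"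
proof -
  assume "y \<in> regular_boundary K"
  then have ex1: "\<exists>!u. outer_unit_normal K y u" by (simp add: regular_boundary_def)
  then have "outer_unit_normal K y (normal_map K y)" unfolding normal_map_def by (rule theI')
  with ex1 show ?thesis by auto
qed

lemma normal_map_measurable:
  "normal_map K \<in> measurable (restrict_space area_measure (regular_boundary K)) borel_sphere"
proof (rule measurable_restrict_space2)
  have "norm (normal_map K y) = 1" if "y \<in> regular_boundary K" for y
    using normal_map_eq[OF that, of "normal_map K y"] by (simp add: outer_unit_normal_def)
  then show "normal_map K \<in> space (restrict_space area_measure (regular_boundary K)) \<rightarrow> sphere 0 1"
    by (auto simp: space_restrict_space space_area_measure)
  show "normal_map K \<in> borel_measurable (restrict_space area_measure (regular_boundary K))"
    unfolding borel_eq_closed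
  proof (rule measurable_measure_of)
    fix C :: "(real^3) set" assume "C \<in> Collect closed"
    then have "{y. \<exists>u\<in>C. outer_unit_normal K y u} \<in> sets borel"
      using closed_normal_preimage by auto
    moreover have "normal_map K -` C \<inter> space (restrict_space area_measure (regular_boundary K)) =
        regular_boundary K \<inter> {y. \<exists>u\<in>C. outer_unit_normal K y u}"
      using normal_map_eq by (auto simp: space_restrict_space space_area_measure)
    ultimately show "normal_map K -` C \<inter> space (restrict_space area_measure (regular_boundary K))
        \<in> sets (restrict_space area_measure (regular_boundary K))"
      by (auto simp: sets_restrict_space sets_area_measure)
  qed auto
qed

lemma emeasure_surface_area_measure:
  assumes "A \<in> sets borel_sphere"
  shows "emeasure (surface_area_measure K) A =
    emeasure area_measure {y \<in> regular_boundary K. normal_map K y \<in> A}"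
proof -
  have "emeasure (surface_area_measure K) A = emeasure (restrict_space area_measure (regular_boundary K))
      {y \<in> regular_boundary K. normal_map K y \<in> A}"
    unfolding surface_area_measure_def
    by (subst emeasure_distr[OF normal_map_measurable assms])
      (auto simp: space_restrict_space space_area_measure intro!: arg_cong[where f = "emeasure _"])
  also have "\<dots> = emeasure area_measure {y \<in> regular_boundary K. normal_map K y \<in> A}"
    using regular_boundary_borel[of K]
    by (intro emeasure_restrict_space) (auto simp: space_area_measure sets_area_measure)
  finally show ?thesis .
qed

end

theory Submission
  imports Defs
begin

text \<open>Second moments of a design of degree at least 2 show that the normals sum to zero and span
  space, so every system of halfspaces \<open>x i \<bullet> y \<le> h i\<close> cuts out a bounded polytope. Its volume, as a
  function of \<open>h\<close>, is differentiable with the face areas as partial derivatives. Hence a maximizer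
  of the volume among all \<open>h\<close> with bounded sum has equal face areas, and scaling gives existence.

  A convex body whose surface area measure is carried by finitely many normals is the intersection
  of its supporting halfspaces with these normals: any part of the boundary that is seen from
  outside near a point satisfying all these inequalities would consist of irregular points up to
  area zero, whereas a concave function is differentiable almost everywhere. Two polytopes with the
  same normals and the same equal areas are translates by the equality case of the
  Brunn--Minkowski inequality.

  Planar area in the Hausdorff sense is only known to be some positive multiple \<open>\<kappa>\<close> of Lebesgue
  measure, the same for all planes. The value of \<open>\<kappa>\<close> is irrelevant, so the isodiametric
  inequality is not needed.\<close>

section \<open>Area of subsets of planes\<close>

text \<open>Uniqueness would usually go through Minkowski's inequality for mixed volumes. Here all
  competitors have equal face areas, so the derivative of the volume along a segment between two of
  them depends only on the sums of their support numbers. Comparison with the maximizer then leads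
  straight to the equality case, and mixed volumes never appear.

  Two obstacles shape the details. Face areas jump when two antipodal halfspaces share their
  boundary plane, and a design may well contain antipodal points; positive volume excludes this
  position. Moreover, nothing is known in advance about the area of the sphere, not even that it is
  finite. Finiteness is read off from the design itself: for infinite total mass the integral of the
  constant 1 takes the default value 0, whereas its average over the points is 1. A finite area of
  the sphere makes area locally finite on planes, which allows the comparison with Lebesgue measure.
  The moments of the design need only the invariance of area under isometries, so no surface
  integral is ever computed.\<close>

lemma area_outer_nonexpansive_image:
  fixes f :: "real^3 \<Rightarrow> real^3"
  assumes f: "\<And>a b. a \<in> S \<Longrightarrow> b \<in> S \<Longrightarrow> dist (f a) (f b) \<le> dist a b"
  shows "area_outer (f ` S) \<le> area_outer S"
proof -
  have "area_pre \<delta> (f ` S) \<le> area_pre \<delta> S" if "\<delta> > 0" for \<delta>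
    unfolding area_pre_def[of \<delta> S]
  proof (rule INF_greatest, safe)
    fix C :: "nat \<Rightarrow> (real^3) set"
    assume C: "S \<subseteq> (\<Union>i. C i)" "\<forall>i. bounded (C i) \<and> diameter (C i) \<le> \<delta>"
    \<comment> \<open>The pieces are cut down to \<open>S\<close> before mapping, because
      \<open>f\<close> is nonexpansive only there.\<close>
    define D where "D i = f ` (C i \<inter> S)" for i
    have dD: "dist a b \<le> diameter (C i)" if "a \<in> D i" "b \<in> D i" for a b i
    proof -
      obtain a' b' where ab: "a' \<in> C i" "a' \<in> S" "b' \<in> C i" "b' \<in> S" "a = f a'" "b = f b'"
        using \<open>a \<in> D i\<close> \<open>b \<in> D i\<close> by (auto simp: D_def)
      have "dist a b \<le> dist a' b'" using f ab by simp
      also have "\<dots> \<le> diameter (C i)" using C(2) ab by (intro diameter_bounded_bound) auto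
      finally show ?thesis .
    qed
    have bD: "bounded (D i)" for i
      unfolding bounded_def
    proof (cases "D i = {}")
      case False
      then obtain a where "a \<in> D i" by auto
      then show "\<exists>x e. \<forall>y\<in>D i. dist x y \<le> e" using dD by blast
    qed auto
    have dg: "0 \<le> diameter (C i)" for i using C(2) by (simp add: diameter_ge_0)
    have di: "diameter (D i) \<le> diameter (C i)" for i
      using dD dg by (intro diameter_le) (auto simp: dist_norm)
    have "area_pre \<delta> (f ` S) \<le> (\<Sum>i. ennreal (pi / 4 * (diameter (D i))\<^sup>2))"
      using C di bD by (intro area_pre_le) (force simp: D_def intro: order_trans)+
    also have "\<dots> \<le> (\<Sum>i. ennreal (pi / 4 * (diameter (C i))\<^sup>2))"
      using di bD by (intro suminf_le ennreal_leI mult_left_mono power_mono) (auto simp: diameter_ge_0)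
    finally show "area_pre \<delta> (f ` S) \<le> (\<Sum>i. ennreal (pi / 4 * (diameter (C i))\<^sup>2))" .
  qed
  then show ?thesis unfolding area_outer_def by (intro SUP_mono) auto
qed

lemma area_outer_isometric_image:
  fixes f :: "real^3 \<Rightarrow> real^3"
  assumes f: "\<And>a b. a \<in> S \<Longrightarrow> b \<in> S \<Longrightarrow> dist (f a) (f b) = dist a b"
  shows "area_outer (f ` S) = area_outer S"
proof (rule antisym)
  show "area_outer (f ` S) \<le> area_outer S"
    using f by (intro area_outer_nonexpansive_image) auto
  have inj: "inj_on f S" using f by (auto simp: inj_on_def) (metis dist_eq_0_iff)
  have "area_outer (inv_into S f ` f ` S) \<le> area_outer (f ` S)"
    using f inj by (intro area_outer_nonexpansive_image) auto
  then show "area_outer S \<le> area_outer (f ` S)"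
    using inj by (simp add: image_image)
qed

text \<open>Integrate the indicator of the pairs with \<open>x\<close> in \<open>A\<close> and
  \<open>x + y\<close> in \<open>B\<close> in both orders. Invariance of Lebesgue measure in
  \<open>y\<close> gives the left side; invariance of \<open>\<mu>\<close> in \<open>x\<close>,
  followed by a reflection in \<open>y\<close>, gives the right side. The cross-multiplied form
  needs no reference set of finite positive measure.\<close>

lemma translation_invariant_measure_unique:
  fixes \<mu> :: "'a::euclidean_space measure"
  assumes sets: "sets \<mu> = sets borel" and sf: "sigma_finite_measure \<mu>"
    and inv: "\<And>a. distr \<mu> borel ((+) a) = \<mu>"
    and A: "A \<in> sets borel" and B: "B \<in> sets borel"
  shows "emeasure \<mu> A * emeasure lborel B = emeasure \<mu> B * emeasure lborel A"
proof -
  interpret \<mu>: sigma_finite_measure \<mu> by fact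
  interpret pair_sigma_finite \<mu> lborel by standard
  have [measurable_cong]: "sets \<mu> = sets borel" by fact
  note [measurable] = A B
  have sp: "space \<mu> = UNIV" using sets_eq_imp_space_eq[OF sets] by simp
  have reflect: "(\<integral>\<^sup>+y. indicator A (x - y) \<partial>lborel) = emeasure lborel A" for x :: 'a
  proof -
    have "distr lborel borel (\<lambda>y. x - y) = lborel"
      using lborel_affine[of "-1" x] by (simp add: density_1)
    then have "emeasure lborel A = emeasure (distr lborel borel (\<lambda>y. x - y)) A" by simp
    also have "\<dots> = (\<integral>\<^sup>+y. indicator A (x - y) \<partial>lborel)"
      by (subst emeasure_distr, simp, simp, subst nn_integral_indicator[symmetric])
        (auto simp: indicator_def intro!: nn_integral_cong measurable_sets_borel[OF _ A])
    finally show ?thesis by simp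
  qed
  have tr: "(\<integral>\<^sup>+y. indicator B (x + y) \<partial>lborel) = emeasure lborel B" for x :: 'a
  proof -
    have "(\<integral>\<^sup>+y. indicator B (x + y) \<partial>lborel) = (\<integral>\<^sup>+y. indicator B y \<partial>(distr lborel borel ((+) x)))"
      by (subst nn_integral_distr) auto
    then show ?thesis by (simp add: lborel_distr_plus)
  qed
  have mu: "(\<integral>\<^sup>+x. indicator A x * indicator B (x + y) \<partial>\<mu>) = (\<integral>\<^sup>+x. indicator A (x - y) * indicator B x \<partial>\<mu>)" for y
  proof -
    have "(\<integral>\<^sup>+x. indicator A (x - y) * indicator B x \<partial>\<mu>) =
       (\<integral>\<^sup>+x. indicator A (x - y) * indicator B x \<partial>(distr \<mu> borel ((+) y)))" by (simp add: inv)
    also have "\<dots> = (\<integral>\<^sup>+x. indicator A x * indicator B (x + y) \<partial>\<mu>)"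
      by (subst nn_integral_distr) (auto simp: add.commute)
    finally show ?thesis ..
  qed
  have "emeasure \<mu> A * emeasure lborel B = (\<integral>\<^sup>+x. indicator A x * emeasure lborel B \<partial>\<mu>)"
    by (subst nn_integral_multc) auto
  also have "\<dots> = (\<integral>\<^sup>+x. (\<integral>\<^sup>+y. indicator A x * indicator B (x + y) \<partial>lborel) \<partial>\<mu>)"
    by (intro nn_integral_cong) (simp add: nn_integral_cmult tr)
  also have "\<dots> = (\<integral>\<^sup>+y. (\<integral>\<^sup>+x. indicator A x * indicator B (x + y) \<partial>\<mu>) \<partial>lborel)"
    by (subst Fubini') auto
  also have "\<dots> = (\<integral>\<^sup>+y. (\<integral>\<^sup>+x. indicator A (x - y) * indicator B x \<partial>\<mu>) \<partial>lborel)"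
    by (simp add: mu)
  also have "\<dots> = (\<integral>\<^sup>+x. (\<integral>\<^sup>+y. indicator A (x - y) * indicator B x \<partial>lborel) \<partial>\<mu>)"
    by (subst Fubini') auto
  also have "\<dots> = (\<integral>\<^sup>+x. emeasure lborel A * indicator B x \<partial>\<mu>)"
    by (intro nn_integral_cong) (simp add: nn_integral_multc reflect)
  also have "\<dots> = emeasure \<mu> B * emeasure lborel A"
    by (subst nn_integral_cmult) (auto simp: mult.commute)
  finally show ?thesis .
qed

section \<open>Linear isometries from the product type onto three-space\<close>

definition frame :: "(real \<times> real \<times> real \<Rightarrow> real^3) \<Rightarrow> bool" where
  "frame T \<longleftrightarrow> linear T \<and> (\<forall>p. norm (T p) = norm p)"

text \<open>Take any linear isometry between the two spaces and follow it by an orthogonal map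
  carrying the image of the first axis to \<open>u\<close>.\<close>

lemma frame_exists:
  assumes "norm u = 1"
  obtains T where "frame T" "T (1, 0, 0) = u"
proof -
  obtain f :: "real \<times> real \<times> real \<Rightarrow> real^3" and g where f: "linear f" "\<And>p. norm (f p) = norm p"
    by (rule isomorphisms_UNIV_UNIV[where 'M = "real \<times> real \<times> real" and 'N = "real^3"]) auto
  have "norm (f (1, 0, 0)) = norm u" using f(2) assms by (simp add: norm_Pair)
  then obtain r where r: "orthogonal_transformation r" "r (f (1, 0, 0)) = u"
    by (rule orthogonal_transformation_exists)
  have "frame (r \<circ> f)"
    using f r by (auto simp: frame_def linear_compose orthogonal_transformation)
  then show ?thesis using r that by auto
qed

lemma frame_linear: "frame T \<Longrightarrow> linear T" and frame_norm: "frame T \<Longrightarrow> norm (T p) = norm p"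
  by (auto simp: frame_def simp del: split_paired_All)

lemma frame_dist: "frame T \<Longrightarrow> dist (T p) (T q) = dist p q"
  by (metis dist_norm frame_linear frame_norm linear_diff)

lemma frame_inner: "frame T \<Longrightarrow> T p \<bullet> T q = p \<bullet> q"
  by (simp add: dot_norm frame_norm flip: linear_add[OF frame_linear])

lemma frame_bij: assumes "frame T" shows "bij T"
proof -
  have "inj T" by (rule injI) (metis assms dist_eq_0_iff frame_dist)
  moreover have "surj T"
  proof -
    have "dim (range T) = DIM(real^3)"
      using dim_image_eq[OF frame_linear[OF assms], of UNIV] \<open>inj T\<close> by (simp add: inj_on_subset)
    moreover have "span (range T) = range T"
      using linear_subspace_image[OF frame_linear[OF assms] subspace_UNIV] by (rule span_eq_iff[THEN iffD2])
    ultimately show ?thesis using dim_eq_full[of "range T"] by presburger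
  qed
  ultimately show ?thesis by (simp add: bij_def)
qed

lemma frame_measurable: "frame T \<Longrightarrow> T \<in> borel_measurable borel"
  by (auto intro!: borel_measurable_continuous_onI linear_continuous_on linear_linear[THEN iffD1] frame_linear
      simp: linear_conv_bounded_linear[symmetric])

text \<open>Under a frame, Lebesgue measure on \<open>\<real>\<^sup>3\<close> can be sliced by the planes orthogonal to
  \<open>T (1, 0, 0)\<close> through Fubini's theorem on the product type.\<close>

lemma distr_frame:
  assumes T: "frame T"
  shows "distr lborel borel T = (lborel :: (real^3) measure)"
proof (rule measure_eqI)
  fix A assume "A \<in> sets (distr lborel borel T)"
  then have A: "A \<in> sets borel" by simp
  have [measurable]: "T \<in> borel_measurable borel" using T by (rule frame_measurable)
  let ?B = "ball (0::real^3) 1"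
  let ?\<mu> = "distr lborel borel T"
  have T_inv: "T (inv T c) = c" for c
    using frame_bij[OF T] by (simp add: bij_is_surj surj_f_inv_f)
  have inv_ball: "T -` ball c r = ball (inv T c) r" for c r
  proof (rule set_eqI)
    fix p show "p \<in> T -` ball c r \<longleftrightarrow> p \<in> ball (inv T c) r"
      using frame_dist[OF T, of "inv T c" p] by (simp add: T_inv)
  qed
  have ball: "emeasure ?\<mu> (ball c r) = emeasure lborel (ball (inv T c) r)" for c r
    by (subst emeasure_distr) (auto simp: inv_ball)
  have "emeasure ?\<mu> A * emeasure lborel ?B = emeasure ?\<mu> ?B * emeasure lborel A"
  proof (rule translation_invariant_measure_unique)
    show "sigma_finite_measure ?\<mu>"
    proof
      let ?C = "range (\<lambda>n::nat. ball (0::real^3) (real n))"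
      have "\<Union> ?C = space ?\<mu>" by (auto intro: reals_Archimedean2)
      moreover have "\<forall>a\<in>?C. emeasure ?\<mu> a \<noteq> \<infinity>" by (auto simp: ball emeasure_ball)
      ultimately show "\<exists>C. countable C \<and> C \<subseteq> sets ?\<mu> \<and> \<Union> C = space ?\<mu> \<and> (\<forall>a\<in>C. emeasure ?\<mu> a \<noteq> \<infinity>)"
        by (intro exI[of _ ?C]) auto
    qed
    show "distr ?\<mu> borel ((+) a) = ?\<mu>" for a
    proof -
      have "a + T p = T (inv T a + p)" for p
        by (simp add: linear_add[OF frame_linear[OF T]] T_inv)
      then have "distr ?\<mu> borel ((+) a) = distr (distr lborel borel ((+) (inv T a))) borel T"
        by (simp add: distr_distr comp_def)
      then show ?thesis by (simp add: lborel_distr_plus)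
    qed
  qed (use A in auto)
  \<comment> \<open>The isometry takes balls to balls of the same radius, so the constant of
    proportionality is 1.\<close>
  moreover have "emeasure ?\<mu> ?B = emeasure lborel ?B" by (simp add: ball emeasure_ball)
  moreover have "emeasure lborel ?B \<noteq> 0" "emeasure lborel ?B \<noteq> top"
    using less_imp_neq[OF unit_ball_vol_pos[of 3]] by (auto simp: emeasure_ball)
  ultimately show "emeasure ?\<mu> A = emeasure lborel A"
    by (simp add: ennreal_mult_cancel_left mult.commute[of _ "emeasure lborel ?B"])
qed simp

lemma frame_continuous: "frame T \<Longrightarrow> continuous_on S T"
  by (auto intro!: linear_continuous_on frame_linear simp: linear_conv_bounded_linear[symmetric])

lemma frame_inv: "frame T \<Longrightarrow> T (inv T y) = y" "frame T \<Longrightarrow> inv T (T p) = p"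
  using frame_bij[of T] by (simp_all add: bij_is_surj surj_f_inv_f bij_is_inj)

lemma frame_inv_dist: "frame T \<Longrightarrow> dist (inv T y) (inv T z) = dist y z"
  using frame_dist[of T "inv T y" "inv T z"] by (simp add: frame_inv)

lemma frame_inv_continuous: "frame T \<Longrightarrow> continuous_on S (inv T)"
  unfolding continuous_on_iff by (auto simp: frame_inv_dist)

lemma frame_image_slab:
  assumes T: "frame T" and [measurable]: "A \<in> sets borel"
  shows "T ` ({s} \<times> A) \<in> sets borel"
proof -
  have "inv T \<in> borel_measurable borel"
    by (intro borel_measurable_continuous_onI frame_inv_continuous T)
  moreover have "{s} \<times> A \<in> sets borel" by (intro borel_Times) auto
  ultimately have "inv T -` ({s} \<times> A) \<in> sets borel" by (rule measurable_sets_borel)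
  also have "inv T -` ({s} \<times> A) = T ` ({s} \<times> A)"
    using frame_bij[OF T] by (simp add: bij_vimage_eq_inv_image bij_imp_bij_inv inv_inv_eq)
  finally show ?thesis .
qed

text \<open>Projection along the first axis sends a covering set of diameter \<open>d\<close> into a
  disc of radius \<open>d\<close>, whose Lebesgue measure is four times the weight of that set;
  hence the bound \<open>e / 4\<close> on the cover.\<close>

lemma negligible_frame_projection:
  assumes T: "frame T" and S: "area_outer S = 0"
  shows "negligible {p. \<exists>t. T (t, p) \<in> S}"
  unfolding negligible_outer_le
proof (intro allI impI)
  fix e :: real assume "e > 0"
  have "area_pre 1 S < ennreal (e / 4)"
    using area_pre_le_outer[of 1 S] S \<open>e > 0\<close> by simp
  then obtain C where C: "S \<subseteq> (\<Union>i. C i)" "\<And>i. bounded (C i)"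
    "\<And>i. diameter (C i) \<le> 1"
    "(\<Sum>i. ennreal (pi / 4 * (diameter (C i))\<^sup>2)) < ennreal (e / 4)"
    by (elim area_pre_less) blast
  define c where "c i = snd (inv T (SOME y. y \<in> C i))" for i
  define B where "B i = cball (c i) (diameter (C i))" for i
  have emB: "emeasure lborel (B i) = 4 * ennreal (pi / 4 * (diameter (C i))\<^sup>2)" for i
    using C(2)[of i] unfolding B_def
    by (subst emeasure_cball)
      (auto simp: diameter_ge_0 power2_eq_square unit_ball_vol_2 ennreal_mult'[symmetric] simp flip: ennreal_numeral)
  have sub: "{p. \<exists>t. T (t, p) \<in> S} \<subseteq> (\<Union>i. B i)"
  proof safe
    fix t p assume "T (t, p) \<in> S"
    then obtain i where i: "T (t, p) \<in> C i" using C(1) by blast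
    then have "(SOME y. y \<in> C i) \<in> C i" by (metis someI)
    then have "dist (SOME y. y \<in> C i) (T (t, p)) \<le> diameter (C i)"
      using i C(2) by (intro diameter_bounded_bound)
    then have "dist (inv T (SOME y. y \<in> C i)) (t, p) \<le> diameter (C i)"
      using frame_inv_dist[OF T, of _ "T (t, p)"] by (simp add: frame_inv[OF T])
    then have "dist (c i) p \<le> diameter (C i)"
      unfolding c_def using dist_snd_le order_trans by (metis snd_conv)
    then show "p \<in> (\<Union>i. B i)" by (auto simp: B_def)
  qed
  have "emeasure lborel (\<Union>i. B i) \<le> (\<Sum>i. emeasure lborel (B i))"
    by (intro emeasure_subadditive_countably) (auto simp: B_def)
  also have "\<dots> = 4 * (\<Sum>i. ennreal (pi / 4 * (diameter (C i))\<^sup>2))"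
    by (simp add: emB)
  also have "\<dots> \<le> 4 * ennreal (e / 4)" using C(4) by (intro mult_left_mono) auto
  also have "\<dots> = ennreal e" by (simp add: ennreal_mult'[symmetric] flip: ennreal_numeral)
  finally have le: "emeasure lebesgue (\<Union>i. B i) \<le> ennreal e"
    by (subst emeasure_completion) (auto simp: B_def)
  have "(\<Union>i. B i) \<in> lmeasurable"
    using le by (intro fmeasurableI) (auto simp: B_def less_top intro: le_less_trans)
  moreover have "measure lebesgue (\<Union>i. B i) \<le> e"
    unfolding measure_def using le \<open>e > 0\<close> by (simp add: enn2real_leI)
  ultimately show "\<exists>U. {p. \<exists>t. T (t, p) \<in> S} \<subseteq> U \<and> U \<in> lmeasurable \<and> measure lebesgue U \<le> e"
    using sub by blast
qed

text \<open>A disc in a plane is the orthogonal projection of a sphere, so finiteness of the area of the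
  sphere makes the area finite on bounded subsets of planes.\<close>

lemma area_disc_finite:
  assumes fin: "area_outer (sphere 0 1) < top" and T: "frame T"
  shows "area_outer (T ` ({s} \<times> ball q 1)) < top"
proof -
  define f where "f y = T (s, q + snd (inv T y))" for y
  have "T ` ({s} \<times> ball q 1) \<subseteq> f ` sphere 0 1"
  proof safe
    fix b assume b: "b \<in> ball q 1"
    then have "norm (b - q) < 1" by (simp add: dist_norm norm_minus_commute)
    then have "norm (b - q) ^ 2 \<le> 1" by (simp add: power_le_one)
    then have "norm (T (sqrt (1 - norm (b - q) ^ 2), b - q)) = 1"
      by (simp add: frame_norm[OF T] norm_Pair)
    then show "T (s, b) \<in> f ` sphere 0 1"
      by (intro image_eqI[where x = "T (sqrt (1 - norm (b - q) ^ 2), b - q)"])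
        (auto simp: f_def frame_inv[OF T])
  qed
  then have "area_outer (T ` ({s} \<times> ball q 1)) \<le> area_outer (f ` sphere 0 1)" by (rule area_outer_mono)
  also have "\<dots> \<le> area_outer (sphere 0 1)"
  proof (rule area_outer_nonexpansive_image)
    fix a b
    have "dist (f a) (f b) = dist (snd (inv T a)) (snd (inv T b))"
      by (simp add: f_def frame_dist[OF T] dist_Pair_Pair)
    also have "\<dots> \<le> dist a b" using dist_snd_le frame_inv_dist[OF T] by metis
    finally show "dist (f a) (f b) \<le> dist a b" .
  qed
  finally show ?thesis using fin by simp
qed

text \<open>Area on the plane at height \<open>s\<close>, transported to the coordinate plane, is
  translation invariant because translations are isometries. It is sigma-finite because unit discs
  around a countable dense set cover the plane. Uniqueness of invariant measures then
  applies.\<close>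

lemma area_outer_plane_swap:
  assumes fin: "area_outer (sphere 0 1) < top" and T: "frame T"
    and A: "A \<in> sets borel" and B: "B \<in> sets borel"
  shows "area_outer (T ` ({s} \<times> A)) * emeasure lborel B = area_outer (T ` ({s} \<times> B)) * emeasure lborel A"
proof -
  let ?H = "T ` ({s} \<times> UNIV)"
  let ?p = "\<lambda>y. snd (inv T y)"
  define \<mu> where "\<mu> = distr (restrict_space area_measure ?H) borel ?p"
  have H: "?H \<in> sets borel" by (intro frame_image_slab T) simp
  have "?p \<in> borel_measurable borel"
    by (intro borel_measurable_continuous_onI continuous_intros frame_inv_continuous T)
  then have "?p \<in> borel_measurable area_measure"
    by (simp add: measurable_cong_sets[OF sets_area_measure refl])
  then have [measurable]: "?p \<in> borel_measurable (restrict_space area_measure ?H)"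
    by (rule measurable_restrict_space1)
  have em: "emeasure \<mu> C = area_outer (T ` ({s} \<times> C))" if [measurable]: "C \<in> sets borel" for C
  proof -
    have "emeasure \<mu> C = emeasure (restrict_space area_measure ?H)
        (?p -` C \<inter> space (restrict_space area_measure ?H))"
      unfolding \<mu>_def by (rule emeasure_distr) auto
    also have "?p -` C \<inter> space (restrict_space area_measure ?H) = T ` ({s} \<times> C)"
      by (auto simp: space_restrict_space space_area_measure frame_inv[OF T])
    also have "emeasure (restrict_space area_measure ?H) \<dots> = area_outer (T ` ({s} \<times> C))"
      using H frame_image_slab[OF T that, of s]
      by (subst emeasure_restrict_space)
        (auto simp: space_area_measure sets_area_measure emeasure_area_measure)
    finally show ?thesis .
  qed
  have sets: "sets \<mu> = sets borel" by (simp add: \<mu>_def)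
  have "emeasure \<mu> A * emeasure lborel B = emeasure \<mu> B * emeasure lborel A"
  proof (rule translation_invariant_measure_unique[OF sets _ _ A B])
    show "sigma_finite_measure \<mu>"
    proof
      obtain D :: "(real \<times> real) set" where D: "countable D" "\<And>X. open X \<Longrightarrow> X \<noteq> {} \<Longrightarrow> \<exists>d\<in>D. d \<in> X"
        using countable_dense_exists by auto
      let ?C = "(\<lambda>q. ball q 1) ` D"
      have "\<Union> ?C = space \<mu>"
      proof -
        have "p \<in> \<Union> ?C" for p
          using D(2)[of "ball p 1"] by (auto simp: dist_commute)
        then show ?thesis using sets_eq_imp_space_eq[OF sets] by auto
      qed
      moreover have "\<forall>a\<in>?C. emeasure \<mu> a \<noteq> \<infinity>"
        using area_disc_finite[OF fin T] by (auto simp: em less_top)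
      ultimately show "\<exists>C. countable C \<and> C \<subseteq> sets \<mu> \<and> \<Union> C = space \<mu> \<and> (\<forall>a\<in>C. emeasure \<mu> a \<noteq> \<infinity>)"
        using D(1) by (intro exI[of _ ?C]) (auto simp: sets)
    qed
    show "distr \<mu> borel ((+) a) = \<mu>" for a
    proof (rule measure_eqI)
      fix C assume "C \<in> sets (distr \<mu> borel ((+) a))"
      then have C: "C \<in> sets borel" by simp
      have m: "(+) a \<in> borel_measurable (borel :: (real \<times> real) measure)" by simp
      have vC: "(+) a -` C \<in> sets borel" using measurable_sets[OF m C] by simp
      have "emeasure (distr \<mu> borel ((+) a)) C = emeasure \<mu> ((+) a -` C)"
        using m C sets_eq_imp_space_eq[OF sets]
        by (subst emeasure_distr) (auto simp: measurable_cong_sets[OF sets refl])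
      also have "\<dots> = area_outer (T ` ({s} \<times> ((+) a -` C)))" by (rule em[OF vC])
      also have "\<dots> = area_outer ((\<lambda>y. y + T (0, a)) ` T ` ({s} \<times> ((+) a -` C)))"
        by (rule area_outer_isometric_image[symmetric]) simp
      also have "(\<lambda>y. y + T (0, a)) ` T ` ({s} \<times> ((+) a -` C)) = T ` ({s} \<times> C)"
      proof -
        have "T (s, p) + T (0, a) = T (s, a + p)" for p
          by (simp add: linear_add[OF frame_linear[OF T], symmetric] add.commute)
        then have "(\<lambda>y. y + T (0, a)) ` T ` ({s} \<times> ((+) a -` C)) = (\<lambda>p. T (s, a + p)) ` ((+) a -` C)"

          by (simp only: flip: \<open>\<And>p. T (s, p) + T (0, a) = T (s, a + p)\<close>) force
        also have "\<dots> = (\<lambda>p. T (s, p)) ` (+) a ` (+) a -` C" by (simp only: image_image)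
        also have "(+) a ` (+) a -` C = C" by (intro surj_image_vimage_eq surj_plus)
        finally show ?thesis by auto
      qed
      finally show "emeasure (distr \<mu> borel ((+) a)) C = emeasure \<mu> C" by (simp add: em[OF C])
    qed (simp add: sets)
  qed
  then show ?thesis by (simp add: em A B)
qed

text \<open>\<open>\<kappa>\<close> is the area of one reference unit disc divided by
  \<open>pi\<close>. It is positive since a disc of area zero would have a negligible projection,
  yet the reference disc projects onto a full disc. Isometries carry it to every other
  plane.\<close>

lemma area_outer_planar:
  assumes fin: "area_outer (sphere 0 1) < top"
  obtains \<kappa> :: real where "\<kappa> > 0"
    "\<And>T s A. frame T \<Longrightarrow> A \<in> sets borel \<Longrightarrow> area_outer (T ` ({s} \<times> A)) = ennreal \<kappa> * emeasure lborel A"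
proof -
  obtain T0 where T0: "frame T0" "T0 (1, 0, 0) = axis 1 1"
    by (rule frame_exists[of "axis 1 1"]) auto
  let ?B = "ball (0 :: real \<times> real) 1"
  define a where "a = area_outer (T0 ` ({0} \<times> ?B))"
  have "a \<noteq> top" using area_disc_finite[OF fin T0(1)] by (simp add: a_def less_top)
  have B: "emeasure lborel ?B = ennreal pi" by (simp add: emeasure_ball unit_ball_vol_2)
  have "a \<noteq> 0"
  proof
    assume "a = 0"
    then have "negligible {p. \<exists>t. T0 (t, p) \<in> T0 ` ({0} \<times> ?B)}"
      unfolding a_def by (rule negligible_frame_projection[OF T0(1)])
    then have "negligible ?B" by (rule negligible_subset) auto
    then show False using B by (simp add: negligible_iff_emeasure0)
  qed
  define \<kappa> where "\<kappa> = enn2real a / pi"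
  have "\<kappa> > 0" using \<open>a \<noteq> 0\<close> \<open>a \<noteq> top\<close> by (simp add: \<kappa>_def enn2real_positive_iff less_top zero_less_iff_neq_zero)
  moreover have "area_outer (T ` ({s} \<times> A)) = ennreal \<kappa> * emeasure lborel A"
    if T: "frame T" and A: "A \<in> sets borel" for T s A
  proof -
    \<comment> \<open>This isometry takes the plane at height \<open>s\<close> in the frame
      \<open>T\<close> to the plane at height 0 in the reference frame.\<close>
    define f where "f y = T0 ((- s, 0) + inv T y)" for y
    have "area_outer (f ` T ` ({s} \<times> ?B)) = area_outer (T ` ({s} \<times> ?B))"
      by (rule area_outer_isometric_image) (simp add: f_def frame_dist[OF T0(1)] frame_inv_dist[OF T])
    moreover have "f ` T ` ({s} \<times> ?B) = T0 ` ({0} \<times> ?B)"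
      by (force simp: f_def image_iff frame_inv[OF T])
    ultimately have a: "area_outer (T ` ({s} \<times> ?B)) = a" by (simp add: a_def)
    have "area_outer (T ` ({s} \<times> A)) * ennreal pi = a * emeasure lborel A"
      using area_outer_plane_swap[OF fin T A, of ?B s] by (simp add: B a)
    also have "a = ennreal \<kappa> * ennreal pi"
      using \<open>a \<noteq> top\<close> by (simp add: \<kappa>_def ennreal_mult'[symmetric] less_top)
    finally have "ennreal pi * area_outer (T ` ({s} \<times> A)) = ennreal pi * (ennreal \<kappa> * emeasure lborel A)"
      by (simp add: mult_ac)
    then show ?thesis by (simp add: ennreal_mult_cancel_left)
  qed
  ultimately show ?thesis using that by blast
qed

section \<open>The Brunn--Minkowski inequality\<close>

text \<open>The Minkowski combination of two sets.\<close>

definition combine :: "real \<Rightarrow> 'a::real_vector set \<Rightarrow> 'a set \<Rightarrow> 'a set" where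
  "combine s A B = (\<lambda>(a, b). (1 - s) *\<^sub>R a + s *\<^sub>R b) ` (A \<times> B)"

lemma combineI: "a \<in> A \<Longrightarrow> b \<in> B \<Longrightarrow> (1 - s) *\<^sub>R a + s *\<^sub>R b \<in> combine s A B"
  by (auto simp: combine_def)

lemma combineE:
  assumes "z \<in> combine s A B"
  obtains a b where "a \<in> A" "b \<in> B" "z = (1 - s) *\<^sub>R a + s *\<^sub>R b"
  using assms by (auto simp: combine_def)

lemma compact_combine:
  fixes A B :: "'a::real_normed_vector set"
  assumes "compact A" "compact B"
  shows "compact (combine s A B)"
  unfolding combine_def case_prod_beta
  by (intro compact_continuous_image continuous_intros compact_Times assms)

lemma convex_combine:
  assumes "convex A" "convex B"
  shows "convex (combine s A B)"
proof -
  have "linear (\<lambda>p::'a \<times> 'a. (1 - s) *\<^sub>R fst p + s *\<^sub>R snd p)"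
    by (auto intro!: linearI simp: algebra_simps)
  then show ?thesis
    unfolding combine_def case_prod_beta by (intro convex_linear_image convex_Times assms)
qed

lemma combine_mono: "A \<subseteq> A' \<Longrightarrow> B \<subseteq> B' \<Longrightarrow> combine s A B \<subseteq> combine s A' B'"
  by (auto simp: combine_def)

lemma combine_convex_subset: "convex A \<Longrightarrow> 0 \<le> s \<Longrightarrow> s \<le> 1 \<Longrightarrow> combine s A A \<subseteq> A"
  by (auto elim!: combineE intro: convexD_alt)

lemma weighted_geometric_mean_le:
  fixes a b s :: real
  assumes "0 \<le> a" "0 \<le> b" "0 < s" "s < 1"
  shows "a powr (1 - s) * b powr s \<le> (1 - s) * a + s * b"
  using assms Youngs_inequality_0[of "1 - s" s a b] by (cases "a = 0 \<or> b = 0") auto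

lemma emeasure_compact: "compact A \<Longrightarrow> emeasure lborel A = ennreal (measure lborel A)"
  by (intro emeasure_eq_ennreal_measure) (use emeasure_compact_finite in \<open>auto simp: less_top\<close>)

lemma fmeasurable_compact: "compact A \<Longrightarrow> A \<in> fmeasurable lborel"
  by (intro fmeasurableI) (auto simp: emeasure_compact borel_compact)

text \<open>Tonelli's theorem on the region between the axis and the graph.\<close>

lemma layer_cake:
  fixes f :: "real \<Rightarrow> real"
  assumes [measurable]: "f \<in> borel_measurable borel" and f0: "\<And>x. 0 \<le> f x"
  shows "(\<integral>\<^sup>+x. f x \<partial>lborel) = (\<integral>\<^sup>+c. indicator {0<..} c * emeasure lborel {x. c < f x} \<partial>lborel)"
proof -
  have "(\<integral>\<^sup>+x. f x \<partial>lborel) = (\<integral>\<^sup>+x. (\<integral>\<^sup>+c. indicator {0<..<f x} c \<partial>lborel) \<partial>lborel)"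
    using f0 by simp
  also have "\<dots> = (\<integral>\<^sup>+x. (\<integral>\<^sup>+c. indicator {0<..} c * indicator {p. snd p < f (fst p)} (x, c) \<partial>lborel) \<partial>lborel)"
    by (intro nn_integral_cong) (auto simp: indicator_def)
  also have "\<dots> = (\<integral>\<^sup>+c. (\<integral>\<^sup>+x. indicator {0<..} c * indicator {p. snd p < f (fst p)} (x, c) \<partial>lborel) \<partial>lborel)"
    by (subst lborel_pair.Fubini') auto
  also have "\<dots> = (\<integral>\<^sup>+c. indicator {0<..} c * (\<integral>\<^sup>+x. indicator {x. c < f x} x \<partial>lborel) \<partial>lborel)"
    by (intro nn_integral_cong, subst nn_integral_cmult[symmetric])
      (auto simp: indicator_def intro!: nn_integral_cong)
  also have "\<dots> = (\<integral>\<^sup>+c. indicator {0<..} c * emeasure lborel {x. c < f x} \<partial>lborel)"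
    by (simp add: nn_integral_indicator)
  finally show ?thesis .
qed

text \<open>Convex sets on the line are intervals up to end points, so lengths simply add. The sets
  need not be closed, and the right side is an arbitrary Borel superset, because superlevel sets of
  functions are to be inserted.\<close>

lemma emeasure_combine_real_ge:
  fixes A B C :: "real set"
  assumes A: "convex A" "bounded A" "A \<noteq> {}" and B: "convex B" "bounded B" "B \<noteq> {}"
    and s: "0 < s" "s < 1" and C: "combine s A B \<subseteq> C" "C \<in> sets borel"
  shows "ennreal (1 - s) * emeasure lborel A + ennreal s * emeasure lborel B \<le> emeasure lborel C"
proof -
  have bd: "bdd_above A" "bdd_below A" "bdd_above B" "bdd_below B"
    using A B by (auto simp: bounded_imp_bdd_above bounded_imp_bdd_below)
  have len: "emeasure lborel X \<le> ennreal (Sup X - Inf X)" "Inf X \<le> Sup X"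
    if "bdd_above X" "bdd_below X" "X \<noteq> {}" for X :: "real set"
  proof -
    have "X \<subseteq> {Inf X..Sup X}" using that by (auto intro: cInf_lower cSup_upper)
    then have "emeasure lborel X \<le> emeasure lborel {Inf X..Sup X}" by (intro emeasure_mono) auto
    moreover show "Inf X \<le> Sup X" using that by (intro cInf_le_cSup)
    ultimately show "emeasure lborel X \<le> ennreal (Sup X - Inf X)" by simp
  qed
  let ?l = "(1 - s) * Inf A + s * Inf B" and ?r = "(1 - s) * Sup A + s * Sup B"
  have "{?l<..<?r} \<subseteq> C"
  proof
    fix z assume z: "z \<in> {?l<..<?r}"
    \<comment> \<open>The slack of \<open>z\<close> at both ends: combinations of points within
      \<open>e\<close> of the infima, respectively suprema, enclose \<open>z\<close>.\<close>
    define e where "e = min (z - ?l) (?r - z)"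
    have e: "e > 0" "?l + e \<le> z" "z \<le> ?r - e" using z by (auto simp: e_def)
    obtain a1 where a1: "a1 \<in> A" "a1 < Inf A + e" using cInf_lessD[of A "Inf A + e"] A e by auto
    obtain b1 where b1: "b1 \<in> B" "b1 < Inf B + e" using cInf_lessD[of B "Inf B + e"] B e by auto
    obtain a2 where a2: "a2 \<in> A" "Sup A - e < a2" using less_cSupD[of A "Sup A - e"] A e by auto
    obtain b2 where b2: "b2 \<in> B" "Sup B - e < b2" using less_cSupD[of B "Sup B - e"] B e by auto
    have "(1 - s) * a1 + s * b1 \<le> (1 - s) * (Inf A + e) + s * (Inf B + e)"
      using a1 b1 s by (intro add_mono mult_left_mono) auto
    also have "\<dots> = ?l + e" by (simp add: algebra_simps)
    finally have 1: "(1 - s) * a1 + s * b1 \<le> z" using e by simp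
    have "?r - e = (1 - s) * (Sup A - e) + s * (Sup B - e)" by (simp add: algebra_simps)
    also have "\<dots> \<le> (1 - s) * a2 + s * b2"
      using a2 b2 s by (intro add_mono mult_left_mono) auto
    finally have 2: "z \<le> (1 - s) * a2 + s * b2" using e by simp
    have "is_interval (combine s A B)" using A B by (simp add: is_interval_convex_1 convex_combine)
    then have "z \<in> combine s A B"
      using combineI[OF a1(1) b1(1), of s] combineI[OF a2(1) b2(1), of s] 1 2
      by (auto intro: mem_is_interval_1_I)
    then show "z \<in> C" using C by auto
  qed
  then have "emeasure lborel {?l<..<?r} \<le> emeasure lborel C"
    using C by (intro emeasure_mono) auto
  moreover have "?l \<le> ?r" using len(2) A B bd s by (intro add_mono mult_left_mono) auto
  ultimately have "ennreal (?r - ?l) \<le> emeasure lborel C" by simp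
  moreover have "ennreal (1 - s) * emeasure lborel A + ennreal s * emeasure lborel B
      \<le> ennreal (1 - s) * ennreal (Sup A - Inf A) + ennreal s * ennreal (Sup B - Inf B)"
    using len A B bd by (intro add_mono mult_left_mono) auto
  moreover have "\<dots> = ennreal (?r - ?l)"
    using s len(2)[OF bd(1,2) A(3)] len(2)[OF bd(3,4) B(3)]
    by (simp flip: ennreal_mult' ennreal_plus) (simp add: algebra_simps)
  ultimately show ?thesis by simp
qed

text \<open>The functions are normalized to have supremum 1, so that all superlevel sets below level 1
  are nonempty and the one-dimensional inequality applies to them.\<close>

lemma prekopa_leindler_normalized:
  fixes f g h :: "real \<Rightarrow> real"
  assumes [measurable]: "f \<in> borel_measurable borel" "g \<in> borel_measurable borel" "h \<in> borel_measurable borel"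
    and nonneg: "\<And>x. 0 \<le> f x" "\<And>x. 0 \<le> g x" "\<And>x. 0 \<le> h x"
    and le1: "\<And>x. f x \<le> 1" "\<And>x. g x \<le> 1"
    and sup: "\<And>c. c < 1 \<Longrightarrow> \<exists>x. c < f x" "\<And>c. c < 1 \<Longrightarrow> \<exists>x. c < g x"
    and conv: "\<And>c. 0 < c \<Longrightarrow> convex {x. c < f x}" "\<And>c. 0 < c \<Longrightarrow> convex {x. c < g x}"
    and bdd: "bounded {x. 0 < f x}" "bounded {x. 0 < g x}"
    and s: "0 < s" "s < 1"
    and H: "\<And>x y. f x powr (1 - s) * g y powr s \<le> h ((1 - s) * x + s * y)"
  shows "ennreal (1 - s) * (\<integral>\<^sup>+x. f x \<partial>lborel) + ennreal s * (\<integral>\<^sup>+x. g x \<partial>lborel) \<le> (\<integral>\<^sup>+x. h x \<partial>lborel)"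
proof -
  let ?m = "\<lambda>f c. emeasure lborel {x::real. (c::real) < f x}"
  \<comment> \<open>Below level 1, if both function values exceed \<open>c\<close> then so does
    their weighted geometric mean, and \<open>h\<close> dominates it. From level 1 on, both sets on
    the left are empty.\<close>
  have lev: "ennreal (1 - s) * ?m f c + ennreal s * ?m g c \<le> ?m h c" if "0 < c" for c
  proof (cases "c < 1")
    case True
    have "c < h ((1 - s) * x + s * y)" if "c < f x" "c < g y" for x y
    proof -
      have "c = c powr (1 - s) * c powr s" using \<open>0 < c\<close> by (simp flip: powr_add)
      also have "\<dots> < f x powr (1 - s) * g y powr s"
        using that \<open>0 < c\<close> s by (intro mult_strict_mono powr_less_mono2) auto
      finally show ?thesis using H[of x y] by simp
    qed
    then have "combine s {x. c < f x} {x. c < g x} \<subseteq> {x. c < h x}"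
      by (auto elim!: combineE)
    then show ?thesis
      using True that s sup conv
      by (intro emeasure_combine_real_ge) (auto intro: bounded_subset[OF bdd(1)] bounded_subset[OF bdd(2)])
  next
    case False
    then have "{x. c < f x} = {}" "{x. c < g x}= {}"
      using le1 by (auto simp: not_less intro: order_trans)
    then show ?thesis by simp
  qed
  have [measurable]: "(\<lambda>c. ?m f c) \<in> borel_measurable borel" if [measurable]: "f \<in> borel_measurable borel" for f
  proof -
    have "{p \<in> space (lborel \<Otimes>\<^sub>M lborel). fst p < f (snd p)} \<in> sets (lborel \<Otimes>\<^sub>M lborel)"
      by measurable
    then have "{p. fst p < f (snd p)} \<in> sets (lborel \<Otimes>\<^sub>M lborel)"
      by (simp add: space_pair_measure)
    from lborel.measurable_emeasure_Pair[OF this] show ?thesis by (simp add: vimage_def)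
  qed
  have "ennreal (1 - s) * (\<integral>\<^sup>+x. f x \<partial>lborel) + ennreal s * (\<integral>\<^sup>+x. g x \<partial>lborel)
     = (\<integral>\<^sup>+c. ennreal (1 - s) * (indicator {0<..} c * ?m f c) + ennreal s * (indicator {0<..} c * ?m g c) \<partial>lborel)"
    by (simp add: layer_cake nonneg nn_integral_add nn_integral_cmult)
  also have "\<dots> \<le> (\<integral>\<^sup>+c. indicator {0<..} c * ?m h c \<partial>lborel)"
    using lev by (intro nn_integral_mono) (auto simp: indicator_def)
  also have "\<dots> = (\<integral>\<^sup>+x. h x \<partial>lborel)" by (simp add: layer_cake nonneg)
  finally show ?thesis .
qed

section \<open>Slices over the first coordinate and induction on the dimension\<close>

definition slice :: "('a \<times> 'b) set \<Rightarrow> 'a \<Rightarrow> 'b set" where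
  "slice A t = {q. (t, q) \<in> A}"

lemma compact_slice:
  fixes A :: "('a::metric_space \<times> 'b::heine_borel) set"
  assumes "compact A"
  shows "compact (slice A t)"
proof -
  have "slice A t = snd ` (A \<inter> ({t} \<times> UNIV))" by (force simp: slice_def)
  moreover have "closed ({t} \<times> (UNIV :: 'b set))" by (intro closed_Times) auto
  ultimately show ?thesis
    using assms by (auto intro!: compact_continuous_image continuous_intros compact_Int_closed)
qed

lemma convex_slice:
  assumes "convex A"
  shows "convex (slice A t)"
proof (rule convexI)
  fix x y u v assume "x \<in> slice A t" "y \<in> slice A t" and uv: "0 \<le> u" "0 \<le> v" "u + v = (1::real)"
  then have "u *\<^sub>R (t, x) + v *\<^sub>R (t, y) \<in> A"
    by (intro convexD[OF assms]) (auto simp: slice_def)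
  moreover have "u *\<^sub>R t + v *\<^sub>R t = t" using uv by (simp flip: scaleR_add_left)
  ultimately show "u *\<^sub>R x + v *\<^sub>R y \<in> slice A t" by (simp add: slice_def)
qed

lemma slice_measurable [measurable]:
  fixes A :: "('a::euclidean_space \<times> 'b::euclidean_space) set"
  assumes "A \<in> sets borel"
  shows "(\<lambda>t. emeasure lborel (slice A t)) \<in> borel_measurable borel"
    and "(\<lambda>t. measure lborel (slice A t)) \<in> borel_measurable borel"
proof -
  have "A \<in> sets (lborel \<Otimes>\<^sub>M lborel)" by (subst lborel_prod) (use assms in simp)
  from lborel.measurable_emeasure_Pair[OF this]
  show "(\<lambda>t. emeasure lborel (slice A t)) \<in> borel_measurable borel"
    by (simp add: vimage_def slice_def)
  then show "(\<lambda>t. measure lborel (slice A t)) \<in> borel_measurable borel"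
    unfolding measure_def by measurable
qed

lemma emeasure_slices:
  fixes A :: "('a::euclidean_space \<times> 'b::euclidean_space) set"
  assumes "A \<in> sets borel"
  shows "emeasure lborel A = (\<integral>\<^sup>+t. emeasure lborel (slice A t) \<partial>lborel)"
proof -
  have "A \<in> sets (lborel \<Otimes>\<^sub>M lborel)" by (subst lborel_prod) (use assms in simp)
  then have "emeasure (lborel \<Otimes>\<^sub>M lborel) A = (\<integral>\<^sup>+t. emeasure lborel (slice A t) \<partial>lborel)"
    by (subst lborel.emeasure_pair_measure_alt) (auto simp: slice_def vimage_def)
  then show ?thesis by (simp add: lborel_prod)
qed

lemma slice_combine: "combine s (slice A x) (slice B y) \<subseteq> slice (combine s A B) ((1 - s) *\<^sub>R x + s *\<^sub>R y)"
  by (force simp: slice_def combine_def image_iff)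

lemma measure_slice_bounded:
  fixes A :: "(real \<times> 'b::euclidean_space) set"
  assumes "compact A"
  obtains M where "\<And>t. measure lborel (slice A t) \<le> M"
proof -
  have "compact (snd ` A)" using assms by (intro compact_continuous_image continuous_intros)
  then have "measure lborel (slice A t) \<le> measure lborel (snd ` A)" for t
    using assms
    by (intro measure_mono_fmeasurable fmeasurable_compact)
      (force simp: slice_def intro!: borel_compact compact_slice[unfolded slice_def])+
  then show ?thesis using that by blast
qed

lemma brunn_minkowski_real:
  fixes A B :: "real set"
  assumes A: "compact A" "convex A" and B: "compact B" "convex B" and s: "0 < s" "s < 1"
  shows "measure lborel A powr (1 - s) * measure lborel B powr s \<le> measure lborel (combine s A B)"
proof (cases "A = {} \<or> B = {}")
  case False
  have "combine s A B \<in> sets borel" using A B by (intro borel_compact compact_combine)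
  then have "ennreal (1 - s) * emeasure lborel A + ennreal s * emeasure lborel B
      \<le> emeasure lborel (combine s A B)"
    using A B s False by (intro emeasure_combine_real_ge) (auto intro: compact_imp_bounded)
  then have "(1 - s) * measure lborel A + s * measure lborel B \<le> measure lborel (combine s A B)"
    using A B s by (simp add: emeasure_compact compact_combine flip: ennreal_mult' ennreal_plus)
  then show ?thesis
    using weighted_geometric_mean_le[OF measure_nonneg measure_nonneg s] order_trans by blast
qed auto

lemma nn_integral_slices:
  fixes A :: "(real \<times> 'b::euclidean_space) set"
  assumes A: "compact A"
  shows "(\<integral>\<^sup>+t. ennreal (measure lborel (slice A t)) \<partial>lborel) = ennreal (measure lborel A)"
  using emeasure_slices[of A] A emeasure_compact[OF compact_slice[OF A]]
  by (simp add: emeasure_compact compact_imp_closed)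

text \<open>The slice measures, divided by their suprema, satisfy the hypotheses of the normalized
  Prekopa-Leindler inequality; the induction hypothesis supplies both the pointwise bound and the
  convexity of superlevel sets. This gives an additive inequality between normalized volumes, which
  the weighted arithmetic-geometric mean inequality turns into the multiplicative one.\<close>

lemma brunn_minkowski_step:
  fixes A B :: "(real \<times> 'b::euclidean_space) set"
  assumes IH: "\<And>(A :: 'b set) B s. compact A \<Longrightarrow> convex A \<Longrightarrow> compact B \<Longrightarrow> convex B \<Longrightarrow> 0 < s \<Longrightarrow> s < 1 \<Longrightarrow>
      measure lborel A powr (1 - s) * measure lborel B powr s \<le> measure lborel (combine s A B)"
    and A: "compact A" "convex A" and B: "compact B" "convex B" and s: "0 < s" "s < 1"
  shows "measure lborel A powr (1 - s) * measure lborel B powr s \<le> measure lborel (combine s A B)"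
proof (cases "measure lborel A = 0 \<or> measure lborel B = 0")
  case False
  define C where "C = combine s A B"
  have C: "compact C" using A B by (simp add: C_def compact_combine)
  let ?f = "\<lambda>(X :: (real \<times> 'b) set) t. measure lborel (slice X t)"
  define M where "M X = (SUP t. ?f X t)" for X :: "(real \<times> 'b) set"
  have bd: "bdd_above (range (?f X))" if "compact X" for X
    using measure_slice_bounded[OF that] by (metis bdd_aboveI2)
  have f_le: "?f X t \<le> M X" if "compact X" for X t
    unfolding M_def using bd[OF that] by (intro cSUP_upper) auto
  have M_pos: "0 < M X" if X: "compact X" "measure lborel X \<noteq> 0" for X
  proof (rule ccontr)
    assume "\<not> 0 < M X"
    then have "?f X t = 0" for t using f_le[OF X(1), of t] measure_nonneg[of lborel "slice X t"] by linarith
    then show False using nn_integral_slices[OF X(1)] X(2) by simp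
  qed
  have pos: "0 < M A" "0 < M B" using M_pos A B False by auto
  \<comment> \<open>Dividing the slices of \<open>C\<close> by the weighted geometric mean of the
    two suprema preserves the pointwise inequality.\<close>
  define \<theta> where "\<theta> = M A powr (1 - s) * M B powr s"
  have \<theta>: "\<theta> > 0" using pos by (simp add: \<theta>_def)
  have sup: "\<exists>t. c < ?f X t / M X" if "compact X" "0 < M X" "c < 1" for X c
  proof -
    have "c * M X < M X" using that by simp
    then have "\<exists>t\<in>UNIV. c * M X < ?f X t"
      unfolding M_def by (subst (asm) less_cSUP_iff) (use bd[OF that(1)] in auto)
    then show ?thesis using that by (auto simp: field_simps)
  qed
  \<comment> \<open>The induction hypothesis is applied to two slices of one convex body, whose
    combination lies in the intermediate slice.\<close>
  have conv: "convex {t. c < ?f X t / M X}" if X: "compact X" "convex X" "0 < M X" "0 < c" for X c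
    unfolding convex_alt
  proof (intro ballI allI impI)
    fix x y u assume x: "x \<in> {t. c < ?f X t / M X}" and y: "y \<in> {t. c < ?f X t / M X}" and u: "0 \<le> u \<and> u \<le> (1::real)"
    have xy: "c * M X < ?f X x" "c * M X < ?f X y" using x y X by (auto simp: field_simps)
    have "c * M X < ?f X ((1 - u) *\<^sub>R x + u *\<^sub>R y)"
    proof (cases "u = 0 \<or> u = 1")
      case False
      then have u': "0 < u" "u < 1" using u by auto
      have cM: "0 < c * M X" using X by simp
      have "c * M X = (c * M X) powr (1 - u) * (c * M X) powr u" using X by (simp flip: powr_add)
      also have "\<dots> < ?f X x powr (1 - u) * ?f X y powr u"
        using xy cM u' by (intro mult_strict_mono powr_less_mono2) (use xy cM in \<open>simp_all\<close>)
      also have "\<dots> \<le> measure lborel (combine u (slice X x) (slice X y))"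
        using X u' by (intro IH compact_slice convex_slice)
      also have "\<dots> \<le> ?f X ((1 - u) *\<^sub>R x + u *\<^sub>R y)"
      proof (rule measure_mono_fmeasurable)
        have "combine u X X \<subseteq> X" using X u by (intro combine_convex_subset) auto
        then show "combine u (slice X x) (slice X y) \<subseteq> slice X ((1 - u) *\<^sub>R x + u *\<^sub>R y)"
          using slice_combine[of u X x X y] by (auto simp: slice_def)
        show "combine u (slice X x) (slice X y) \<in> sets lborel"
          using X by (auto intro!: borel_compact compact_combine compact_slice)
        show "slice X ((1 - u) *\<^sub>R x + u *\<^sub>R y) \<in> fmeasurable lborel"
          using X by (auto intro!: fmeasurable_compact compact_slice)
      qed
      finally show ?thesis .
    qed (use xy in auto)
    then show "(1 - u) *\<^sub>R x + u *\<^sub>R y \<in> {t. c < ?f X t / M X}" using X by (simp add: field_simps)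
  qed
  have bdd: "bounded {t. 0 < ?f X t / M X}" if "compact X" for X
  proof (rule bounded_subset)
    show "bounded (fst ` X)" using that compact_imp_bounded by (intro bounded_fst)
    show "{t. 0 < ?f X t / M X} \<subseteq> fst ` X"
    proof
      fix t assume "t \<in> {t. 0 < ?f X t / M X}"
      then have "slice X t \<noteq> {}" by auto
      then show "t \<in> fst ` X" by (force simp: slice_def)
    qed
  qed
  have int: "(\<integral>\<^sup>+t. ennreal (?f X t / c) \<partial>lborel) = ennreal (measure lborel X / c)" if "compact X" "c > 0" for X c
  proof -
    have "(\<integral>\<^sup>+t. ennreal (?f X t / c) \<partial>lborel) = (\<integral>\<^sup>+t. ennreal (?f X t) * ennreal (1 / c) \<partial>lborel)"
      using that by (intro nn_integral_cong) (simp flip: ennreal_mult')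
    also have "\<dots> = ennreal (measure lborel X) * ennreal (1 / c)"
      using that by (subst nn_integral_multc) (auto simp: nn_integral_slices compact_imp_closed)
    finally show ?thesis using that by (simp flip: ennreal_mult')
  qed
  have "ennreal (1 - s) * (\<integral>\<^sup>+t. ennreal (?f A t / M A) \<partial>lborel) + ennreal s * (\<integral>\<^sup>+t. ennreal (?f B t / M B) \<partial>lborel)
      \<le> (\<integral>\<^sup>+t. ennreal (?f C t / \<theta>) \<partial>lborel)"
  proof (rule prekopa_leindler_normalized)
    fix x y
    have "(?f A x / M A) powr (1 - s) * (?f B y / M B) powr s = (?f A x powr (1 - s) * ?f B y powr s) / \<theta>"
      using pos by (simp add: powr_divide \<theta>_def)
    also have "\<dots> \<le> measure lborel (combine s (slice A x) (slice B y)) / \<theta>"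
      using A B \<theta> by (intro divide_right_mono IH compact_slice convex_slice) (use s in auto)
    also have "\<dots> \<le> ?f C ((1 - s) * x + s * y) / \<theta>"
      using slice_combine[of s A x B y] A B C \<theta>
      by (intro divide_right_mono measure_mono_fmeasurable)
        (auto simp: C_def intro!: fmeasurable_compact borel_compact compact_combine compact_slice)
    finally show "(?f A x / M A) powr (1 - s) * (?f B y / M B) powr s \<le> ?f C ((1 - s) * x + s * y) / \<theta>" .
  next
    show "?f A t / M A \<le> 1" "?f B t / M B \<le> 1" for t
      using f_le[OF A(1), of t] f_le[OF B(1), of t] pos by simp_all
    show "convex {t. c < ?f A t / M A}" "convex {t. c < ?f B t / M B}" if "0 < c" for c
      using conv[of A] conv[of B] A B pos that by blast+
    show "\<exists>t. c < ?f A t / M A" "\<exists>t. c < ?f B t / M B" if "c < 1" for c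
      using sup A B pos that by blast+
    show "bounded {t. 0 < ?f A t / M A}" "bounded {t. 0 < ?f B t / M B}"
      using bdd A B by blast+
  qed (use A B C pos \<theta> s in \<open>auto simp: compact_imp_closed\<close>)
  then have "ennreal ((1 - s) * (measure lborel A / M A) + s * (measure lborel B / M B)) \<le> ennreal (measure lborel C / \<theta>)"
    using A B C pos \<theta> s by (simp add: int ennreal_mult'' flip: ennreal_mult' ennreal_plus)
  then have "(1 - s) * (measure lborel A / M A) + s * (measure lborel B / M B) \<le> measure lborel C / \<theta>"
    using \<theta> by (subst (asm) ennreal_le_iff) auto
  moreover have "(measure lborel A / M A) powr (1 - s) * (measure lborel B / M B) powr s
      \<le> (1 - s) * (measure lborel A / M A) + s * (measure lborel B / M B)"
    using pos s by (intro weighted_geometric_mean_le) auto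
  moreover have "(measure lborel A / M A) powr (1 - s) * (measure lborel B / M B) powr s =
      (measure lborel A powr (1 - s) * measure lborel B powr s) / \<theta>"
    using pos by (simp add: powr_divide \<theta>_def)
  ultimately have "(measure lborel A powr (1 - s) * measure lborel B powr s) / \<theta> \<le> measure lborel C / \<theta>"
    by simp
  then show ?thesis using \<theta> by (simp add: divide_le_cancel C_def)
qed auto

lemma brunn_minkowski_real2:
  fixes A B :: "(real \<times> real) set"
  assumes "compact A" "convex A" "compact B" "convex B" "0 < s" "s < 1"
  shows "measure lborel A powr (1 - s) * measure lborel B powr s \<le> measure lborel (combine s A B)"
  using assms by (intro brunn_minkowski_step brunn_minkowski_real)

lemma brunn_minkowski_real3:
  fixes A B :: "(real \<times> real \<times> real) set"
  assumes "compact A" "convex A" "compact B" "convex B" "0 < s" "s < 1"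
  shows "measure lborel A powr (1 - s) * measure lborel B powr s \<le> measure lborel (combine s A B)"
  using assms by (intro brunn_minkowski_step brunn_minkowski_real2)

section \<open>Volumes of slabs and regularity of slice measures\<close>

lemma slice_measure_Icc:
  fixes A :: "(real \<times> 'b::euclidean_space) set"
  assumes A: "compact A"
  shows "ennreal (measure lborel (A \<inter> {a..b} \<times> UNIV)) =
    (\<integral>\<^sup>+t. ennreal (measure lborel (slice A t)) * indicator {a..b} t \<partial>lborel)"
proof -
  have "closed ({a..b} \<times> (UNIV :: 'b set))" by (intro closed_Times) auto
  then have c: "compact (A \<inter> {a..b} \<times> UNIV)" using A by (intro compact_Int_closed)
  have "measure lborel (slice (A \<inter> {a..b} \<times> UNIV) t) = measure lborel (slice A t) * indicator {a..b} t" for t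
    by (auto simp: slice_def indicator_def)
  then show ?thesis
    using nn_integral_slices[OF c] by (simp add: ennreal_mult'' ennreal_indicator)
qed

text \<open>Increments of \<open>F\<close> are assumed as nonnegative integrals, the form in which
  Fubini delivers them. They become gauge integrals on a compact interval \<open>{c..d}\<close>
  around \<open>t\<close>, chosen inside the open interval because \<open>f\<close> is continuous
  only there.\<close>

lemma FTC_nn_integral:
  fixes f F :: "real \<Rightarrow> real"
  assumes [measurable]: "f \<in> borel_measurable borel" and f0: "\<And>t. 0 \<le> f t"
    and F: "\<And>s t. a < s \<Longrightarrow> s \<le> t \<Longrightarrow> t < b \<Longrightarrow>
      F s \<le> F t \<and> ennreal (F t - F s) = (\<integral>\<^sup>+x. ennreal (f x) * indicator {s..t} x \<partial>lborel)"
    and cont: "continuous_on {a<..<b} f" and t: "a < t" "t < b"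
  shows "(F has_real_derivative f t) (at t)"
proof -
  obtain c where c: "a < c" "c < t" using dense t by blast
  obtain d where d: "t < d" "d < b" using dense t by blast
  have I: "(f has_integral (F x - F c)) {c..x}" if "c \<le> x" "x \<le> d" for x
  proof -
    have "((\<lambda>y. f y * indicator {c..x} y) has_integral (F x - F c)) UNIV"
    proof (rule nn_integral_has_integral)
      show "(\<integral>\<^sup>+ y. ennreal (f y * indicator {c..x} y) \<partial>lborel) = ennreal (F x - F c)"
        using F[of c x] that c d by (simp add: ennreal_mult'' ennreal_indicator)
    qed (use f0 F[of c x] that c d in auto)
    moreover have "(\<lambda>y. f y * indicator {c..x} y) = (\<lambda>y. if y \<in> {c..x} then f y else 0)"
      by (auto simp: indicator_def)
    ultimately have "((\<lambda>y. if y \<in> {c..x} then f y else 0) has_integral (F x - F c)) UNIV" by simp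
    then show ?thesis by (simp only: has_integral_restrict_UNIV)
  qed
  have "((\<lambda>x. integral {c..x} f) has_real_derivative f t) (at t within {c..d})"
    using c d by (intro integral_has_real_derivative continuous_on_subset[OF cont]) auto
  then have "((\<lambda>x. integral {c..x} f) has_real_derivative f t) (at t)"
    using c d by (simp add: at_within_Icc_at)
  then have "((\<lambda>x. integral {c..x} f + F c) has_real_derivative f t) (at t)"
    by (auto intro!: derivative_eq_intros)
  then show ?thesis
  proof (rule has_field_derivative_transform_within_open)
    fix x assume "x \<in> {c<..<d}"
    then show "integral {c..x} f + F c = F x" using integral_unique[OF I[of x]] by simp
  qed (use c d in auto)
qed

lemma measure_hyperplane_slab:
  fixes A :: "(real \<times> 'b::euclidean_space) set"
  assumes A: "compact A"
  shows "measure lborel (A \<inter> {t..t} \<times> UNIV) = 0"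
proof -
  have "(\<integral>\<^sup>+x. ennreal (measure lborel (slice A x)) * indicator {t..t} x \<partial>lborel) = 0"
  proof (subst nn_integral_0_iff_AE)
    show "AE x in lborel. ennreal (measure lborel (slice A x)) * indicator {t..t} x = 0"
      using AE_lborel_singleton[of t] by eventually_elim (auto split: split_indicator)
  qed (use A in \<open>auto simp: compact_imp_closed\<close>)
  then show ?thesis using slice_measure_Icc[OF A, of t t] by simp
qed

lemma measure_slab_add:
  fixes A :: "(real \<times> 'b::euclidean_space) set"
  assumes A: "compact A" and "a \<le> b" "b \<le> c"
  shows "measure lborel (A \<inter> {a..c} \<times> UNIV) =
    measure lborel (A \<inter> {a..b} \<times> UNIV) + measure lborel (A \<inter> {b..c} \<times> UNIV)"
proof -
  have "closed ({x..y} \<times> (UNIV :: 'b set))" for x y :: real by (intro closed_Times) auto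
  then have c: "compact (A \<inter> {x..y} \<times> UNIV)" for x y using A by (intro compact_Int_closed)
  have "A \<inter> {a..c} \<times> UNIV = (A \<inter> {a..b} \<times> UNIV) \<union> (A \<inter> {b..c} \<times> UNIV)"
    using assms by auto
  moreover have "(A \<inter> {a..b} \<times> UNIV) \<inter> (A \<inter> {b..c} \<times> UNIV) = A \<inter> {b..b} \<times> UNIV"
    using assms by auto
  ultimately show ?thesis
    using measure_Un3[of "A \<inter> {a..b} \<times> UNIV" lborel "A \<inter> {b..c} \<times> UNIV"] measure_hyperplane_slab[OF A]
    by (simp add: fmeasurable_compact c)
qed

lemma fst_image_interval:
  fixes A :: "(real \<times> 'b::euclidean_space) set"
  assumes "compact A" "convex A" "A \<noteq> {}"
  obtains a b where "fst ` A = {a..b}" "a \<le> b"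
proof -
  have "compact (fst ` A)" using assms by (intro compact_continuous_image continuous_intros)
  moreover have "connected (fst ` A)"
    using assms by (intro connected_continuous_image continuous_intros convex_connected)
  ultimately obtain a b where "fst ` A = {a..b}" using connected_compact_interval_1[of "fst ` A"] by blast
  then show ?thesis using that assms by (metis atLeastatMost_empty_iff image_is_empty)
qed

text \<open>A point of \<open>A\<close> over an end of the projection, shrunk towards an interior
  point, reaches height \<open>t\<close> inside the interior, so the slice contains a ball.\<close>

lemma slice_measure_pos:
  fixes A :: "(real \<times> 'b::euclidean_space) set"
  assumes A: "compact A" "convex A" "interior A \<noteq> {}" and ab: "fst ` A = {a..b}" and t: "a < t" "t < b"
  shows "0 < measure lborel (slice A t)"
proof -
  obtain p where p: "p \<in> interior A" using A by auto
  have "\<exists>q. (t, q) \<in> interior A"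
  proof -
    have key: "\<exists>q. (t, q) \<in> interior A"
      if r: "r \<in> A" and st: "fst r < t \<and> t < fst p \<or> fst p < t \<and> t < fst r" for r
    proof -
      \<comment> \<open>The parameter at which the segment from \<open>r\<close> to \<open>p\<close>
        has first coordinate \<open>t\<close>.\<close>
      define e where "e = (fst r - t) / (fst r - fst p)"
      have e: "0 < e" "e \<le> 1" using st by (auto simp: e_def field_simps)
      have "fst r - e * (fst r - fst p) = t" using st by (auto simp: e_def)
      moreover have "r - e *\<^sub>R (r - p) \<in> interior A"
        using mem_interior_convex_shrink[OF A(2) p r e] .
      ultimately have "(t, snd (r - e *\<^sub>R (r - p))) \<in> interior A"
        by (metis fst_diff fst_scaleR prod.collapse real_scaleR_def)
      then show ?thesis by blast
    qed
    have "fst p = t \<or> fst p < t \<or> t < fst p" by auto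
    moreover have "a \<in> fst ` A" "b \<in> fst ` A" using t by (auto simp: ab)
    then obtain r1 r2 where "r1 \<in> A" "r2 \<in> A" "fst r1 = a" "fst r2 = b" by (auto simp del: ab)
    moreover have "(fst p, snd p) \<in> interior A" using p by simp
    ultimately show ?thesis using key[of r1] key[of r2] t by blast
  qed
  then obtain q where "(t, q) \<in> interior A" by auto
  then obtain e where e: "e > 0" "ball (t, q) e \<subseteq> A" by (auto simp: mem_interior)
  have "ball q e \<subseteq> slice A t"
    using e(2) by (auto simp: slice_def subset_eq dist_Pair_Pair)
  then have "measure lborel (ball q e) \<le> measure lborel (slice A t)"
    using A by (intro measure_mono_fmeasurable fmeasurable_compact compact_slice) auto
  then show ?thesis by (rule less_le_trans[OF content_ball_pos[OF e(1)]])
qed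

lemma compact_convex_interior_of_measure:
  fixes A :: "'a::euclidean_space set"
  assumes "compact A" "convex A" "measure lborel A \<noteq> 0"
  shows "interior A \<noteq> {}"
proof
  assume "interior A = {}"
  then have "negligible A" using assms by (simp add: negligible_convex_interior)
  then show False using assms by (simp add: negligible_iff_measure0 lmeasurable_compact)
      (simp add: measure_completion borel_compact)
qed

text \<open>The lower-dimensional Brunn--Minkowski inequality makes the slice measure log-concave.\<close>

lemma slice_measure_continuous:
  fixes A :: "(real \<times> real \<times> real) set"
  assumes A: "compact A" "convex A" "interior A \<noteq> {}" and ab: "fst ` A = {a..b}"
  shows "continuous_on {a<..<b} (\<lambda>t. measure lborel (slice A t))"
proof -
  let ?f = "\<lambda>t. measure lborel (slice A t)"
  have pos: "0 < ?f t" if "t \<in> {a<..<b}" for t using that slice_measure_pos[OF A ab] by auto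
  have "convex_on {a<..<b} (\<lambda>t. - ln (?f t))"
  proof (rule convex_onI)
    fix u x y :: real assume u: "0 < u" "u < 1" and xy: "x \<in> {a<..<b}" "y \<in> {a<..<b}"
    have "(1 - u) *\<^sub>R x + u *\<^sub>R y \<in> {a<..<b}"
      using xy u convex_real_interval(8)[of a b] by (intro convexD_alt) auto
    note p = pos[OF xy(1)] pos[OF xy(2)] pos[OF this]
    have "?f x powr (1 - u) * ?f y powr u \<le> measure lborel (combine u (slice A x) (slice A y))"
      using A u by (intro brunn_minkowski_real2 compact_slice convex_slice)
    also have "\<dots> \<le> ?f ((1 - u) *\<^sub>R x + u *\<^sub>R y)"
    proof (intro measure_mono_fmeasurable fmeasurable_compact compact_slice A)
      have "combine u A A \<subseteq> A" using A u by (intro combine_convex_subset) auto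
      then show "combine u (slice A x) (slice A y) \<subseteq> slice A ((1 - u) *\<^sub>R x + u *\<^sub>R y)"
        using slice_combine[of u A x A y] by (auto simp: slice_def)
      show "combine u (slice A x) (slice A y) \<in> sets lborel"
        using A by (auto intro!: borel_compact compact_combine compact_slice)
    qed
    finally have "ln (?f x powr (1 - u) * ?f y powr u) \<le> ln (?f ((1 - u) *\<^sub>R x + u *\<^sub>R y))"
      using p by (subst ln_le_cancel_iff) auto
    then show "- ln (?f ((1 - u) *\<^sub>R x + u *\<^sub>R y)) \<le> (1 - u) * - ln (?f x) + u * - ln (?f y)"
      using p by (simp add: ln_mult ln_powr)
  qed auto
  then have "continuous_on {a<..<b} (\<lambda>t. - ln (?f t))" by (intro convex_on_continuous) auto
  then have "continuous_on {a<..<b} (\<lambda>t. exp (- (- ln (?f t))))"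
    by (rule continuous_on_exp[OF continuous_on_minus])
  then show ?thesis by (rule continuous_on_eq) (use pos in auto)
qed

lemma fst_image_combine: "fst ` combine s A B = combine s (fst ` A) (fst ` B)"
proof
  show "fst ` combine s A B \<subseteq> combine s (fst ` A) (fst ` B)"
  proof
    fix z assume "z \<in> fst ` combine s A B"
    then obtain a b where ab: "a \<in> A" "b \<in> B" "z = (1 - s) *\<^sub>R fst a + s *\<^sub>R fst b"
      by (auto elim!: combineE)
    then show "z \<in> combine s (fst ` A) (fst ` B)" by (auto intro: combineI)
  qed
  show "combine s (fst ` A) (fst ` B) \<subseteq> fst ` combine s A B"
  proof
    fix z assume "z \<in> combine s (fst ` A) (fst ` B)"
    then obtain a b where ab: "a \<in> A" "b \<in> B" "z = (1 - s) *\<^sub>R fst a + s *\<^sub>R fst b"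
      by (auto elim!: combineE)
    then show "z \<in> fst ` combine s A B"
      by (intro image_eqI[OF _ combineI[OF ab(1,2), of s]]) auto
  qed
qed

lemma combine_Icc:
  fixes a b c d s :: real
  assumes "0 < s" "s < 1" "a \<le> b" "c \<le> d"
  shows "combine s {a..b} {c..d} = {(1 - s) * a + s * c..(1 - s) * b + s * d}"
proof
  show "combine s {a..b} {c..d} \<subseteq> {(1 - s) * a + s * c..(1 - s) * b + s * d}"
    using assms by (auto elim!: combineE intro!: add_mono mult_left_mono)
  have int: "is_interval (combine s {a..b} {c..d})" by (simp add: is_interval_convex_1 convex_combine)
  have l: "(1 - s) * a + s * c \<in> combine s {a..b} {c..d}"
    using assms combineI[of a "{a..b}" c "{c..d}" s] by auto
  have r: "(1 - s) * b + s * d \<in> combine s {a..b} {c..d}"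
    using assms combineI[of b "{a..b}" d "{c..d}" s] by auto
  show "{(1 - s) * a + s * c..(1 - s) * b + s * d} \<subseteq> combine s {a..b} {c..d}"
    using mem_is_interval_1_I[OF int l r] by (simp add: subset_iff)
qed

section \<open>The equality case\<close>

text \<open>Bounded slices make the volume below a height Lipschitz. This provides continuity up to
  the end points of the projection, where no derivative is available.\<close>

lemma slab_measure_le:
  fixes A :: "(real \<times> 'b::euclidean_space) set"
  assumes A: "compact A" and M: "\<And>t. measure lborel (slice A t) \<le> M" and "s \<le> t"
  shows "measure lborel (A \<inter> {s..t} \<times> UNIV) \<le> M * (t - s)"
proof -
  have M0: "0 \<le> M" using M measure_nonneg order_trans by blast
  have "ennreal (measure lborel (A \<inter> {s..t} \<times> UNIV)) \<le> (\<integral>\<^sup>+x. ennreal M * indicator {s..t} x \<partial>lborel)"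
    unfolding slice_measure_Icc[OF A] by (intro nn_integral_mono mult_right_mono ennreal_leI M) auto
  also have "\<dots> = ennreal M * ennreal (t - s)"
    using \<open>s \<le> t\<close> by (subst nn_integral_cmult) auto
  finally show ?thesis using M0 \<open>s \<le> t\<close> by (simp flip: ennreal_mult')
qed

text \<open>The volume below height \<open>t\<close>, like a distribution function. The infimum is
  the left end of the projection, so only slabs over compact intervals have to be handled.\<close>

definition cumulative :: "(real \<times> 'b::euclidean_space) set \<Rightarrow> real \<Rightarrow> real" where
  "cumulative A t = measure lborel (A \<inter> {Inf (fst ` A)..t} \<times> UNIV)"

lemma cumulative_derivative:
  fixes A :: "(real \<times> real \<times> real) set"
  assumes A: "compact A" "convex A" "interior A \<noteq> {}" and ab: "fst ` A = {a..b}" and t: "a < t" "t < b"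
  shows "(cumulative A has_real_derivative measure lborel (slice A t)) (at t)"
proof (rule FTC_nn_integral[of _ a b])
  fix s t assume st: "a < s" "s \<le> t" "t < b"
  then have "cumulative A t = cumulative A s + measure lborel (A \<inter> {s..t} \<times> UNIV)"
    unfolding cumulative_def ab by (subst measure_slab_add[OF A(1), of _ s]) auto
  then show "cumulative A s \<le> cumulative A t \<and> ennreal (cumulative A t - cumulative A s) =
      (\<integral>\<^sup>+x. ennreal (measure lborel (slice A x)) * indicator {s..t} x \<partial>lborel)"
    by (simp add: slice_measure_Icc[OF A(1)])
qed (use A ab t in \<open>auto intro!: slice_measure_continuous simp: compact_imp_closed\<close>)

lemma Int_fst_image: "A \<inter> (fst ` A) \<times> UNIV = A"
  by force

text \<open>Inside the projection the cumulative volume has the positive slice measure as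
  derivative, so it is strictly increasing; the intermediate value theorem makes it onto. The
  quantile function \<open>q\<close> is its inverse, differentiated by the inverse function
  rule.\<close>

lemma quantile_exists:
  fixes A :: "(real \<times> real \<times> real) set"
  assumes A: "compact A" "convex A" "interior A \<noteq> {}" and ab: "fst ` A = {a..b}" "a \<le> b"
  obtains q where
    "\<And>p. 0 < p \<Longrightarrow> p < measure lborel A \<Longrightarrow> a < q p \<and> q p < b \<and> cumulative A (q p) = p"
    "\<And>t. a < t \<Longrightarrow> t < b \<Longrightarrow> 0 < cumulative A t \<and> cumulative A t < measure lborel A \<and> q (cumulative A t) = t"
    "\<And>p. 0 < p \<Longrightarrow> p < measure lborel A \<Longrightarrow>
      (q has_real_derivative inverse (measure lborel (slice A (q p)))) (at p)"
proof -
  let ?F = "cumulative A" and ?v = "measure lborel A"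
  have add: "?F t = ?F s + measure lborel (A \<inter> {s..t} \<times> UNIV)" if "a \<le> s" "s \<le> t" for s t
    unfolding cumulative_def ab using that ab by (subst measure_slab_add[OF A(1), of _ s]) auto
  have Fa: "?F a = 0" using ab measure_hyperplane_slab[OF A(1), of a] by (simp add: cumulative_def)
  have "A \<inter> {a..b} \<times> UNIV = A" using Int_fst_image[of A] by (simp add: ab)
  then have Fb: "?F b = ?v" using ab by (simp add: cumulative_def)
  have mono: "?F s \<le> ?F t" if "a \<le> s" "s \<le> t" for s t using add[OF that] by simp
  have strict: "?F s < ?F t" if "a < s" "s < t" "t < b" for s t
  proof (rule DERIV_pos_imp_increasing[OF \<open>s < t\<close>])
    fix x assume "s \<le> x" "x \<le> t"
    then show "\<exists>y. (?F has_real_derivative y) (at x) \<and> 0 < y"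
      using cumulative_derivative[OF A ab(1), of x] slice_measure_pos[OF A ab(1), of x] that by auto
  qed
  have inj: "inj_on ?F {a<..<b}"
    by (rule inj_onI) (metis greaterThanLessThan_iff less_irrefl linorder_neqE strict)
  have range: "0 < ?F t" "?F t < ?v" if "a < t" "t < b" for t
  proof -
    obtain s where s: "a < s" "s < t" using dense[OF \<open>a < t\<close>] by blast
    have "0 \<le> ?F s" using mono[of a s] Fa s by simp
    then show "0 < ?F t" using strict[of s t] s that by simp
    obtain r where r: "t < r" "r < b" using dense[OF \<open>t < b\<close>] by blast
    have "?F r \<le> ?v" using mono[of r b] Fb r that by simp
    then show "?F t < ?v" using strict[of t r] r that by simp
  qed
  obtain M where M: "\<And>t. measure lborel (slice A t) \<le> M" using measure_slice_bounded[OF A(1)] by blast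
  have M0: "0 \<le> M" using M measure_nonneg order_trans by blast
  have "M-lipschitz_on {a..b} ?F"
  proof (rule lipschitz_onI)
    have *: "dist (?F x) (?F y) \<le> M * dist x y" if "a \<le> x" "x \<le> y" for x y
      using add[OF that] slab_measure_le[OF A(1) M that(2)] that by (simp add: dist_real_def)
    fix x y assume "x \<in> {a..b}" "y \<in> {a..b}"
    then show "dist (?F x) (?F y) \<le> M * dist x y"
      using *[of x y] *[of y x] by (cases "x \<le> y") (auto simp: dist_commute)
  qed (fact M0)
  then have cont: "continuous_on {a..b} ?F" by (rule lipschitz_on_continuous_on)
  have surj: "\<exists>t. a < t \<and> t < b \<and> ?F t = p" if "0 < p" "p < ?v" for p
  proof -
    have "\<exists>t\<ge>a. t \<le> b \<and> ?F t = p" using IVT'[of ?F a p b] that Fa Fb ab cont by auto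
    then show ?thesis using that Fa Fb by (metis less_le)
  qed
  define q where "q = inv_into {a<..<b} ?F"
  have qF: "q (?F t) = t" if "a < t" "t < b" for t
    unfolding q_def using that by (intro inv_into_f_f inj) auto
  have q: "a < q p \<and> q p < b \<and> ?F (q p) = p" if p: "0 < p" "p < ?v" for p
    using surj[OF p] qF by auto
  show ?thesis
  proof (rule that[of q])
    fix p assume p: "0 < p" "p < ?v"
    note qp = q[OF p]
    have "isCont q (?F (q p))"
    proof (rule isCont_inverse_function[where f = ?F and g = q and x = "q p" and d = "min (q p - a) (b - q p) / 2"])
      let ?d = "min (q p - a) (b - q p) / 2"
      show "0 < ?d" using qp by auto
      fix z assume "\<bar>z - q p\<bar> \<le> ?d"
      moreover have "?d < q p - a" "?d < b - q p" using qp by auto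
      ultimately have z: "a < z" "z < b" by linarith+
      show "q (?F z) = z" using qF z by auto
      show "isCont ?F z" using cumulative_derivative[OF A ab(1) z] by (rule DERIV_isCont)
    qed
    then show "(q has_real_derivative inverse (measure lborel (slice A (q p)))) (at p)"
      using qp slice_measure_pos[OF A ab(1), of "q p"] cumulative_derivative[OF A ab(1), of "q p"] q p
      by (intro DERIV_inverse_function[of ?F _ q p 0 ?v]) auto
  qed (use q range qF in auto)
qed

lemma integral_fst_slices:
  fixes A :: "(real \<times> 'b::euclidean_space) set"
  assumes A: "compact A"
  shows "integrable lborel (\<lambda>t. t * measure lborel (slice A t))"
    and "(\<integral>p. indicator A p *\<^sub>R fst p \<partial>lborel) = (\<integral>t. t * measure lborel (slice A t) \<partial>lborel)"
proof -
  have int: "integrable (lborel \<Otimes>\<^sub>M lborel) (\<lambda>p. indicator A p *\<^sub>R fst p)"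
    unfolding lborel_prod by (intro borel_integrable_compact A continuous_intros)
  have eq: "(\<integral>q. indicator A (t, q) *\<^sub>R fst (t, q) \<partial>lborel) = t * measure lborel (slice A t)" for t
  proof -
    have "(\<integral>q. indicator A (t, q) *\<^sub>R fst (t, q) \<partial>lborel) = (\<integral>q. indicator (slice A t) q *\<^sub>R t \<partial>lborel)"
      by (intro Bochner_Integration.integral_cong) (auto simp: slice_def indicator_def)
    then show ?thesis by simp
  qed
  show "integrable lborel (\<lambda>t. t * measure lborel (slice A t))"
    using lborel_pair.integrable_fst'[OF int] by (simp only: eq)
  show "(\<integral>p. indicator A p *\<^sub>R fst p \<partial>lborel) = (\<integral>t. t * measure lborel (slice A t) \<partial>lborel)"
    using lborel_pair.integral_fst'[OF int] unfolding eq lborel_prod by simp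
qed

lemma integrable_slices:
  fixes A :: "(real \<times> 'b::euclidean_space) set"
  assumes A: "compact A"
  shows "integrable lborel (\<lambda>t. measure lborel (slice A t))"
    and "(\<integral>t. measure lborel (slice A t) \<partial>lborel) = measure lborel A"
proof -
  have "(\<integral>\<^sup>+t. ennreal (measure lborel (slice A t)) \<partial>lborel) = ennreal (measure lborel A)"
    by (rule nn_integral_slices[OF A])
  moreover have m: "(\<lambda>t. measure lborel (slice A t)) \<in> borel_measurable lborel"
    using A by (simp add: compact_imp_closed)
  ultimately show "integrable lborel (\<lambda>t. measure lborel (slice A t))"
    by (intro integrableI_nonneg) auto
  show "(\<integral>t. measure lborel (slice A t) \<partial>lborel) = measure lborel A"
    using m nn_integral_slices[OF A] by (subst integral_eq_nn_integral) auto
qed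

text \<open>The last hypothesis says that \<open>z\<close> is the harmonic mean, which never exceeds
  the geometric mean and equals it only for \<open>x = y\<close>.\<close>

lemma geometric_le_harmonic_mean_imp_eq:
  fixes x y z :: real
  assumes pos: "0 < x" "0 < y" and z: "sqrt x * sqrt y \<le> z" and h: "z * ((inverse x + inverse y) / 2) = 1"
  shows "x = y"
proof -
  define r w where "r = sqrt x" and "w = sqrt y"
  have rw: "0 < r" "0 < w" "x = r\<^sup>2" "y = w\<^sup>2" using pos by (simp_all add: r_def w_def)
  have z': "r * w \<le> z" using z by (simp add: r_def w_def)
  have h': "z * ((inverse (r\<^sup>2) + inverse (w\<^sup>2)) / 2) = 1" using h by (simp only: rw(3,4))
  have "r * w * ((inverse (r\<^sup>2) + inverse (w\<^sup>2)) / 2) \<le> z * ((inverse (r\<^sup>2) + inverse (w\<^sup>2)) / 2)"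
    by (rule mult_right_mono[OF z']) simp
  then have "r * w * ((inverse (r\<^sup>2) + inverse (w\<^sup>2)) / 2) \<le> 1" by (simp only: h')
  moreover have "r * w * ((inverse (r\<^sup>2) + inverse (w\<^sup>2)) / 2) = (r\<^sup>2 + w\<^sup>2) / (2 * (r * w))"
    using rw(1,2) by (simp add: field_simps power2_eq_square)
  ultimately have "r\<^sup>2 + w\<^sup>2 \<le> 2 * (r * w)" using rw(1,2) by (simp add: divide_le_eq)
  then have "(r - w)\<^sup>2 \<le> 0" by (simp add: power2_diff)
  then have "r = w" by simp
  then show ?thesis by (simp only: rw(3,4))
qed

text \<open>In case of equality every halfspace \<open>{fst \<le> t}\<close> cutting off the same volume from both bodies
  must also cut off that volume from the midpoint body. Hence the quantile function of the midpoint
  body is the mean of the two quantile functions. Its derivative is the inverse of the slice area,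
  which by the planar inequality is at least the geometric mean of the two areas; so the areas
  agree and the quantile functions differ by a constant.\<close>

lemma brunn_minkowski_equality_fst:
  fixes K L :: "(real \<times> real \<times> real) set"
  assumes K: "compact K" "convex K" and L: "compact L" "convex L"
    and v: "measure lborel K = v" "measure lborel L = v" "0 < v"
    and le: "measure lborel (combine (1/2) K L) \<le> v"
  shows "v * (Sup (fst ` L) - Sup (fst ` K)) =
    (\<integral>p. indicator L p *\<^sub>R fst p \<partial>lborel) - (\<integral>p. indicator K p *\<^sub>R fst p \<partial>lborel)"
proof -
  define M where "M = combine (1/2) K L"
  have M: "compact M" "convex M" using K L by (auto simp: M_def compact_combine convex_combine)
  have half: "x powr (1 - 1/2) * x powr (1/2) = x" if "0 \<le> x" for x :: real
    using that by (simp flip: powr_add)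
  \<comment> \<open>The inequality itself bounds this volume from below, the hypothesis
    \<open>le\<close> from above.\<close>
  have mM: "measure lborel M = v"
    using brunn_minkowski_real3[OF K L, of "1/2"] le v half[of v] by (simp add: M_def)
  have iK: "interior K \<noteq> {}" and iL: "interior L \<noteq> {}" and iM: "interior M \<noteq> {}"
    using compact_convex_interior_of_measure[OF K] compact_convex_interior_of_measure[OF L]
      compact_convex_interior_of_measure[OF M] v mM by simp_all
  have ne: "K \<noteq> {}" "L \<noteq> {}" using v by auto
  obtain a b where ab: "fst ` K = {a..b}" "a \<le> b" using fst_image_interval[OF K ne(1)] .
  obtain c d where cd: "fst ` L = {c..d}" "c \<le> d" using fst_image_interval[OF L ne(2)] .
  have M_fst: "fst ` M = {(a + c) / 2..(b + d) / 2}"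
    using ab cd by (simp add: M_def fst_image_combine combine_Icc add_divide_distrib)
  let ?f = "\<lambda>t. measure lborel (slice K t)" and ?g = "\<lambda>t. measure lborel (slice L t)"
  let ?h = "\<lambda>t. measure lborel (slice M t)"
  obtain qK where qK:
    "\<And>p. 0 < p \<Longrightarrow> p < v \<Longrightarrow> a < qK p \<and> qK p < b \<and> cumulative K (qK p) = p"
    "\<And>t. a < t \<Longrightarrow> t < b \<Longrightarrow> 0 < cumulative K t \<and> cumulative K t < v \<and> qK (cumulative K t) = t"
    "\<And>p. 0 < p \<Longrightarrow> p < v \<Longrightarrow> (qK has_real_derivative inverse (?f (qK p))) (at p)"
    using quantile_exists[OF K iK ab] unfolding v by blast
  obtain qL where qL:
    "\<And>p. 0 < p \<Longrightarrow> p < v \<Longrightarrow> c < qL p \<and> qL p < d \<and> cumulative L (qL p) = p"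
    "\<And>t. c < t \<Longrightarrow> t < d \<Longrightarrow> 0 < cumulative L t \<and> cumulative L t < v \<and> qL (cumulative L t) = t"
    "\<And>p. 0 < p \<Longrightarrow> p < v \<Longrightarrow> (qL has_real_derivative inverse (?g (qL p))) (at p)"
    using quantile_exists[OF L iL cd] unfolding v by blast
  define m where "m p = (qK p + qL p) / 2" for p
  have slab: "compact (A \<inter> {x..y} \<times> UNIV)" "convex (A \<inter> {x..y} \<times> UNIV)"
    if "compact A" "convex A" for A :: "(real \<times> real \<times> real) set" and x y
  proof -
    have "closed ({x..y} \<times> (UNIV :: (real \<times> real) set))" by (intro closed_Times) auto
    with that show "compact (A \<inter> {x..y} \<times> UNIV)" "convex (A \<inter> {x..y} \<times> UNIV)"
      by (auto intro!: compact_Int_closed convex_Int convex_Times)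
  qed
  have slab_le: "w \<le> measure lborel (M \<inter> {(x + z) / 2..(y + z') / 2} \<times> UNIV)"
    if w: "measure lborel (K \<inter> {x..y} \<times> UNIV) = w" "measure lborel (L \<inter> {z..z'} \<times> UNIV) = w" for w x y z z'
  proof -
    have "w = w powr (1 - 1/2) * w powr (1/2)" using w half[of w] measure_nonneg by metis
    also have "\<dots> \<le> measure lborel (combine (1/2) (K \<inter> {x..y} \<times> UNIV) (L \<inter> {z..z'} \<times> UNIV))"
      using brunn_minkowski_real3[OF slab[OF K] slab[OF L], of "1/2" x y z z'] w by simp
    also have "\<dots> \<le> measure lborel (M \<inter> {(x + z) / 2..(y + z') / 2} \<times> UNIV)"
    proof (rule measure_mono_fmeasurable)
      show "combine (1/2) (K \<inter> {x..y} \<times> UNIV) (L \<inter> {z..z'} \<times> UNIV) \<subseteq> M \<inter> {(x + z) / 2..(y + z') / 2} \<times> UNIV"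
        using combine_mono[of "K \<inter> {x..y} \<times> UNIV" K "L \<inter> {z..z'} \<times> UNIV" L "1/2"]
        by (auto simp: M_def elim!: combineE)
    qed (use K L M slab in \<open>auto intro!: fmeasurable_compact borel_compact compact_combine\<close>)
    finally show ?thesis .
  qed
  have mid: "cumulative M (m p) = p" and m_in: "(a + c) / 2 < m p" "m p < (b + d) / 2"
    if p: "0 < p" "p < v" for p
  proof -
    note qKp = qK(1)[OF p] and qLp = qL(1)[OF p]
    show in1: "(a + c) / 2 < m p" and in2: "m p < (b + d) / 2" using qKp qLp by (auto simp: m_def)
    have full: "measure lborel (A \<inter> {x..y} \<times> UNIV) = measure lborel A" if "fst ` A = {x..y}"
      for A :: "(real \<times> real \<times> real) set" and x y
    proof -
      have "A \<inter> {x..y} \<times> UNIV = A" using Int_fst_image[of A] that by simp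
      then show ?thesis by simp
    qed
    have 1: "measure lborel (K \<inter> {a..qK p} \<times> UNIV) = p" "measure lborel (L \<inter> {c..qL p} \<times> UNIV) = p"
      using qKp qLp ab cd by (auto simp: cumulative_def)
    then have 2: "measure lborel (K \<inter> {qK p..b} \<times> UNIV) = v - p" "measure lborel (L \<inter> {qL p..d} \<times> UNIV) = v - p"
      using measure_slab_add[OF K(1), of a "qK p" b] measure_slab_add[OF L(1), of c "qL p" d]
        full[OF ab(1)] full[OF cd(1)] qKp qLp v by auto
    \<comment> \<open>The two parts of the midpoint body have volumes at least \<open>p\<close> and
      \<open>v - p\<close> and add up to \<open>v\<close>, so both bounds are attained.\<close>
    have "measure lborel (M \<inter> {(a + c) / 2..m p} \<times> UNIV) + measure lborel (M \<inter> {m p..(b + d) / 2} \<times> UNIV) = v"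
      using measure_slab_add[OF M(1), of "(a + c) / 2" "m p" "(b + d) / 2"] full[OF M_fst] in1 in2 mM by auto
    then have "measure lborel (M \<inter> {(a + c) / 2..m p} \<times> UNIV) = p"
      using slab_le[OF 1] slab_le[OF 2] by (simp add: m_def)
    moreover have "Inf (fst ` M) = (a + c) / 2" using M_fst ab cd by simp
    ultimately show "cumulative M (m p) = p" by (simp only: cumulative_def)
  qed
  have fg: "?f (qK p) = ?g (qL p)" if p: "0 < p" "p < v" for p
  proof -
    let ?x = "?f (qK p)" and ?y = "?g (qL p)" and ?z = "?h (m p)"
    have pos: "0 < ?x" "0 < ?y"
      using slice_measure_pos[OF K iK ab(1)] slice_measure_pos[OF L iL cd(1)] qK(1)[OF p] qL(1)[OF p] by auto
    \<comment> \<open>Differentiating \<open>cumulative M (m p) = p\<close> by the chain rule makes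
      the slice area of the midpoint body the harmonic mean of the other two slice areas.\<close>
    have "(m has_real_derivative (inverse ?x + inverse ?y) / 2) (at p)"
      unfolding m_def using qK(3)[OF p] qL(3)[OF p] by (auto intro!: derivative_eq_intros)
    then have "((\<lambda>p. cumulative M (m p)) has_real_derivative ?z * ((inverse ?x + inverse ?y) / 2)) (at p)"
      using cumulative_derivative[OF M iM M_fst m_in(1)[OF p] m_in(2)[OF p]]
      by (intro DERIV_chain2[where f = "cumulative M" and g = m])
    moreover have "((\<lambda>p. cumulative M (m p)) has_real_derivative 1) (at p)"
    proof (rule has_field_derivative_transform_within_open[OF DERIV_ident])
      show "\<And>x. x \<in> {0<..<v} \<Longrightarrow> x = cumulative M (m x)" using mid by simp
    qed (use p in auto)
    ultimately have D: "?z * ((inverse ?x + inverse ?y) / 2) = 1" by (rule DERIV_unique)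
    have "?x powr (1 - 1/2) * ?y powr (1/2) \<le> measure lborel (combine (1/2) (slice K (qK p)) (slice L (qL p)))"
      using K L by (intro brunn_minkowski_real2 compact_slice convex_slice) auto
    also have "\<dots> \<le> ?z"
    proof (rule measure_mono_fmeasurable)
      show "combine (1/2) (slice K (qK p)) (slice L (qL p)) \<subseteq> slice M (m p)"
        using slice_combine[of "1/2" K "qK p" L "qL p"] by (simp add: M_def m_def add_divide_distrib)
    qed (use K L M in \<open>auto intro!: fmeasurable_compact borel_compact compact_combine compact_slice\<close>)
    finally have "sqrt ?x * sqrt ?y \<le> ?z" using pos by (simp add: powr_half_sqrt)
    then show ?thesis using geometric_le_harmonic_mean_imp_eq[OF pos] D by blast
  qed
  define e where "e = qL (v / 2) - qK (v / 2)"
  have e: "qL p = qK p + e" if p: "0 < p" "p < v" for p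
  proof -
    have "qL p - qK p = qL (v / 2) - qK (v / 2)"
    proof (rule DERIV_isconst3[where a = 0 and b = v and f = "\<lambda>x. qL x - qK x" and x = p and y = "v / 2"])
      fix x assume x: "x \<in> {0<..<v}"
      then show "((\<lambda>x. qL x - qK x) has_real_derivative 0) (at x)"
        using qK(3)[of x] qL(3)[of x] fg[of x] by (auto intro!: derivative_eq_intros)
    qed (use p in auto)
    then show ?thesis by (simp add: e_def)
  qed
  have K_to_L: "c < t + e" "t + e < d" "?g (t + e) = ?f t" if "a < t" "t < b" for t
    using qK(2)[OF that] qL(1)[of "cumulative K t"] e[of "cumulative K t"] fg[of "cumulative K t"] by auto
  have L_to_K: "a < t - e" "t - e < b" if "c < t" "t < d" for t
    using qL(2)[OF that] qK(1)[of "cumulative L t"] e[of "cumulative L t"] by auto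
  have "a < b" "c < d" using qK(1)[of "v / 2"] qL(1)[of "v / 2"] v by auto
  \<comment> \<open>Translation by \<open>e\<close> matches the open intervals
    \<open>{a<..<b}\<close> and \<open>{c<..<d}\<close>; the end points follow by density.\<close>
  have "b \<le> d - e" by (rule dense_le_bounded[OF \<open>a < b\<close>]) (use K_to_L in \<open>auto simp: less_imp_le algebra_simps\<close>)
  moreover have "d \<le> b + e" by (rule dense_le_bounded[OF \<open>c < d\<close>]) (use L_to_K in \<open>auto simp: less_imp_le algebra_simps\<close>)
  ultimately have d: "d = b + e" by simp
  have "c - e \<le> a" by (rule dense_ge_bounded[OF \<open>a < b\<close>]) (use K_to_L in \<open>auto simp: less_imp_le algebra_simps\<close>)
  moreover have "a + e \<le> c" by (rule dense_ge_bounded[OF \<open>c < d\<close>]) (use L_to_K in \<open>auto simp: less_imp_le algebra_simps\<close>)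
  ultimately have c: "c = a + e" by simp
  have outside: "measure lborel (slice A t) = 0" if "t \<notin> fst ` A" for A :: "(real \<times> real \<times> real) set" and t
  proof -
    have "slice A t = {}" using that by (force simp: slice_def)
    then show ?thesis by simp
  qed
  \<comment> \<open>The slices exactly over the ends \<open>a\<close> and \<open>b\<close> are not
    controlled, hence only an almost-everywhere identity.\<close>
  have ae: "AE t in lborel. ?g (t + e) = ?f t"
    using AE_lborel_singleton[of a] AE_lborel_singleton[of b]
  proof eventually_elim
    fix t assume "t \<noteq> a" "t \<noteq> b"
    then show "?g (t + e) = ?f t"
      using K_to_L[of t] outside[of t K] outside[of "t + e" L] ab cd c d by (cases "a < t \<and> t < b") auto
  qed
  have "(\<integral>p. indicator L p *\<^sub>R fst p \<partial>lborel) = (\<integral>t. t * ?g t \<partial>lborel)"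
    by (rule integral_fst_slices[OF L(1)])
  also have "\<dots> = (\<integral>t. (e + t) * ?g (e + t) \<partial>lborel)"
    using lborel_integral_real_affine[of 1 "\<lambda>t. t * ?g t" e] by simp
  also have "\<dots> = (\<integral>t. t * ?f t + e * ?f t \<partial>lborel)"
  proof (rule integral_cong_AE)
    show "AE t in lborel. (e + t) * ?g (e + t) = t * ?f t + e * ?f t"
      using ae by eventually_elim (auto simp: algebra_simps)
    have "?g \<in> borel_measurable borel" "?f \<in> borel_measurable borel"
      using K L by (auto simp: compact_imp_closed)
    note [measurable] = this
    show "(\<lambda>t. (e + t) * ?g (e + t)) \<in> borel_measurable lborel" "(\<lambda>t. t * ?f t + e * ?f t) \<in> borel_measurable lborel"
      by measurable
  qed
  also have "\<dots> = (\<integral>t. t * ?f t \<partial>lborel) + e * v"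
    using integral_fst_slices[OF K(1)] integrable_slices[OF K(1)] v by simp
  also have "(\<integral>t. t * ?f t \<partial>lborel) = (\<integral>p. indicator K p *\<^sub>R fst p \<partial>lborel)"
    by (rule integral_fst_slices(2)[OF K(1), symmetric])
  finally show ?thesis using ab cd d by (simp add: mult.commute)
qed

lemma frame_inv_linear:
  assumes T: "frame T"
  shows "linear (inv T)"
proof (rule linearI)
  show "inv T (a + b) = inv T a + inv T b" for a b
    using frame_inv(2)[OF T, of "inv T a + inv T b"] by (simp add: linear_add[OF frame_linear[OF T]] frame_inv[OF T])
  show "inv T (c *\<^sub>R a) = c *\<^sub>R inv T a" for c a
    using frame_inv(2)[OF T, of "c *\<^sub>R inv T a"] by (simp add: linear_scale[OF frame_linear[OF T]] frame_inv[OF T])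
qed

lemma frame_vimage: "frame T \<Longrightarrow> inv T ` A = T -` A"
  by (simp add: bij_vimage_eq_inv_image frame_bij)

lemma emeasure_frame:
  assumes T: "frame T" and A: "A \<in> sets borel"
  shows "emeasure lborel (inv T ` A) = emeasure lborel A"
proof -
  have "emeasure lborel A = emeasure (distr lborel borel T) A" by (simp add: distr_frame[OF T])
  also have "\<dots> = emeasure lborel (T -` A)"
    using A frame_measurable[OF T] by (subst emeasure_distr) auto
  finally show ?thesis by (simp add: frame_vimage[OF T])
qed

lemma measure_frame: "frame T \<Longrightarrow> A \<in> sets borel \<Longrightarrow> measure lborel (inv T ` A) = measure lborel A"
  by (simp add: measure_def emeasure_frame)

lemma frame_inv_compact: "frame T \<Longrightarrow> compact A \<Longrightarrow> compact (inv T ` A)"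
  by (intro compact_continuous_image frame_inv_continuous)

lemma frame_inv_convex: "frame T \<Longrightarrow> convex A \<Longrightarrow> convex (inv T ` A)"
  by (intro convex_linear_image frame_inv_linear)

lemma combine_linear_image:
  assumes "linear f"
  shows "f ` combine s A B = combine s (f ` A) (f ` B)"
proof
  show "f ` combine s A B \<subseteq> combine s (f ` A) (f ` B)"
  proof
    fix z assume "z \<in> f ` combine s A B"
    then obtain a b where "a \<in> A" "b \<in> B" "z = f ((1 - s) *\<^sub>R a + s *\<^sub>R b)" by (auto elim!: combineE)
    then show "z \<in> combine s (f ` A) (f ` B)"
      by (auto simp: linear_add[OF assms] linear_scale[OF assms] intro: combineI)
  qed
  show "combine s (f ` A) (f ` B) \<subseteq> f ` combine s A B"
  proof
    fix z assume "z \<in> combine s (f ` A) (f ` B)"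
    then obtain a b where ab: "a \<in> A" "b \<in> B" "z = (1 - s) *\<^sub>R f a + s *\<^sub>R f b" by (auto elim!: combineE)
    then have "z = f ((1 - s) *\<^sub>R a + s *\<^sub>R b)" by (simp add: linear_add[OF assms] linear_scale[OF assms])
    then show "z \<in> f ` combine s A B" using combineI[OF ab(1,2)] by blast
  qed
qed

theorem brunn_minkowski:
  fixes A B :: "(real^3) set"
  assumes A: "compact A" "convex A" and B: "compact B" "convex B" and s: "0 < s" "s < 1"
  shows "measure lborel A powr (1 - s) * measure lborel B powr s \<le> measure lborel (combine s A B)"
proof -
  obtain T :: "real \<times> real \<times> real \<Rightarrow> real^3" where T: "frame T"
    by (rule frame_exists[of "axis 1 1"]) auto
  have "measure lborel (inv T ` A) powr (1 - s) * measure lborel (inv T ` B) powr s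
      \<le> measure lborel (combine s (inv T ` A) (inv T ` B))"
    using A B s T by (intro brunn_minkowski_real3 frame_inv_compact frame_inv_convex)
  then show ?thesis
    using A B by (simp add: measure_frame[OF T] borel_compact compact_combine
      flip: combine_linear_image[OF frame_inv_linear[OF T]])
qed

text \<open>A point of \<open>K\<close> outside \<open>L\<close> is strictly separated from
  \<open>L\<close>, and the unit normal of the separating plane would violate
  \<open>le\<close>.\<close>

lemma convex_subset_of_support:
  fixes K L :: "'a::euclidean_space set"
  assumes K: "bounded K" and L: "closed L" "convex L" "L \<noteq> {}"
    and le: "\<And>u. norm u = 1 \<Longrightarrow> Sup ((\<bullet>) u ` K) \<le> Sup ((\<bullet>) u ` L)"
  shows "K \<subseteq> L"
proof
  fix y assume y: "y \<in> K"
  show "y \<in> L"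
  proof (rule ccontr)
    assume "y \<notin> L"
    then obtain a b where ab: "a \<bullet> y < b" "\<And>z. z \<in> L \<Longrightarrow> b < a \<bullet> z"
      using separating_hyperplane_closed_point[OF L(2,1)] by blast
    then have "a \<noteq> 0" using L(3) by (metis all_not_in_conv inner_zero_left less_asym)
    define u where "u = - (a /\<^sub>R norm a)"
    have u: "norm u = 1" using \<open>a \<noteq> 0\<close> by (simp add: u_def)
    have "Sup ((\<bullet>) u ` L) \<le> - b / norm a"
      using L(3) ab(2) \<open>a \<noteq> 0\<close> by (intro cSUP_least) (auto simp: u_def field_simps less_imp_le)
    also have "\<dots> < u \<bullet> y" using ab(1) \<open>a \<noteq> 0\<close> by (simp add: u_def field_simps)
    also have "\<dots> \<le> Sup ((\<bullet>) u ` K)"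
      using y K by (intro cSUP_upper bounded_imp_bdd_above bounded_linear_image bounded_linear_inner_right) auto
    finally show False using le[OF u] by simp
  qed
qed

lemma Sup_translate:
  fixes S :: "real set"
  assumes S: "S \<noteq> {}" "bdd_above S"
  shows "Sup ((+) d ` S) = d + Sup S"
proof (rule antisym)
  show "Sup ((+) d ` S) \<le> d + Sup S" using S by (intro cSUP_least) (auto intro: cSup_upper)
  have "bdd_above ((+) d ` S)" using S(2) by (auto simp: bdd_above_def) (metis add_left_mono)
  then have "Sup S \<le> Sup ((+) d ` S) - d"
    using S by (intro cSup_least) (auto simp: le_diff_eq add.commute intro: cSUP_upper)
  then show "d + Sup S \<le> Sup ((+) d ` S)" by simp
qed

text \<open>The translation vector is the difference of the centroids.\<close>

theorem brunn_minkowski_equality: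
  fixes K L :: "(real^3) set"
  assumes K: "compact K" "convex K" and L: "compact L" "convex L"
    and v: "measure lborel K = v" "measure lborel L = v" "0 < v"
    and le: "measure lborel (combine (1/2) K L) \<le> v"
  obtains a where "L = (+) a ` K"
proof -
  define c where "c A = (\<integral>y. indicator A y *\<^sub>R y \<partial>lborel)" for A :: "(real^3) set"
  define a where "a = (c L - c K) /\<^sub>R v"
  have ne: "K \<noteq> {}" "L \<noteq> {}" using v by auto
  \<comment> \<open>In a frame with first axis \<open>u\<close>, the support number and the first
    moment in direction \<open>u\<close> become those of the first coordinate. The same vector
    \<open>a\<close> then serves every direction.\<close>
  have supp: "Sup ((\<bullet>) u ` L) = Sup ((\<bullet>) u ` K) + u \<bullet> a" if u: "norm u = 1" for u
  proof -
    obtain T where T: "frame T" "T (1, 0, 0) = u" using frame_exists[OF u] .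
    have fst_T: "fst p = u \<bullet> T p" for p
      using frame_inner[OF T(1), of "(1, 0, 0)" p] T(2) by (cases p) simp
    have Sup_eq: "Sup (fst ` inv T ` A) = Sup ((\<bullet>) u ` A)" for A
      by (simp add: image_image fst_T frame_inv[OF T(1)])
    have int_eq: "(\<integral>p. indicator (inv T ` A) p *\<^sub>R fst p \<partial>lborel) = u \<bullet> c A" if A: "compact A" for A
    proof -
      have int: "integrable lborel (\<lambda>y. indicator A y *\<^sub>R y)"
        using A by (intro borel_integrable_compact) (auto intro: continuous_intros)
      have "u \<bullet> c A = (\<integral>y. indicator A y *\<^sub>R (u \<bullet> y) \<partial>lborel)"
        unfolding c_def using integral_inner_right[OF int, of u] by (simp add: inner_scaleR_right)
      also have "\<dots> = (\<integral>y. indicator A y *\<^sub>R (u \<bullet> y) \<partial>distr lborel borel T)"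
        by (simp add: distr_frame[OF T(1)])
      also have "\<dots> = (\<integral>p. indicator A (T p) *\<^sub>R (u \<bullet> T p) \<partial>lborel)"
      proof (rule integral_distr)
        have [measurable]: "A \<in> sets borel" using A by (rule borel_compact)
        show "(\<lambda>y. indicat_real A y *\<^sub>R (u \<bullet> y)) \<in> borel_measurable borel" by measurable
      qed (use frame_measurable[OF T(1)] in simp)
      also have "\<dots> = (\<integral>p. indicator (inv T ` A) p *\<^sub>R fst p \<partial>lborel)"
        by (intro Bochner_Integration.integral_cong) (auto simp: frame_vimage[OF T(1)] fst_T indicator_def)
      finally show ?thesis ..
    qed
    have "v * (Sup (fst ` inv T ` L) - Sup (fst ` inv T ` K)) =
      (\<integral>p. indicator (inv T ` L) p *\<^sub>R fst p \<partial>lborel) - (\<integral>p. indicator (inv T ` K) p *\<^sub>R fst p \<partial>lborel)"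
      using K L v le
      by (intro brunn_minkowski_equality_fst frame_inv_compact frame_inv_convex T(1))
        (auto simp: measure_frame[OF T(1)] borel_compact compact_combine
          simp flip: combine_linear_image[OF frame_inv_linear[OF T(1)]])
    then have "v * (Sup ((\<bullet>) u ` L) - Sup ((\<bullet>) u ` K)) = u \<bullet> (c L - c K)"
      by (simp only: Sup_eq int_eq[OF K(1)] int_eq[OF L(1)] inner_diff_right)
    moreover have "u \<bullet> (c L - c K) = v * (u \<bullet> a)" using v(3) by (simp add: a_def)
    ultimately have "v * (Sup ((\<bullet>) u ` L) - Sup ((\<bullet>) u ` K)) = v * (u \<bullet> a)" by simp
    then show ?thesis using v(3) by simp
  qed
  have K': "compact ((+) a ` K)" "convex ((+) a ` K)" "(+) a ` K \<noteq> {}"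
    using K ne by (auto simp: compact_translation convex_translation)
  have supp': "Sup ((\<bullet>) u ` (+) a ` K) = Sup ((\<bullet>) u ` K) + u \<bullet> a" for u
  proof -
    have bd: "bdd_above ((\<bullet>) u ` K)"
      by (intro bounded_imp_bdd_above bounded_linear_image bounded_linear_inner_right compact_imp_bounded K)
    have "(\<bullet>) u ` (+) a ` K = (+) (u \<bullet> a) ` (\<bullet>) u ` K" by (simp add: image_image inner_add_right)
    also have "Sup \<dots> = u \<bullet> a + Sup ((\<bullet>) u ` K)"
      using bd ne by (intro Sup_translate) auto
    finally show ?thesis by simp
  qed
  have "L \<subseteq> (+) a ` K" "(+) a ` K \<subseteq> L"
    using K' K L ne supp supp'
    by (intro convex_subset_of_support; force intro: compact_imp_bounded compact_imp_closed)+
  then show ?thesis using that by blast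
qed

section \<open>Scaling, translation and limits of Lebesgue measure\<close>

lemma emeasure_lborel_scaleR:
  fixes A :: "'a::euclidean_space set"
  assumes A: "A \<in> sets borel" and t: "t > 0"
  shows "emeasure lborel ((*\<^sub>R) t ` A) = ennreal (t ^ DIM('a)) * emeasure lborel A"
proof -
  have m: "(*\<^sub>R) (inverse t) \<in> borel_measurable (borel :: 'a measure)" by simp
  have im: "(*\<^sub>R) t ` A = (*\<^sub>R) (inverse t) -` A"
    using t by (auto simp: image_iff) (metis right_inverse scaleR_one scaleR_scaleR less_irrefl)
  then have B: "(*\<^sub>R) t ` A \<in> sets borel" using measurable_sets_borel[OF m A] by simp
  have "emeasure lborel ((*\<^sub>R) t ` A) =
      emeasure (density (distr lborel borel (\<lambda>y. 0 + t *\<^sub>R y)) (\<lambda>_. \<bar>t\<bar> ^ DIM('a))) ((*\<^sub>R) t ` A)"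
    using lborel_affine[of t "0::'a"] t by simp
  also have "\<dots> = ennreal (t ^ DIM('a)) * emeasure (distr lborel borel (\<lambda>y. 0 + t *\<^sub>R y)) ((*\<^sub>R) t ` A)"
    using B t by (subst emeasure_density) (auto simp: nn_integral_cmult_indicator)
  also have "emeasure (distr lborel borel (\<lambda>y. 0 + t *\<^sub>R y)) ((*\<^sub>R) t ` A) = emeasure lborel A"
    using B t by (subst emeasure_distr) (auto intro!: arg_cong[where f = "emeasure lborel"])
  finally show ?thesis .
qed

lemma measure_lborel_scaleR:
  fixes A :: "'a::euclidean_space set"
  assumes "A \<in> sets borel" and "t > 0"
  shows "measure lborel ((*\<^sub>R) t ` A) = t ^ DIM('a) * measure lborel A"
  using assms by (simp add: measure_def emeasure_lborel_scaleR enn2real_mult)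

lemma measure_lborel_translation:
  fixes A :: "'a::euclidean_space set"
  assumes A: "A \<in> sets borel"
  shows "measure lborel ((+) a ` A) = measure lborel A"
proof -
  have m: "(+) (- a) \<in> borel_measurable (borel :: 'a measure)" by simp
  have "(+) a ` A = (+) (- a) -` A" by (auto simp: image_iff) (metis add.commute diff_add_cancel uminus_add_conv_diff)
  then have "emeasure lborel ((+) a ` A) = emeasure (distr lborel borel ((+) (- a))) A"
    using A by (subst emeasure_distr) auto
  then show ?thesis by (simp add: measure_def lborel_distr_plus)
qed

text \<open>Dominated convergence of the indicators, with a common ball as majorant. It serves
  volumes in space as well as face areas in the plane.\<close>

lemma measure_tendsto_AE:
  fixes A :: "nat \<Rightarrow> 'a::euclidean_space set"
  assumes A: "\<And>n. A n \<in> sets borel" "B \<in> sets borel" and r: "\<And>n. A n \<subseteq> cball 0 r" "B \<subseteq> cball 0 r"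
    and ae: "AE y in lborel. \<forall>\<^sub>F n in sequentially. y \<in> A n \<longleftrightarrow> y \<in> B"
  shows "(\<lambda>n. measure lborel (A n)) \<longlonglongrightarrow> measure lborel B"
proof -
  have "(\<lambda>n. \<integral>y. indicat_real (A n) y \<partial>lborel) \<longlonglongrightarrow> (\<integral>y. indicat_real B y \<partial>lborel)"
  proof (rule integral_dominated_convergence[where w = "indicat_real (cball 0 r)"])
    show "AE y in lborel. (\<lambda>n. indicat_real (A n) y) \<longlonglongrightarrow> indicat_real B y"
      using ae
    proof eventually_elim
      case (elim y)
      then have "\<forall>\<^sub>F n in sequentially. indicat_real (A n) y = indicat_real B y"
        by eventually_elim (auto simp: indicator_def)
      then show ?case by (rule tendsto_eventually)
    qed
    show "AE y in lborel. norm (indicat_real (A n) y) \<le> indicat_real (cball 0 r) y" for n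
      using r(1)[of n] by (intro AE_I2) (auto simp: indicator_def subset_iff)
    show "integrable lborel (indicat_real (cball 0 r :: 'a set))"
      by (intro integrable_real_indicator) (auto simp: emeasure_compact)
  qed (use A in auto)
  then show ?thesis by (simp add: space_borel)
qed

lemma AE_not_hyperplane:
  fixes w :: "'a::euclidean_space"
  assumes "w \<noteq> 0 \<or> c \<noteq> 0"
  shows "AE y in lborel. w \<bullet> y \<noteq> c"
proof -
  have "negligible {y. w \<bullet> y = c}" using assms by (rule negligible_hyperplane)
  moreover have "closed {y. w \<bullet> y = c}" by (intro closed_Collect_eq continuous_intros)
  ultimately have "{y. w \<bullet> y = c} \<in> null_sets lborel"
    by (simp add: negligible_iff_null_sets null_sets_completion_iff)
  then show ?thesis by (rule AE_I') auto
qed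

section \<open>Polytopes with prescribed normals\<close>

text \<open>\<open>spanning\<close> is a lower frame bound with constant \<open>c\<close>, and
  \<open>balanced\<close> is Minkowski's closing condition for equal face areas. Together they force
  every system of halfspaces to be bounded; \<open>balanced\<close> also makes the sum of support
  numbers translation invariant.\<close>

locale normal_system =
  fixes I :: "'i set" and x :: "'i \<Rightarrow> real^3" and c :: real
  assumes fin: "finite I" and unit: "\<And>i. i \<in> I \<Longrightarrow> norm (x i) = 1" and inj: "inj_on x I"
    and balanced: "(\<Sum>i\<in>I. x i) = 0"
    and c_pos: "0 < c" and spanning: "\<And>y. c * (norm y)\<^sup>2 \<le> (\<Sum>i\<in>I. (x i \<bullet> y)\<^sup>2)"
begin

definition body :: "('i \<Rightarrow> real) \<Rightarrow> (real^3) set" where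
  "body h = {y. \<forall>i\<in>I. x i \<bullet> y \<le> h i}"

definition vol :: "('i \<Rightarrow> real) \<Rightarrow> real" where
  "vol h = measure lborel (body h)"

definition chart :: "'i \<Rightarrow> real \<times> real \<times> real \<Rightarrow> real^3" where
  "chart i = (SOME T. frame T \<and> T (1, 0, 0) = x i)"

definition sect :: "'i \<Rightarrow> ('i \<Rightarrow> real) \<Rightarrow> (real \<times> real) set" where
  "sect i h = {p. chart i (h i, p) \<in> body h}"

text \<open>The area of the face with normal \<open>x i\<close>, measured in a chart of its plane.\<close>

definition area :: "'i \<Rightarrow> ('i \<Rightarrow> real) \<Rightarrow> real" where
  "area i h = measure lborel (sect i h)"

text \<open>The face areas depend continuously on \<open>h\<close> except where two antipodal halfspaces meet in a
  common plane.\<close>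

definition nondeg :: "('i \<Rightarrow> real) \<Rightarrow> bool" where
  "nondeg h \<longleftrightarrow> (\<forall>i\<in>I. \<forall>k\<in>I. x k = - x i \<longrightarrow> 0 < h i + h k)"

lemma chart:
  assumes "i \<in> I"
  shows frame_chart: "frame (chart i)" and chart_1: "chart i (1, 0, 0) = x i"
proof -
  have "\<exists>T. frame T \<and> T (1, 0, 0) = x i" using frame_exists[OF unit[OF assms]] by metis
  from someI_ex[OF this] show "frame (chart i)" "chart i (1, 0, 0) = x i" by (simp_all add: chart_def)
qed

lemma inner_chart: "i \<in> I \<Longrightarrow> y \<bullet> chart i q = inv (chart i) y \<bullet> q"
  using frame_inner[OF frame_chart, of i "inv (chart i) y" q] by (simp add: frame_inv frame_chart)

lemma inv_chart_self: "i \<in> I \<Longrightarrow> inv (chart i) (x i) = (1, 0, 0)"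
  using frame_inv(2)[OF frame_chart, of i "(1, 0, 0)"] by (simp add: chart_1)

lemma inner_chart_self: "i \<in> I \<Longrightarrow> x i \<bullet> chart i (t, p) = t"
  by (cases p) (simp add: inner_chart inv_chart_self)

text \<open>Within the plane of face \<open>i\<close>, these are the constraints that do not depend
  on the position in the plane: the face's own one, and that of an antipodal normal. The latter is
  the source of \<open>nondeg\<close>.\<close>

lemma inv_chart_planar:
  assumes i: "i \<in> I" and k: "k \<in> I" and z: "snd (inv (chart i) (x k)) = 0"
  shows "k = i \<or> x k = - x i"
proof -
  obtain r where r: "inv (chart i) (x k) = (r, 0)" using z by (metis prod.collapse)
  have "norm (inv (chart i) (x k)) = 1"
    using frame_norm[OF frame_chart[OF i], of "inv (chart i) (x k)"] unit[OF k] by (simp add: frame_inv frame_chart[OF i])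
  then have "\<bar>r\<bar> = 1" by (simp add: r)
  have "x k = chart i (r *\<^sub>R (1, 0, 0))"
    using frame_inv(1)[OF frame_chart[OF i], of "x k"] r by (simp add: zero_prod_def)
  then have "x k = r *\<^sub>R x i" by (simp only: linear_scale[OF frame_linear[OF frame_chart[OF i]]] chart_1[OF i])
  moreover have "r = 1 \<or> r = -1" using \<open>\<bar>r\<bar> = 1\<close> by linarith
  ultimately show ?thesis using inj i k by (auto simp: inj_on_def)
qed

lemma body_mono: "(\<And>i. i \<in> I \<Longrightarrow> g i \<le> h i) \<Longrightarrow> body g \<subseteq> body h"
  by (force simp: body_def)

lemma body_cong: "(\<And>i. i \<in> I \<Longrightarrow> g i = h i) \<Longrightarrow> body g = body h"
  by (auto simp: body_def)

lemma vol_cong: "(\<And>i. i \<in> I \<Longrightarrow> g i = h i) \<Longrightarrow> vol g = vol h"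
  unfolding vol_def by (simp cong: body_cong)

lemma closed_body: "closed (body h)"
proof -
  have "body h = (\<Inter>i\<in>I. {y. x i \<bullet> y \<le> h i})" by (auto simp: body_def)
  then show ?thesis by (auto intro!: closed_INT closed_Collect_le continuous_intros)
qed

lemma body_convex: "convex (body h)"
proof -
  have "body h = (\<Inter>i\<in>I. {y. x i \<bullet> y \<le> h i})" by (auto simp: body_def)
  then show ?thesis by (auto intro!: convex_INT convex_halfspace_le)
qed

text \<open>Each \<open>x i \<bullet> y\<close> is bounded above; since these numbers sum to zero,
  the others bound it below as well. The frame bound converts this into a bound on the norm.\<close>

lemma bounded_body: "bounded (body h)"
proof -
  define H where "H = (\<Sum>i\<in>I. \<bar>h i\<bar>)"
  \<comment> \<open>One bound for both signs: \<open>H\<close> from above and at most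
    \<open>card I\<close> copies of \<open>H\<close> from below.\<close>
  define m where "m = real (card I) + 1"
  have h_le: "h i \<le> H" if "i \<in> I" for i
  proof -
    have "h i \<le> \<bar>h i\<bar>" by simp
    also have "\<dots> \<le> H" unfolding H_def using fin that by (intro member_le_sum) auto
    finally show ?thesis .
  qed
  have H0: "0 \<le> H" by (auto simp: H_def intro: sum_nonneg)
  have "(norm y)\<^sup>2 \<le> real (card I) * (m * H)\<^sup>2 / c" if y: "y \<in> body h" for y
  proof -
    have *: "(x i \<bullet> y)\<^sup>2 \<le> (m * H)\<^sup>2" if i: "i \<in> I" for i
    proof -
      have up: "x k \<bullet> y \<le> H" if "k \<in> I" for k using y h_le[OF that] that by (force simp: body_def)
      have "(\<Sum>k\<in>I. x k \<bullet> y) = 0" using balanced by (simp flip: inner_sum_left)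
      then have "- (x i \<bullet> y) = (\<Sum>k\<in>I - {i}. x k \<bullet> y)" using fin i by (simp add: sum.remove)
      also have "\<dots> \<le> (\<Sum>k\<in>I - {i}. H)" using up by (intro sum_mono) auto
      also have "\<dots> \<le> real (card I) * H" using fin H0 by (auto intro!: mult_right_mono card_mono)
      finally have "\<bar>x i \<bullet> y\<bar> \<le> m * H" using up[OF i] H0 fin by (auto simp: m_def algebra_simps abs_le_iff intro: add_increasing add_increasing2)
      then show ?thesis using abs_le_square_iff[of "x i \<bullet> y" "m * H"] by linarith
    qed
    have "c * (norm y)\<^sup>2 \<le> (\<Sum>i\<in>I. (m * H)\<^sup>2)" using spanning[of y] sum_mono[OF *] by (rule order_trans)
    then show ?thesis using c_pos by (simp add: field_simps)
  qed
  then have "norm y \<le> sqrt (real (card I) * (m * H)\<^sup>2 / c)" if "y \<in> body h" for y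
    using that by (intro real_le_rsqrt) auto
  then show ?thesis unfolding bounded_iff by blast
qed

lemma compact_body: "compact (body h)"
  using closed_body bounded_body by (simp add: compact_eq_bounded_closed)

lemma body_borel: "body h \<in> sets borel"
  using closed_body by simp

text \<open>Provides a single system \<open>H\<close> whose body contains all the bodies of a
  convergent sequence, hence an integrable majorant.\<close>

lemma pointwise_bounded:
  assumes "\<And>i. i \<in> I \<Longrightarrow> (\<lambda>n. h n i) \<longlonglongrightarrow> (h0 i :: real)"
  obtains H where "\<And>n i. i \<in> I \<Longrightarrow> h n i \<le> H i" "\<And>i. i \<in> I \<Longrightarrow> h0 i \<le> H i"
proof -
  have "\<forall>i\<in>I. \<exists>M. (\<forall>n. h n i \<le> M) \<and> h0 i \<le> M"
  proof
    fix i assume i: "i \<in> I"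
    then have "Bseq (\<lambda>n. h n i)" using assms by (intro convergent_imp_Bseq convergentI)
    then obtain M where M: "\<And>n. norm (h n i) \<le> M" by (auto simp: Bseq_def)
    have "h n i \<le> M" for n using M[of n] by simp
    moreover from this have "h0 i \<le> M" using LIMSEQ_le_const2[OF assms[OF i]] by blast
    ultimately show "\<exists>M. (\<forall>n. h n i \<le> M) \<and> h0 i \<le> M" by blast
  qed
  then obtain H where "\<forall>i\<in>I. (\<forall>n. h n i \<le> H i) \<and> h0 i \<le> H i" by metis
  then show ?thesis using that by blast
qed

lemma eventually_le_iff_of_tendsto:
  fixes a b :: "nat \<Rightarrow> real"
  assumes "a \<longlonglongrightarrow> a0" "b \<longlonglongrightarrow> b0" "a0 \<noteq> b0"
  shows "\<forall>\<^sub>F n in sequentially. a n \<le> b n \<longleftrightarrow> a0 \<le> b0"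
proof (cases "a0 < b0")
  case True
  have "\<forall>\<^sub>F n in sequentially. 0 < b n - a n"
    using True by (intro order_tendstoD(1)[OF tendsto_diff[OF assms(2,1)]]) auto
  then show ?thesis by eventually_elim (use True in auto)
next
  case False
  then have "\<forall>\<^sub>F n in sequentially. 0 < a n - b n"
    using assms(3) by (intro order_tendstoD(1)[OF tendsto_diff[OF assms(1,2)]]) auto
  then show ?thesis by eventually_elim (use False assms(3) in auto)
qed

text \<open>A point off the finitely many limiting boundary planes eventually satisfies exactly the
  inequalities that hold in the limit.\<close>

lemma vol_tendsto:
  assumes h: "\<And>i. i \<in> I \<Longrightarrow> (\<lambda>n. h n i) \<longlonglongrightarrow> h0 i"
  shows "(\<lambda>n. vol (h n)) \<longlonglongrightarrow> vol h0"
proof -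
  obtain H where H: "\<And>n i. i \<in> I \<Longrightarrow> h n i \<le> H i" "\<And>i. i \<in> I \<Longrightarrow> h0 i \<le> H i"
    using pointwise_bounded[of h h0, OF h] by blast
  obtain r where r: "body H \<subseteq> cball 0 r" using bounded_body[of H] by (auto simp: bounded_iff subset_iff)
  show ?thesis unfolding vol_def
  proof (rule measure_tendsto_AE)
    show "body (h n) \<subseteq> cball 0 r" "body h0 \<subseteq> cball 0 r" for n
      using r body_mono[of "h n" H] body_mono[of h0 H] H by blast+
    have "AE y in lborel. \<forall>i\<in>I. x i \<bullet> y \<noteq> h0 i"
    proof (rule AE_finite_allI[OF fin])
      fix i assume "i \<in> I"
      then have "x i \<noteq> 0" using unit by force
      then show "AE y in lborel. x i \<bullet> y \<noteq> h0 i" by (intro AE_not_hyperplane) simp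
    qed
    then show "AE y in lborel. \<forall>\<^sub>F n in sequentially. y \<in> body (h n) \<longleftrightarrow> y \<in> body h0"
    proof eventually_elim
      case (elim y)
      have "\<forall>\<^sub>F n in sequentially. \<forall>i\<in>I. x i \<bullet> y \<le> h n i \<longleftrightarrow> x i \<bullet> y \<le> h0 i"
        using elim h by (intro eventually_ball_finite fin ballI eventually_le_iff_of_tendsto) auto
      then show ?case by eventually_elim (auto simp: body_def)
    qed
  qed (rule body_borel)+
qed

lemma sect_eq:
  assumes i: "i \<in> I"
  shows "sect i h = {p. \<forall>k\<in>I. fst (inv (chart i) (x k)) * h i + snd (inv (chart i) (x k)) \<bullet> p \<le> h k}"
  unfolding sect_def body_def using i by (simp add: inner_chart inner_prod_def)

lemma closed_sect: "i \<in> I \<Longrightarrow> closed (sect i h)"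
proof -
  assume i: "i \<in> I"
  have "sect i h = (\<Inter>k\<in>I. {p. fst (inv (chart i) (x k)) * h i + snd (inv (chart i) (x k)) \<bullet> p \<le> h k})"
    using sect_eq[OF i] by auto
  then show ?thesis by (auto intro!: closed_INT closed_Collect_le continuous_intros)
qed

lemma sect_subset_cball:
  assumes i: "i \<in> I" and r: "body h \<subseteq> cball 0 r"
  shows "sect i h \<subseteq> cball 0 r"
proof
  fix p assume "p \<in> sect i h"
  then have "norm (chart i (h i, p)) \<le> r" using r by (auto simp: sect_def)
  then have "norm (h i, p) \<le> r" by (simp add: frame_norm[OF frame_chart[OF i]])
  then have "norm p \<le> r" by (rule order_trans[OF norm_snd_le])
  then show "p \<in> cball 0 r" by simp
qed

lemma sect_borel: "i \<in> I \<Longrightarrow> sect i h \<in> sets borel"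
  using closed_sect by simp

text \<open>In the chart, a normal not parallel to \<open>x i\<close> cuts the plane of the face in
  a line, which is null. The remaining constraints do not depend on \<open>p\<close>: the one for
  \<open>i\<close> itself always holds, and an antipodal one is stable by
  \<open>nondeg\<close>.\<close>

lemma area_tendsto:
  assumes i: "i \<in> I" and nd: "nondeg h0" and h: "\<And>i. i \<in> I \<Longrightarrow> (\<lambda>n. h n i) \<longlonglongrightarrow> h0 i"
  shows "(\<lambda>n. area i (h n)) \<longlonglongrightarrow> area i h0"
proof -
  obtain H where H: "\<And>n i. i \<in> I \<Longrightarrow> h n i \<le> H i" "\<And>i. i \<in> I \<Longrightarrow> h0 i \<le> H i"
    using pointwise_bounded[of h h0, OF h] by blast
  obtain r where r: "body H \<subseteq> cball 0 r" using bounded_body[of H] by (auto simp: bounded_iff subset_iff)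
  define u w where "u k = fst (inv (chart i) (x k))" and "w k = snd (inv (chart i) (x k))" for k
  have sec: "sect i h = {p. \<forall>k\<in>I. u k * h i + w k \<bullet> p \<le> h k}" for h
    unfolding sect_eq[OF i] u_def w_def ..
  have wi: "u i = 1" "w i = 0" using inv_chart_self[OF i] by (simp_all add: u_def w_def zero_prod_def)
  have anti: "x k = - x i" "u k = -1" if "k \<in> I" "k \<noteq> i" "w k = 0" for k
  proof -
    show k: "x k = - x i" using inv_chart_planar[OF i that(1)] that by (simp add: w_def)
    have "inv (chart i) (x k) = - (1, 0, 0)"
      using linear_neg[OF frame_inv_linear[OF frame_chart[OF i]], of "x i"] inv_chart_self[OF i] k by simp
    then show "u k = -1" by (simp add: u_def)
  qed
  show ?thesis unfolding area_def
  proof (rule measure_tendsto_AE)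
    have "body (h n) \<subseteq> cball 0 r" "body h0 \<subseteq> cball 0 r" for n
      using r body_mono[of "h n" H] body_mono[of h0 H] H by blast+
    then show "sect i (h n) \<subseteq> cball 0 r" "sect i h0 \<subseteq> cball 0 r" for n
      using sect_subset_cball[OF i] by blast+
    have "AE p in lborel. \<forall>k\<in>I. w k \<noteq> 0 \<longrightarrow> w k \<bullet> p \<noteq> h0 k - u k * h0 i"
    proof (rule AE_finite_allI[OF fin])
      fix k
      show "AE p in lborel. w k \<noteq> 0 \<longrightarrow> w k \<bullet> p \<noteq> h0 k - u k * h0 i"
      proof (cases "w k = 0")
        case False
        then show ?thesis using AE_not_hyperplane[of "w k" "h0 k - u k * h0 i"] by simp
      qed simp
    qed
    then show "AE p in lborel. \<forall>\<^sub>F n in sequentially. p \<in> sect i (h n) \<longleftrightarrow> p \<in> sect i h0"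
    proof eventually_elim
      case (elim p)
      have "\<forall>\<^sub>F n in sequentially. u k * h n i + w k \<bullet> p \<le> h n k \<longleftrightarrow> u k * h0 i + w k \<bullet> p \<le> h0 k"
        if k: "k \<in> I" for k
      proof (cases "k = i")
        case False
        show ?thesis
        proof (rule eventually_le_iff_of_tendsto)
          show "(\<lambda>n. u k * h n i + w k \<bullet> p) \<longlonglongrightarrow> u k * h0 i + w k \<bullet> p" "(\<lambda>n. h n k) \<longlonglongrightarrow> h0 k"
            using h i k by (auto intro!: tendsto_intros)
          show "u k * h0 i + w k \<bullet> p \<noteq> h0 k"
          proof (cases "w k = 0")
            case True
            \<comment> \<open>Here the limiting constraint reads \<open>- h0 i \<le> h0 k\<close>
              for every \<open>p\<close>; \<open>nondeg\<close> makes it strict.\<close>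
            have "0 < h0 i + h0 k" using nd i k anti(1)[OF k False True] by (auto simp: nondeg_def)
            then show ?thesis using anti(2)[OF k False True] True by simp
          next
            case False
            then have "w k \<bullet> p \<noteq> h0 k - u k * h0 i" using elim k by blast
            then show ?thesis by linarith
          qed
        qed
      qed (simp add: wi)
      then have "\<forall>\<^sub>F n in sequentially. \<forall>k\<in>I. u k * h n i + w k \<bullet> p \<le> h n k \<longleftrightarrow> u k * h0 i + w k \<bullet> p \<le> h0 k"
        using fin by (intro eventually_ball_finite) auto
      then show ?case by eventually_elim (auto simp: sec)
    qed
  qed (use sect_borel[OF i] in auto)
qed

lemma nondeg_eventually:
  assumes "nondeg h0" and h: "\<And>i. i \<in> I \<Longrightarrow> (\<lambda>n. h n i) \<longlonglongrightarrow> h0 i"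
  shows "\<forall>\<^sub>F n in sequentially. nondeg (h n)"
proof -
  have "\<forall>\<^sub>F n in sequentially. \<forall>i\<in>I. \<forall>k\<in>I. x k = - x i \<longrightarrow> 0 < h n i + h n k"
  proof (intro eventually_ball_finite fin ballI)
    fix i k assume ik: "i \<in> I" "k \<in> I"
    show "\<forall>\<^sub>F n in sequentially. x k = - x i \<longrightarrow> 0 < h n i + h n k"
    proof (cases "x k = - x i")
      case True
      then have "0 < h0 i + h0 k" using assms(1) ik by (auto simp: nondeg_def)
      then have "\<forall>\<^sub>F n in sequentially. 0 < h n i + h n k"
        using h ik by (intro order_tendstoD(1)[OF tendsto_add[of "\<lambda>n. h n i" "h0 i" _ "\<lambda>n. h n k" "h0 k"]]) auto
      then show ?thesis by eventually_elim simp
    qed simp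
  qed
  then show ?thesis by (simp add: nondeg_def)
qed

end

section \<open>Derivatives of the volume\<close>

context normal_system begin

text \<open>Raising the single number \<open>h i\<close> from \<open>s\<close> to \<open>t\<close>
  adds a slab orthogonal to \<open>x i\<close>. Its slice at height \<open>r\<close> is the
  \<open>i\<close>th section of \<open>h(i := r)\<close>, because the other constraints stay
  fixed.\<close>

lemma vol_increment:
  assumes i: "i \<in> I" and st: "s \<le> t"
  shows "vol (h(i := s)) \<le> vol (h(i := t))"
    and "ennreal (vol (h(i := t)) - vol (h(i := s))) =
      (\<integral>\<^sup>+r. ennreal (area i (h(i := r))) * indicator {s..t} r \<partial>lborel)"
proof -
  note T = frame_chart[OF i]
  define B where "B r = inv (chart i) ` body (h(i := r))" for r
  have B: "compact (B r)" for r unfolding B_def by (intro frame_inv_compact T compact_body)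
  have mem: "(r, p) \<in> B t' \<longleftrightarrow> r \<le> t' \<and> p \<in> sect i (h(i := r))" for r p t'
    using i unfolding B_def frame_vimage[OF T]
    by (auto simp: sect_def body_def inner_chart_self split: if_splits)
  have vol: "vol (h(i := r)) = measure lborel (B r)" for r
    unfolding vol_def B_def by (rule measure_frame[OF T body_borel, symmetric])
  let ?S = "B t \<inter> {s..t} \<times> UNIV"
  have cS: "compact ?S" using B by (intro compact_Int_closed closed_Times) auto
  have "B t = B s \<union> ?S" using st by (auto simp: mem)
  moreover have "measure lborel (B s \<inter> ?S) = 0"
  proof -
    have "B s \<inter> ?S \<subseteq> B s \<inter> {s..s} \<times> UNIV" by (auto simp: mem)
    then have "measure lborel (B s \<inter> ?S) \<le> measure lborel (B s \<inter> {s..s} \<times> UNIV)"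
    proof (rule measure_mono_fmeasurable)
      show "B s \<inter> ?S \<in> sets lborel" using compact_Int[OF B cS] by (simp add: borel_compact)
      show "B s \<inter> {s..s} \<times> UNIV \<in> fmeasurable lborel"
        by (intro fmeasurable_compact compact_Int_closed B closed_Times) auto
    qed
    then show ?thesis using measure_hyperplane_slab[OF B, of s s] by (simp add: measure_le_0_iff)
  qed
  ultimately have eq: "vol (h(i := t)) = vol (h(i := s)) + measure lborel ?S"
    using measure_Un3[of "B s" lborel ?S] B cS by (simp add: vol fmeasurable_compact)
  then show "vol (h(i := s)) \<le> vol (h(i := t))" by simp
  have "ennreal (measure lborel ?S) = (\<integral>\<^sup>+r. ennreal (measure lborel (slice (B t) r)) * indicator {s..t} r \<partial>lborel)"
    by (rule slice_measure_Icc[OF B])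
  also have "\<dots> = (\<integral>\<^sup>+r. ennreal (area i (h(i := r))) * indicator {s..t} r \<partial>lborel)"
  proof (rule nn_integral_cong)
    fix r
    show "ennreal (measure lborel (slice (B t) r)) * indicator {s..t} r = ennreal (area i (h(i := r))) * indicator {s..t} r"
      by (cases "r \<le> t") (auto simp: slice_def mem area_def)
  qed
  finally show "ennreal (vol (h(i := t)) - vol (h(i := s))) =
      (\<integral>\<^sup>+r. ennreal (area i (h(i := r))) * indicator {s..t} r \<partial>lborel)" using eq by simp
qed

text \<open>The sections at varying heights are slices of one polyhedron, the one cut out by the
  other constraints.\<close>

lemma area_measurable:
  assumes i: "i \<in> I"
  shows "(\<lambda>r. area i (h(i := r))) \<in> borel_measurable borel"
proof -
  define C where "C = (\<Inter>k\<in>I - {i}. {q. inv (chart i) (x k) \<bullet> q \<le> h k})"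
  have "sect i (h(i := r)) = slice C r" for r
    using i inv_chart_self[OF i] unfolding sect_eq[OF i] slice_def C_def
    by (auto simp: inner_prod_def mult.commute)
  moreover have "closed C" unfolding C_def by (intro closed_INT ballI closed_Collect_le continuous_intros)
  ultimately show ?thesis unfolding area_def by (auto intro: slice_measurable)
qed

lemma vol_partial_derivative:
  assumes i: "i \<in> I" and nd: "\<And>r. a < r \<Longrightarrow> r < b \<Longrightarrow> nondeg (h(i := r))" and t: "a < t" "t < b"
  shows "((\<lambda>r. vol (h(i := r))) has_real_derivative area i (h(i := t))) (at t)"
proof (rule FTC_nn_integral[of "\<lambda>r. area i (h(i := r))" a b "\<lambda>r. vol (h(i := r))"])
  show "continuous_on {a<..<b} (\<lambda>r. area i (h(i := r)))"
  proof (rule continuous_on_sequentiallyI)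
    fix u r assume "r \<in> {a<..<b}" and u: "u \<longlonglongrightarrow> r"
    then have "nondeg (h(i := r))" using nd by simp
    then show "(\<lambda>n. area i (h(i := u n))) \<longlonglongrightarrow> area i (h(i := r))"
      using u by (intro area_tendsto i) auto
  qed
qed (use area_measurable[OF i] vol_increment[OF i] t in \<open>auto simp: area_def\<close>)

text \<open>Raising a coordinate only widens the gaps between antipodal halfspaces, so the
  admissible values form an upward ray.\<close>

lemma nondeg_coordinate_ge:
  assumes i: "i \<in> I" and nd: "nondeg (h(i := r))"
  obtains a where "a < r" "\<And>s. a < s \<Longrightarrow> nondeg (h(i := s))"
proof -
  \<comment> \<open>The bounds \<open>- h k\<close> come from antipodal normals;
    \<open>r - 1\<close> keeps the set nonempty when there are none.\<close>
  define a where "a = Max (insert (r - 1) ((\<lambda>k. - h k) ` {k \<in> I. x k = - x i}))"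
  have ne: "k \<noteq> i" if "x k = - x i" for k
  proof
    assume "k = i"
    then have "2 *\<^sub>R x i = 0" using that by (simp add: scaleR_2)
    then show False using unit[OF i] by simp
  qed
  have f: "finite (insert (r - 1) ((\<lambda>k. - h k) ` {k \<in> I. x k = - x i}))" using fin by simp
  have "a < r"
    unfolding a_def using nd i ne by (subst Max_less_iff[OF f]) (force simp: nondeg_def)+
  moreover have "nondeg (h(i := s))" if s: "a < s" for s
    unfolding nondeg_def
  proof (intro ballI impI)
    fix j k assume jk: "j \<in> I" "k \<in> I" "x k = - x j"
    have *: "- h k < s" if "k \<in> I" "x k = - x i" for k
      using s that unfolding a_def by (subst (asm) Max_less_iff[OF f]) auto
    have 0: "0 < (h(i := r)) j + (h(i := r)) k" using nd jk by (auto simp: nondeg_def)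
    consider "j = i" | "k = i" "j \<noteq> i" | "j \<noteq> i" "k \<noteq> i" by blast
    then show "0 < (h(i := s)) j + (h(i := s)) k"
    proof cases
      case 1 then show ?thesis using *[of k] jk ne[of k] by simp
    next
      case 2 then show ?thesis using *[of j] jk by simp
    next
      case 3 then show ?thesis using 0 by simp
    qed
  qed
  ultimately show ?thesis using that by blast
qed

text \<open>Because the nondegenerate values form an upward ray, nondegeneracy at the lower end
  already covers the whole segment.\<close>

lemma vol_mean_value:
  assumes i: "i \<in> I" and nd: "nondeg (h(i := r))" "nondeg (h(i := s))"
  obtains z where "\<bar>z - r\<bar> \<le> \<bar>s - r\<bar>" "vol (h(i := s)) - vol (h(i := r)) = (s - r) * area i (h(i := z))"
proof -
  have *: "\<exists>z. r \<le> z \<and> z \<le> s \<and> vol (h(i := s)) - vol (h(i := r)) = (s - r) * area i (h(i := z))"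
    if rs: "r < s" "nondeg (h(i := r))" for r s
  proof -
    obtain a where a: "a < r" "\<And>s. a < s \<Longrightarrow> nondeg (h(i := s))" using nondeg_coordinate_ge[OF i rs(2)] by blast
    have "\<exists>z>r. z < s \<and> vol (h(i := s)) - vol (h(i := r)) = (s - r) * area i (h(i := z))"
    proof (rule MVT2[OF rs(1)])
      fix z assume "r \<le> z" "z \<le> s"
      then show "((\<lambda>r. vol (h(i := r))) has_real_derivative area i (h(i := z))) (at z)"
        using a by (intro vol_partial_derivative[OF i, of a "s + 1"]) auto
    qed
    then show ?thesis by (auto intro: less_imp_le)
  qed
  consider "r < s" | "s < r" | "r = s" by linarith
  then show ?thesis
  proof cases
    case 1
    then obtain z where "r \<le> z" "z \<le> s" "vol (h(i := s)) - vol (h(i := r)) = (s - r) * area i (h(i := z))"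
      using *[OF _ nd(1)] by blast
    then show ?thesis using that[of z] by simp
  next
    case 2
    then obtain z where "s \<le> z" "z \<le> r" "vol (h(i := r)) - vol (h(i := s)) = (r - s) * area i (h(i := z))"
      using *[OF _ nd(2)] by blast
    then show ?thesis using that[of z] by (simp add: algebra_simps)
  next
    case 3
    then show ?thesis using that[of r] by simp
  qed
qed

text \<open>Continuous partial derivatives imply differentiability: coordinates are switched on one
  at a time, and each switch is handled by the mean value theorem together with continuity of the
  face areas.\<close>

lemma vol_directional_derivative:
  assumes nd: "nondeg h"
  shows "((\<lambda>s. vol (\<lambda>i. h i + s * v i)) has_real_derivative (\<Sum>i\<in>I. v i * area i h)) (at 0)"
proof -
  have "(\<lambda>n. (vol (\<lambda>i. h i + (if i \<in> J then s n * v i else 0)) - vol h) / s n) \<longlonglongrightarrow> (\<Sum>i\<in>J. v i * area i h)"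
    if J: "J \<subseteq> I" and s0: "\<And>n. s n \<noteq> 0" and s: "s \<longlonglongrightarrow> 0" for J s
    using finite_subset[OF J fin] J
  proof (induction J)
    case empty
    then show ?case by simp
  next
    case (insert k J)
    then have k: "k \<in> I" by simp
    define g where "g n = (\<lambda>i. h i + (if i \<in> J then s n * v i else 0))" for n
    define g' where "g' n = (\<lambda>i. h i + (if i \<in> insert k J then s n * v i else 0))" for n
    have gk: "(g n)(k := h k) = g n" "(g n)(k := h k + s n * v k) = g' n" for n
      using insert by (auto simp: g_def g'_def)
    have lim: "(\<lambda>n. g n i) \<longlonglongrightarrow> h i" "(\<lambda>n. g' n i) \<longlonglongrightarrow> h i" for i
    proof -
      have "(\<lambda>n. h i + s n * v i) \<longlonglongrightarrow> h i" using s by (auto intro!: tendsto_eq_intros)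
      then show "(\<lambda>n. g n i) \<longlonglongrightarrow> h i" "(\<lambda>n. g' n i) \<longlonglongrightarrow> h i"
        by (cases "i \<in> J"; cases "i = k"; simp add: g_def g'_def)+
    qed
    have ev: "\<forall>\<^sub>F n in sequentially. nondeg (g n) \<and> nondeg (g' n)"
      using lim by (intro eventually_conj nondeg_eventually[OF nd]) auto
    \<comment> \<open>The mean value identity is asked for only at nondegenerate \<open>n\<close>,
      so that the bound, and with it the convergence of \<open>z n\<close> to \<open>h k\<close>,
      holds for every \<open>n\<close>.\<close>
    define z where "z n = (SOME z. \<bar>z - h k\<bar> \<le> \<bar>s n * v k\<bar> \<and>
      (nondeg (g n) \<and> nondeg (g' n) \<longrightarrow> vol (g' n) - vol (g n) = (s n * v k) * area k ((g n)(k := z))))" for n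
    have z: "\<bar>z n - h k\<bar> \<le> \<bar>s n * v k\<bar> \<and>
      (nondeg (g n) \<and> nondeg (g' n) \<longrightarrow> vol (g' n) - vol (g n) = (s n * v k) * area k ((g n)(k := z n)))" for n
      unfolding z_def
    proof (rule someI_ex, cases "nondeg (g n) \<and> nondeg (g' n)")
      case True
      then have "nondeg ((g n)(k := h k))" "nondeg ((g n)(k := h k + s n * v k))" by (simp_all only: gk)
      from vol_mean_value[OF k this] show "\<exists>z. \<bar>z - h k\<bar> \<le> \<bar>s n * v k\<bar> \<and>
        (nondeg (g n) \<and> nondeg (g' n) \<longrightarrow> vol (g' n) - vol (g n) = (s n * v k) * area k ((g n)(k := z)))"
        unfolding gk by (metis add_diff_cancel_left')
    next
      case False
      then show "\<exists>z. \<bar>z - h k\<bar> \<le> \<bar>s n * v k\<bar> \<and>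
        (nondeg (g n) \<and> nondeg (g' n) \<longrightarrow> vol (g' n) - vol (g n) = (s n * v k) * area k ((g n)(k := z)))"
        by (intro exI[of _ "h k"]) auto
    qed
    have "(\<lambda>n. z n - h k) \<longlonglongrightarrow> 0"
    proof (rule Lim_null_comparison)
      show "\<forall>\<^sub>F n in sequentially. norm (z n - h k) \<le> \<bar>s n * v k\<bar>" using z by simp
      show "(\<lambda>n. \<bar>s n * v k\<bar>) \<longlonglongrightarrow> 0" using s by (auto intro!: tendsto_eq_intros tendsto_rabs_zero)
    qed
    then have "z \<longlonglongrightarrow> h k" by (simp add: LIM_zero_iff)
    then have "(\<lambda>n. area k ((g n)(k := z n))) \<longlonglongrightarrow> area k h"
    proof (intro area_tendsto k nd)
      show "(\<lambda>n. ((g n)(k := z n)) i) \<longlonglongrightarrow> h i" for i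
        using lim(1)[of i] \<open>z \<longlonglongrightarrow> h k\<close> by (cases "i = k") auto
    qed
    then have "(\<lambda>n. v k * area k ((g n)(k := z n)) + (vol (g n) - vol h) / s n)
        \<longlonglongrightarrow> v k * area k h + (\<Sum>i\<in>J. v i * area i h)"
      using insert unfolding g_def by (intro tendsto_intros) auto
    moreover have "\<forall>\<^sub>F n in sequentially. v k * area k ((g n)(k := z n)) + (vol (g n) - vol h) / s n = (vol (g' n) - vol h) / s n"
      using ev
    proof eventually_elim
      case (elim n)
      then have "vol (g' n) = vol (g n) + (s n * v k) * area k ((g n)(k := z n))" using z[of n] by simp
      then show ?case using s0[of n] by (simp add: field_simps)
    qed
    ultimately have "(\<lambda>n. (vol (g' n) - vol h) / s n) \<longlonglongrightarrow> v k * area k h + (\<Sum>i\<in>J. v i * area i h)"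
      by (rule Lim_transform_eventually)
    then show ?case using insert unfolding g'_def by simp
  qed
  note * = this[OF order_refl]
  have "((\<lambda>s. (vol (\<lambda>i. h i + s * v i) - vol h) / s) \<longlongrightarrow> (\<Sum>i\<in>I. v i * area i h)) (at 0)"
    unfolding tendsto_at_iff_sequentially
  proof (intro allI impI)
    fix s :: "nat \<Rightarrow> real" assume "\<forall>n. s n \<in> UNIV - {0}" "s \<longlonglongrightarrow> 0"
    then have "(\<lambda>n. (vol (\<lambda>i. h i + (if i \<in> I then s n * v i else 0)) - vol h) / s n) \<longlonglongrightarrow> (\<Sum>i\<in>I. v i * area i h)"
      by (intro *) auto
    moreover have "vol (\<lambda>i. h i + (if i \<in> I then s n * v i else 0)) = vol (\<lambda>i. h i + s n * v i)" for n
      by (rule vol_cong) simp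
    ultimately show "((\<lambda>s. (vol (\<lambda>i. h i + s * v i) - vol h) / s) \<circ> s) \<longlonglongrightarrow> (\<Sum>i\<in>I. v i * area i h)"
      by (simp add: comp_def)
  qed
  then show ?thesis by (simp add: DERIV_def)
qed

section \<open>Scaling, translation and positivity of the volume\<close>

lemma body_scale:
  assumes "t > 0"
  shows "body (\<lambda>i. t * h i) = (*\<^sub>R) t ` body h"
proof
  show "body (\<lambda>i. t * h i) \<subseteq> (*\<^sub>R) t ` body h"
  proof
    fix y assume "y \<in> body (\<lambda>i. t * h i)"
    then have "(1 / t) *\<^sub>R y \<in> body h" using assms by (auto simp: body_def field_simps)
    then have "t *\<^sub>R (1 / t) *\<^sub>R y \<in> (*\<^sub>R) t ` body h" by (rule imageI)
    then show "y \<in> (*\<^sub>R) t ` body h" using assms by simp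
  qed
  show "(*\<^sub>R) t ` body h \<subseteq> body (\<lambda>i. t * h i)" using assms by (auto simp: body_def)
qed

lemma vol_scale: "t > 0 \<Longrightarrow> vol (\<lambda>i. t * h i) = t ^ 3 * vol h"
  unfolding vol_def by (simp add: body_scale measure_lborel_scaleR body_borel)

lemma area_scale:
  assumes i: "i \<in> I" and t: "t > 0"
  shows "area i (\<lambda>i. t * h i) = t\<^sup>2 * area i h"
proof -
  have scale: "chart i (t * r, t *\<^sub>R p) = t *\<^sub>R chart i (r, p)" for r p
    using linear_scale[OF frame_linear[OF frame_chart[OF i]], of t "(r, p)"] by simp
  have "sect i (\<lambda>i. t * h i) = (*\<^sub>R) t ` sect i h"
  proof
    show "sect i (\<lambda>i. t * h i) \<subseteq> (*\<^sub>R) t ` sect i h"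
    proof
      fix p assume p: "p \<in> sect i (\<lambda>i. t * h i)"
      have "chart i (t * h i, t *\<^sub>R (1 / t) *\<^sub>R p) \<in> (*\<^sub>R) t ` body h"
        using p t by (simp add: sect_def body_scale)
      then have "chart i (h i, (1 / t) *\<^sub>R p) \<in> body h" unfolding scale using t by auto
      then have "(1 / t) *\<^sub>R p \<in> sect i h" by (simp add: sect_def)
      then have "t *\<^sub>R (1 / t) *\<^sub>R p \<in> (*\<^sub>R) t ` sect i h" by (rule imageI)
      then show "p \<in> (*\<^sub>R) t ` sect i h" using t by simp
    qed
    show "(*\<^sub>R) t ` sect i h \<subseteq> sect i (\<lambda>i. t * h i)"
    proof
      fix q assume "q \<in> (*\<^sub>R) t ` sect i h"
      then obtain p where p: "p \<in> sect i h" "q = t *\<^sub>R p" by blast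
      then have "chart i (h i, p) \<in> body h" by (simp add: sect_def)
      then have "chart i (t * h i, q) \<in> (*\<^sub>R) t ` body h"
        unfolding scale p(2) by (rule imageI)
      then show "q \<in> sect i (\<lambda>i. t * h i)" using t by (simp add: sect_def body_scale)
    qed
  qed
  then show ?thesis unfolding area_def using t by (simp add: measure_lborel_scaleR sect_borel[OF i] power2_eq_square)
qed

lemma body_translate: "body (\<lambda>i. h i + x i \<bullet> a) = (+) a ` body h"
proof
  show "body (\<lambda>i. h i + x i \<bullet> a) \<subseteq> (+) a ` body h"
    by (auto simp: body_def inner_diff_right algebra_simps intro!: image_eqI[where x = "_ - a"])
  show "(+) a ` body h \<subseteq> body (\<lambda>i. h i + x i \<bullet> a)" by (auto simp: body_def inner_add_right)
qed

lemma vol_translate: "vol (\<lambda>i. h i + x i \<bullet> a) = vol h"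
  unfolding vol_def by (simp add: body_translate measure_lborel_translation body_borel)

text \<open>Two antipodal halfspaces with \<open>h i + h k \<le> 0\<close> would confine the body to
  a plane.\<close>

lemma vol_pos_imp_nondeg:
  assumes "0 < vol h"
  shows "nondeg h"
  unfolding nondeg_def
proof (intro ballI impI, rule ccontr)
  fix i k assume ik: "i \<in> I" "k \<in> I" "x k = - x i" and n: "\<not> 0 < h i + h k"
  have "x i \<noteq> 0" using unit[OF ik(1)] by force
  have "body h \<subseteq> {y. x i \<bullet> y = h i}"
  proof
    fix y assume "y \<in> body h"
    then have "x i \<bullet> y \<le> h i" "x k \<bullet> y \<le> h k" using ik by (auto simp: body_def)
    then show "y \<in> {y. x i \<bullet> y = h i}" using ik(3) n by simp
  qed
  then have "negligible (body h)"
    using negligible_hyperplane[of "x i" "h i"] \<open>x i \<noteq> 0\<close> negligible_subset by blast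
  then have "vol h = 0"
    unfolding vol_def by (simp add: negligible_iff_null_sets null_sets_completion_iff body_borel measure_eq_0_null_sets)
  then show False using assms by simp
qed

lemma vol_pos_iff_interior: "0 < vol h \<longleftrightarrow> interior (body h) \<noteq> {}"
proof
  assume "0 < vol h"
  then show "interior (body h) \<noteq> {}"
    using compact_convex_interior_of_measure[OF compact_body body_convex] by (simp add: vol_def)
next
  assume "interior (body h) \<noteq> {}"
  then obtain y e where e: "e > 0" "ball y e \<subseteq> body h" by (auto simp: mem_interior)
  then have "measure lborel (ball y e) \<le> vol h"
    unfolding vol_def by (intro measure_mono_fmeasurable fmeasurable_compact compact_body) auto
  then show "0 < vol h" by (rule less_le_trans[OF content_ball_pos[OF e(1)]])
qed

text \<open>Euler's identity for the volume, which is homogeneous of degree 3: differentiate along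
  \<open>h\<close> itself.\<close>

lemma vol_eq_sum_area:
  assumes "0 < vol h"
  shows "3 * vol h = (\<Sum>i\<in>I. h i * area i h)"
proof -
  have "((\<lambda>s. vol (\<lambda>i. h i + s * h i)) has_real_derivative (\<Sum>i\<in>I. h i * area i h)) (at 0)"
    by (intro vol_directional_derivative vol_pos_imp_nondeg assms)
  moreover have "((\<lambda>s. vol (\<lambda>i. h i + s * h i)) has_real_derivative 3 * vol h) (at 0)"
  proof (rule has_field_derivative_transform_within_open[where S = "{-1<..}"])
    show "((\<lambda>s. (1 + s) ^ 3 * vol h) has_real_derivative 3 * vol h) (at 0)"
      by (auto intro!: derivative_eq_intros)
    fix s :: real assume "s \<in> {-1<..}"
    then have "vol (\<lambda>i. (1 + s) * h i) = (1 + s) ^ 3 * vol h" by (intro vol_scale) auto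
    then show "(1 + s) ^ 3 * vol h = vol (\<lambda>i. h i + s * h i)" by (simp add: algebra_simps)
  qed auto
  ultimately show ?thesis by (simp add: DERIV_unique)
qed

end

section \<open>Equal face areas: existence and uniqueness\<close>

text \<open>Bolzano-Weierstrass, one coordinate at a time.\<close>

lemma pointwise_convergent_subsequence:
  fixes h :: "nat \<Rightarrow> 'i \<Rightarrow> real"
  assumes "finite J" and "\<And>n i. i \<in> J \<Longrightarrow> 0 \<le> h n i \<and> h n i \<le> 1"
  shows "\<exists>r :: nat \<Rightarrow> nat. strict_mono r \<and> (\<forall>i\<in>J. \<exists>l. (\<lambda>n. h (r n) i) \<longlonglongrightarrow> l)"
  using assms
proof (induction J)
  case empty
  then show ?case by (auto intro: exI[of _ id] simp: strict_mono_def)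
next
  case (insert k J)
  then obtain r where r: "strict_mono r" "\<forall>i\<in>J. \<exists>l. (\<lambda>n. h (r n) i) \<longlonglongrightarrow> l" by auto
  have "seq_compact {0..1::real}" by (intro compact_imp_seq_compact) simp
  then obtain l s where s: "strict_mono s" "((\<lambda>n. h (r n) k) \<circ> s) \<longlonglongrightarrow> l"
    using insert.prems by (auto elim: seq_compactE[where f = "\<lambda>n. h (r n) k"])
  have "\<exists>l. (\<lambda>n. h ((r \<circ> s) n) i) \<longlonglongrightarrow> l" if "i \<in> insert k J" for i
  proof (cases "i = k")
    case True
    then show ?thesis using s(2) by (auto simp: comp_def)
  next
    case False
    then have "i \<in> J" using that by simp
    then obtain l where "(\<lambda>n. h (r n) i) \<longlonglongrightarrow> l" using r(2) by blast
    from LIMSEQ_subseq_LIMSEQ[OF this s(1)] show ?thesis by (auto simp: comp_def)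
  qed
  moreover have "strict_mono (r \<circ> s)" using r(1) s(1) by (rule strict_mono_o)
  ultimately show ?case by blast
qed

context normal_system begin

lemma nonempty: "I \<noteq> {}"
proof
  assume "I = {}"
  then have "c * (norm (axis 1 1 :: real^3))\<^sup>2 \<le> 0" using spanning[of "axis 1 1"] by simp
  then show False using c_pos by simp
qed

lemma interior_body_strict:
  assumes y: "y \<in> interior (body h)" and i: "i \<in> I"
  shows "x i \<bullet> y < h i"
proof -
  obtain e where e: "e > 0" "ball y e \<subseteq> body h" using y by (auto simp: mem_interior)
  have "y + (e / 2) *\<^sub>R x i \<in> ball y e" using e(1) unit[OF i] by (simp add: dist_norm)
  then have "x i \<bullet> (y + (e / 2) *\<^sub>R x i) \<le> h i" using e(2) i by (auto simp: body_def)
  moreover have "x i \<bullet> x i = 1" using unit[OF i] by (simp add: dot_square_norm)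
  ultimately show ?thesis using e(1) by (simp add: inner_add_right)
qed

text \<open>By \<open>balanced\<close>, so translates may replace a body without affecting the
  constraint of the maximum problem.\<close>

lemma sum_translate: "(\<Sum>i\<in>I. h i + x i \<bullet> a) = (\<Sum>i\<in>I. h i)"
  using balanced by (simp add: sum.distrib flip: inner_sum_left)

text \<open>Move an interior point to the origin. This later removes the sign condition from the
  maximum problem.\<close>

lemma exists_pos_translate:
  assumes "0 < vol h"
  obtains a where "\<And>i. i \<in> I \<Longrightarrow> 0 < h i + x i \<bullet> a"
proof -
  obtain y where "y \<in> interior (body h)" using assms vol_pos_iff_interior by auto
  then have "0 < h i + x i \<bullet> (- y)" if "i \<in> I" for i using interior_body_strict[OF _ that, of y h] by simp
  then show ?thesis using that by blast
qed

text \<open>The sign condition makes the admissible set compact in the coordinates from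
  \<open>I\<close>; without it, translations would let the numbers \<open>h i\<close> escape to
  infinity. A maximizing sequence then has a limit, and the volume is continuous.\<close>

lemma exists_maximizer:
  obtains g where "0 < vol g" "(\<Sum>i\<in>I. g i) \<le> 1" "\<And>i. i \<in> I \<Longrightarrow> 0 \<le> g i"
    "\<And>h. (\<And>i. i \<in> I \<Longrightarrow> 0 \<le> h i) \<Longrightarrow> (\<Sum>i\<in>I. h i) \<le> 1 \<Longrightarrow> vol h \<le> vol g"
proof -
  define A where "A = {h. (\<forall>i\<in>I. 0 \<le> h i) \<and> (\<Sum>i\<in>I. h i) \<le> (1::real)}"
  have le1: "h i \<le> 1" if "h \<in> A" "i \<in> I" for h i
    using member_le_sum[of i I h] fin that by (force simp: A_def)
  have "vol h \<le> vol (\<lambda>_. 1)" if "h \<in> A" for h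
    unfolding vol_def using le1[OF that]
    by (intro measure_mono_fmeasurable fmeasurable_compact compact_body body_mono) (auto simp: body_borel)
  then have bdd: "bdd_above (vol ` A)" by (auto simp: bdd_above_def)
  have A0: "(\<lambda>_. 0) \<in> A" by (simp add: A_def)
  define S where "S = Sup (vol ` A)"
  have upper: "vol h \<le> S" if "h \<in> A" for h unfolding S_def using that bdd by (intro cSUP_upper)
  have "\<forall>n. \<exists>h\<in>A. S - 1 / real (Suc n) < vol h"
  proof
    fix n
    have "S - 1 / real (Suc n) < S" by simp
    then show "\<exists>h\<in>A. S - 1 / real (Suc n) < vol h"
      unfolding S_def using bdd A0 by (subst (asm) less_cSUP_iff) auto
  qed
  then obtain h where h: "\<And>n. h n \<in> A" "\<And>n. S - 1 / real (Suc n) < vol (h n)" by metis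
  obtain r :: "nat \<Rightarrow> nat" where r: "strict_mono r" "\<forall>i\<in>I. \<exists>l. (\<lambda>n. h (r n) i) \<longlonglongrightarrow> l"
    using pointwise_convergent_subsequence[OF fin, of h] h(1) le1 by (auto simp: A_def)
  then obtain g where g: "\<And>i. i \<in> I \<Longrightarrow> (\<lambda>n. h (r n) i) \<longlonglongrightarrow> g i" by metis
  have gA: "g \<in> A"
  proof -
    have "0 \<le> g i" if "i \<in> I" for i
      using h(1) that by (intro LIMSEQ_le_const[OF g[OF that]]) (auto simp: A_def)
    moreover have "(\<lambda>n. \<Sum>i\<in>I. h (r n) i) \<longlonglongrightarrow> (\<Sum>i\<in>I. g i)" using g by (intro tendsto_sum)
    then have "(\<Sum>i\<in>I. g i) \<le> 1"
      by (rule LIMSEQ_le_const2) (use h(1) in \<open>auto simp: A_def\<close>)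
    ultimately show ?thesis by (simp add: A_def)
  qed
  have lim: "(\<lambda>n. vol (h (r n))) \<longlonglongrightarrow> vol g" using g by (rule vol_tendsto)
  have "(\<lambda>n. S - 1 / real (Suc (r n))) \<longlonglongrightarrow> S - 0"
  proof (rule tendsto_diff[OF tendsto_const])
    have "(\<lambda>n. 1 / real (Suc n)) \<longlonglongrightarrow> 0" using LIMSEQ_inverse_real_of_nat by (simp add: inverse_eq_divide)
    from LIMSEQ_subseq_LIMSEQ[OF this r(1)] show "(\<lambda>n. 1 / real (Suc (r n))) \<longlonglongrightarrow> 0" by (simp add: comp_def)
  qed
  then have "S - 0 \<le> vol g" by (rule LIMSEQ_le[OF _ lim]) (use h(2) in \<open>auto intro: less_imp_le\<close>)
  then have max: "vol h \<le> vol g" if "h \<in> A" for h using upper[OF that] by simp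
  \<comment> \<open>An admissible competitor containing a ball shows that the maximum is
    positive.\<close>
  have "0 < vol (\<lambda>_. 1 / real (card I))"
  proof -
    have pos: "0 < 1 / real (card I)" using nonempty fin by (simp add: card_gt_0_iff)
    have "ball 0 (1 / real (card I)) \<subseteq> body (\<lambda>_. 1 / real (card I))"
    proof
      fix y :: "real^3" assume "y \<in> ball 0 (1 / real (card I))"
      then have "x i \<bullet> y \<le> 1 / real (card I)" if "i \<in> I" for i
        using norm_cauchy_schwarz[of "x i" y] unit[OF that] by simp
      then show "y \<in> body (\<lambda>_. 1 / real (card I))" by (simp add: body_def)
    qed
    then have "ball 0 (1 / real (card I)) \<subseteq> interior (body (\<lambda>_. 1 / real (card I)))"
      by (simp add: interior_maximal)
    moreover have "0 \<in> ball (0::real^3) (1 / real (card I))" using pos by simp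
    ultimately show ?thesis unfolding vol_pos_iff_interior by blast
  qed
  also have "\<dots> \<le> vol g" using fin by (intro max) (auto simp: A_def)
  finally have "0 < vol g" .
  then show ?thesis using that[of g] gA max by (auto simp: A_def)
qed

text \<open>At a maximizer the derivative of the volume in the direction of increasing \<open>h i\<close> and
  decreasing \<open>h j\<close> vanishes; that derivative is the difference of the two face areas.\<close>

lemma exists_equal_areas:
  obtains g a where "0 < a" "\<And>i. i \<in> I \<Longrightarrow> area i g = a" "0 < vol g"
    "\<And>h. (\<Sum>i\<in>I. h i) \<le> (\<Sum>i\<in>I. g i) \<Longrightarrow> vol h \<le> vol g"
proof -
  obtain g0 where g0: "0 < vol g0" "(\<Sum>i\<in>I. g0 i) \<le> 1"
    "\<And>h. (\<And>i. i \<in> I \<Longrightarrow> 0 \<le> h i) \<Longrightarrow> (\<Sum>i\<in>I. h i) \<le> 1 \<Longrightarrow> vol h \<le> vol g0"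
    using exists_maximizer by metis
  obtain b where b: "\<And>i. i \<in> I \<Longrightarrow> 0 < g0 i + x i \<bullet> b" using exists_pos_translate[OF g0(1)] by blast
  define g where "g i = g0 i + x i \<bullet> b" for i
  have vol_g: "vol g = vol g0" using vol_translate[of g0 b] by (simp add: g_def[abs_def])
  have sum_g: "(\<Sum>i\<in>I. g i) \<le> 1" using g0(2) by (simp add: g_def sum_translate)
  \<comment> \<open>A competitor of positive volume is first translated to have positive support
    numbers, which changes neither its volume nor its sum.\<close>
  have max: "vol h \<le> vol g" if "(\<Sum>i\<in>I. h i) \<le> (\<Sum>i\<in>I. g i)" for h
  proof (cases "0 < vol h")
    case True
    then obtain a where a: "\<And>i. i \<in> I \<Longrightarrow> 0 < h i + x i \<bullet> a" using exists_pos_translate by blast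
    have "vol (\<lambda>i. h i + x i \<bullet> a) \<le> vol g0"
      using that sum_g a by (intro g0(3)) (auto simp: sum_translate intro: less_imp_le)
    then show ?thesis by (simp add: vol_translate vol_g)
  next
    case False
    then show ?thesis using g0(1) vol_g by linarith
  qed
  have eq: "area i g = area j g" if ij: "i \<in> I" "j \<in> I" "i \<noteq> j" for i j
  proof -
    define v where "v k = (if k = i then 1 else if k = j then -1 else 0 :: real)" for k
    have sum_v: "(\<Sum>k\<in>I. v k * f k) = f i - f j" for f :: "'i \<Rightarrow> real"
    proof -
      have "(\<Sum>k\<in>I. v k * f k) = (\<Sum>k\<in>{i, j}. v k * f k)"
        using ij fin by (intro sum.mono_neutral_right) (auto simp: v_def)
      then show ?thesis using ij by (simp add: v_def)
    qed
    have "((\<lambda>s. vol (\<lambda>k. g k + s * v k)) has_real_derivative area i g - area j g) (at 0)"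
      using vol_directional_derivative[of g v] vol_pos_imp_nondeg g0(1) vol_g by (simp add: sum_v)
    then have "area i g - area j g = 0"
    proof (rule DERIV_local_max[of _ _ _ 1])
      show "\<forall>s. \<bar>0 - s\<bar> < 1 \<longrightarrow> vol (\<lambda>k. g k + s * v k) \<le> vol (\<lambda>k. g k + 0 * v k)"
      proof (intro allI impI)
        fix s :: real
        have "(\<Sum>k\<in>I. s * v k) = 0" using sum_v[of "\<lambda>_. s"] by (simp add: mult.commute)
        then have "vol (\<lambda>k. g k + s * v k) \<le> vol g" by (intro max) (simp add: sum.distrib)
        then show "vol (\<lambda>k. g k + s * v k) \<le> vol (\<lambda>k. g k + 0 * v k)" by simp
      qed
    qed simp
    then show ?thesis by simp
  qed
  obtain i where i: "i \<in> I" using nonempty by auto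
  have all: "area k g = area i g" if "k \<in> I" for k using eq[OF that i] by (cases "k = i") auto
  have "3 * vol g = (\<Sum>k\<in>I. g k * area i g)" using vol_eq_sum_area[of g] g0(1) vol_g all by simp
  then have "area i g \<noteq> 0" using g0(1) vol_g by auto
  then have "0 < area i g" by (simp add: area_def zero_less_measure_iff)
  then show ?thesis using that[of "area i g" g] all max g0(1) vol_g by auto
qed

section \<open>Comparison of bodies with equal face areas\<close>

lemma face_nonempty:
  assumes i: "i \<in> I" and a: "0 < area i h"
  obtains y where "y \<in> body h" "x i \<bullet> y = h i"
proof -
  have "sect i h \<noteq> {}" using a by (auto simp: area_def)
  then obtain p where "p \<in> sect i h" by auto
  then show ?thesis using that[of "chart i (h i, p)"] inner_chart_self[OF i] by (auto simp: sect_def)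
qed

lemma combine_body_subset:
  assumes "0 \<le> s" "s \<le> 1"
  shows "combine s (body g) (body h) \<subseteq> body (\<lambda>i. (1 - s) * g i + s * h i)"
  using assms
  by (auto simp: body_def inner_add_right elim!: combineE intro!: add_mono mult_left_mono)

text \<open>The Brunn-Minkowski inequality for equal volumes, since the interpolated halfspaces
  contain the Minkowski combination.\<close>

lemma vol_combination_ge:
  assumes "vol g = v" "vol h = v" "0 < v" "0 \<le> s" "s \<le> 1"
  shows "v \<le> vol (\<lambda>i. (1 - s) * g i + s * h i)"
proof (cases "s = 0 \<or> s = 1")
  case False
  then have s: "0 < s" "s < 1" using assms by auto
  have "v = v powr (1 - s) * v powr s" using assms by (simp flip: powr_add)
  also have "\<dots> \<le> measure lborel (combine s (body g) (body h))"
    using brunn_minkowski[OF compact_body body_convex compact_body body_convex s, of g h] assms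
    by (simp add: vol_def)
  also have "\<dots> \<le> vol (\<lambda>i. (1 - s) * g i + s * h i)"
    unfolding vol_def using combine_body_subset[of s g h] s
    by (intro measure_mono_fmeasurable fmeasurable_compact compact_body)
      (auto intro!: borel_compact compact_combine compact_body)
  finally show ?thesis .
qed (use assms in auto)

text \<open>After scaling to equal volumes, the Brunn--Minkowski inequality along the segment from \<open>h\<close>
  to \<open>g\<close> shows that the sum of the \<open>h i\<close> is at most that of the \<open>g i\<close>. Maximality of \<open>g\<close> then
  forces equality in the inequality at the midpoint.\<close>

lemma equal_areas_unique:
  assumes a: "0 < a" and g: "\<And>i. i \<in> I \<Longrightarrow> area i g = a" "0 < vol g"
    and max: "\<And>h. (\<Sum>i\<in>I. h i) \<le> (\<Sum>i\<in>I. g i) \<Longrightarrow> vol h \<le> vol g"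
    and h: "\<And>i. i \<in> I \<Longrightarrow> area i h = a" "0 < vol h"
  obtains b where "body h = (+) b ` body g"
proof -
  define v where "v = vol g"
  \<comment> \<open>The scaling factor that gives \<open>h\<close> the volume of
    \<open>g\<close>.\<close>
  define t where "t = root 3 (v / vol h)"
  have t: "0 < t" using g(2) h(2) by (simp add: t_def v_def)
  have t3: "t ^ 3 = v / vol h" using g(2) h(2) unfolding t_def v_def by (intro real_root_pow_pos2) auto
  define h' where "h' i = t * h i" for i
  have vh': "vol h' = v" using vol_scale[OF t, of h] t3 h(2) by (simp add: h'_def[abs_def])
  have ah': "area i h' = t\<^sup>2 * a" if "i \<in> I" for i
    using area_scale[OF that t, of h] h(1)[OF that] by (simp add: h'_def[abs_def])
  have v: "0 < v" "vol g = v" using g(2) by (auto simp: v_def)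
  have le: "(\<Sum>i\<in>I. h' i) \<le> (\<Sum>i\<in>I. g i)"
  proof (rule ccontr)
    assume n: "\<not> ?thesis"
    \<comment> \<open>The derivative of the volume at \<open>h'\<close> towards \<open>g\<close>.
      All face areas of \<open>h'\<close> agree, so its sign is that of the difference of the sums;
      a negative one would push the volume below \<open>v\<close> on the segment, against
      \<open>vol_combination_ge\<close>.\<close>
    define l where "l = (\<Sum>i\<in>I. (g i - h' i) * area i h')"
    have "l = t\<^sup>2 * a * ((\<Sum>i\<in>I. g i) - (\<Sum>i\<in>I. h' i))"
      using ah' by (simp add: l_def sum_distrib_left mult.commute flip: sum_subtractf)
    also have "\<dots> < 0" using n a t by (intro mult_pos_neg) auto
    finally have l: "l < 0" .
    have D: "((\<lambda>s. vol (\<lambda>i. h' i + s * (g i - h' i))) has_real_derivative l) (at 0)"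
      unfolding l_def using v vh' by (intro vol_directional_derivative vol_pos_imp_nondeg) simp
    obtain d where d: "d > 0" "\<And>s. 0 < s \<Longrightarrow> s < d \<Longrightarrow>
        vol (\<lambda>i. h' i + (0 + s) * (g i - h' i)) < vol (\<lambda>i. h' i + 0 * (g i - h' i))"
      using DERIV_neg_dec_right[OF D l] by blast
    define s where "s = min (d / 2) 1"
    have s: "0 < s" "s < d" "s \<le> 1" using d(1) by (auto simp: s_def)
    have "vol (\<lambda>i. (1 - s) * h' i + s * g i) < v" using d(2)[OF s(1,2)] vh' by (simp add: algebra_simps)
    then show False using vol_combination_ge[OF vh' v(2) v(1), of s] s by simp
  qed
  have "vol (\<lambda>i. (1 - 1/2) * h' i + 1/2 * g i) \<le> v"
    unfolding v_def
  proof (rule max)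
    have "(\<Sum>i\<in>I. (1 - 1/2) * h' i + 1/2 * g i) = 1/2 * (\<Sum>i\<in>I. h' i) + 1/2 * (\<Sum>i\<in>I. g i)"
      by (simp add: sum.distrib sum_distrib_left)
    then show "(\<Sum>i\<in>I. (1 - 1/2) * h' i + 1/2 * g i) \<le> (\<Sum>i\<in>I. g i)" using le by simp
  qed
  moreover have "measure lborel (combine (1/2) (body h') (body g)) \<le> vol (\<lambda>i. (1 - 1/2) * h' i + 1/2 * g i)"
    unfolding vol_def using combine_body_subset[of "1/2" h' g]
    by (intro measure_mono_fmeasurable fmeasurable_compact compact_body)
      (auto intro!: borel_compact compact_combine compact_body)
  ultimately have "measure lborel (combine (1/2) (body h') (body g)) \<le> v" by simp
  then obtain b where b: "body g = (+) b ` body h'"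
    using brunn_minkowski_equality[OF compact_body body_convex compact_body body_convex, of h' v g]
      v vh' unfolding vol_def by metis
  \<comment> \<open>The number \<open>h i\<close> can be recovered from the body because every face
    is nonempty: each bounding plane is touched.\<close>
  have gi: "g i = h' i + x i \<bullet> b" if i: "i \<in> I" for i
  proof (rule antisym)
    obtain y where y: "y \<in> body g" "x i \<bullet> y = g i" using face_nonempty[OF i, of g] g(1)[OF i] a by auto
    then obtain y' where "y' \<in> body h'" "y = b + y'" using b by auto
    then show "g i \<le> h' i + x i \<bullet> b" using y(2) i by (auto simp: body_def inner_add_right)
    obtain z where z: "z \<in> body h'" "x i \<bullet> z = h' i" using face_nonempty[OF i, of h'] ah'[OF i] a t by auto
    then have "b + z \<in> body g" using b by auto
    then have "x i \<bullet> (b + z) \<le> g i" using i by (auto simp: body_def)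
    then show "h' i + x i \<bullet> b \<le> g i" using z by (simp add: inner_add_right)
  qed
  have "(\<Sum>i\<in>I. g i) = (\<Sum>i\<in>I. h' i)" using sum_translate[of h' b] gi by simp
  moreover have "3 * v = a * (\<Sum>i\<in>I. g i)"
    using vol_eq_sum_area[OF g(2)] g(1) v(2) by (simp add: sum_distrib_left mult.commute)
  moreover have "3 * v = t\<^sup>2 * a * (\<Sum>i\<in>I. h' i)"
    using vol_eq_sum_area[of h'] ah' vh' v(1) by (simp add: mult.commute flip: sum_distrib_right)
  \<comment> \<open>Equal volumes and equal sums force equal face areas in the Euler identity, so no
    scaling took place.\<close>
  ultimately have "t\<^sup>2 = 1" using v(1) a by auto
  then have "t = 1" using t by (simp add: power2_eq_1_iff)
  then have "body h' = body h" by (simp add: h'_def[abs_def])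
  then have "body h = (+) (- b) ` body g" using b by (simp add: image_image)
  then show ?thesis using that by blast
qed

end

section \<open>Bodies whose surface area measure is carried by finitely many normals\<close>

text \<open>\<open>supports K z w\<close>: the functional \<open>w\<close> attains its maximum over \<open>K\<close> at \<open>z\<close>. Normalizing the
  first coordinate of \<open>w\<close> to 1 turns the remaining ones into (negative) slopes of the upper
  boundary of \<open>K\<close>.\<close>

definition supports :: "'a::real_inner set \<Rightarrow> 'a \<Rightarrow> 'a \<Rightarrow> bool" where
  "supports K z w \<longleftrightarrow> (\<forall>z'\<in>K. w \<bullet> (z' - z) \<le> 0)"

text \<open>The upper boundary of \<open>K\<close> is the graph of a concave function; these are the
  points where its supergradient is not unique along \<open>d\<close>.\<close>

definition kinks :: "(real \<times> 'b::real_inner) set \<Rightarrow> 'b \<Rightarrow> 'b set" where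
  "kinks K d = {p. \<exists>t m m'. (t, p) \<in> K \<and> supports K (t, p) (1, m) \<and> supports K (t, p) (1, m') \<and> m \<bullet> d < m' \<bullet> d}"

text \<open>Bounding the slopes by \<open>n\<close> and their gap below by
  \<open>1 / real (Suc n)\<close> gives compact sets, whose projections exhaust the kinks.\<close>

lemma kinks_borel:
  fixes K :: "(real \<times> 'b::euclidean_space) set"
  assumes K: "compact K"
  shows "kinks K d \<in> sets borel"
proof -
  define G where "G n = {(z, m, m'). supports K z (1, m) \<and> supports K z (1, m') \<and> m \<bullet> d + 1 / real (Suc n) \<le> m' \<bullet> d}
    \<inter> (K \<times> cball 0 (real n) \<times> cball 0 (real n))" for n
  have "closed {(z, m, m'). supports K z (1, m) \<and> supports K z (1, m') \<and> m \<bullet> d + 1 / real (Suc n) \<le> m' \<bullet> d}" for n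
  proof -
    have "{(z, m, m'). supports K z (1, m) \<and> supports K z (1, m') \<and> m \<bullet> d + 1 / real (Suc n) \<le> m' \<bullet> d} =
      (\<Inter>z'\<in>K. {q. (1, fst (snd q)) \<bullet> (z' - fst q) \<le> 0}) \<inter> (\<Inter>z'\<in>K. {q. (1, snd (snd q)) \<bullet> (z' - fst q) \<le> 0})
      \<inter> {q. fst (snd q) \<bullet> d + 1 / real (Suc n) \<le> snd (snd q) \<bullet> d}"
      by (rule set_eqI) (simp only: supports_def case_prod_beta mem_Collect_eq Int_iff INT_iff conj_assoc)
    then show ?thesis
      by (auto intro!: closed_Int closed_INT closed_Collect_le continuous_intros)
  qed
  then have "compact (G n)" for n
    unfolding G_def using K by (intro closed_Int_compact compact_Times) auto
  then have "compact ((\<lambda>q. snd (fst q)) ` G n)" for n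
    by (intro compact_continuous_image continuous_intros)
  then have "(\<Union>n. (\<lambda>q. snd (fst q)) ` G n) \<in> sets borel"
    by (intro sets.countable_UN) (auto intro: borel_compact)
  moreover have "(\<Union>n. (\<lambda>q. snd (fst q)) ` G n) = kinks K d"
  proof
    have *: "snd (fst q) \<in> kinks K d" if "q \<in> G n" for q n
    proof -
      obtain t p m m' where q: "q = ((t, p), m, m')" by (metis prod.collapse)
      have "m \<bullet> d + 1 / real (Suc n) \<le> m' \<bullet> d" using that q by (simp add: G_def del: of_nat_Suc)
      moreover have "0 < 1 / real (Suc n)" by simp
      ultimately have "m \<bullet> d < m' \<bullet> d" by linarith
      then show ?thesis using that q by (auto simp: G_def kinks_def)
    qed
    then show "(\<Union>n. (\<lambda>q. snd (fst q)) ` G n) \<subseteq> kinks K d" by blast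
    show "kinks K d \<subseteq> (\<Union>n. (\<lambda>q. snd (fst q)) ` G n)"
    proof
      fix p assume "p \<in> kinks K d"
      then obtain t m m' where p: "(t, p) \<in> K" "supports K (t, p) (1, m)" "supports K (t, p) (1, m')" "m \<bullet> d < m' \<bullet> d"
        by (auto simp: kinks_def)
      obtain n1 n2 n3 :: nat where n: "norm m < real n1" "norm m' < real n2" "1 / (m' \<bullet> d - m \<bullet> d) < real n3"
        using reals_Archimedean2 by metis
      define n where "n = n1 + n2 + n3"
      have "1 / (m' \<bullet> d - m \<bullet> d) < real (Suc n)" using n(3) by (simp add: n_def)
      then have "1 / real (Suc n) < m' \<bullet> d - m \<bullet> d" using p(4) by (simp add: field_simps)
      then have "((t, p), m, m') \<in> G n" using p n by (auto simp: G_def n_def)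
      then show "p \<in> (\<Union>n. (\<lambda>q. snd (fst q)) ` G n)" by (force intro: rev_image_eqI)
    qed
  qed
  ultimately show ?thesis by simp
qed

text \<open>Slopes of a concave function of one variable decrease, so the slope intervals at its kinks
  are disjoint and a rational can be chosen in each.\<close>

lemma countable_kinks_line:
  fixes K :: "(real \<times> 'b::real_inner) set"
  shows "countable {s. p + s *\<^sub>R d \<in> kinks K d}"
proof -
  let ?S = "{s. p + s *\<^sub>R d \<in> kinks K d}"
  have "\<forall>s\<in>?S. \<exists>t m m' r. (t, p + s *\<^sub>R d) \<in> K \<and> supports K (t, p + s *\<^sub>R d) (1, m) \<and>
      supports K (t, p + s *\<^sub>R d) (1, m') \<and> r \<in> \<rat> \<and> m \<bullet> d < r \<and> r < m' \<bullet> d"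
  proof
    fix s assume "s \<in> ?S"
    then obtain t m m' where "(t, p + s *\<^sub>R d) \<in> K \<and> supports K (t, p + s *\<^sub>R d) (1, m) \<and>
      supports K (t, p + s *\<^sub>R d) (1, m')" "m \<bullet> d < m' \<bullet> d" by (auto simp: kinks_def)
    then show "\<exists>t m m' r. (t, p + s *\<^sub>R d) \<in> K \<and> supports K (t, p + s *\<^sub>R d) (1, m) \<and>
      supports K (t, p + s *\<^sub>R d) (1, m') \<and> r \<in> \<rat> \<and> m \<bullet> d < r \<and> r < m' \<bullet> d"
      using Rats_dense_in_real[of "m \<bullet> d" "m' \<bullet> d"] by blast
  qed
  then obtain t m m' r where S: "\<And>s. s \<in> ?S \<Longrightarrow> (t s, p + s *\<^sub>R d) \<in> K \<and> supports K (t s, p + s *\<^sub>R d) (1, m s) \<and>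
      supports K (t s, p + s *\<^sub>R d) (1, m' s) \<and> r s \<in> \<rat> \<and> m s \<bullet> d < r s \<and> r s < m' s \<bullet> d"
    by metis
  have less: "r s < r s'" if s: "s \<in> ?S" "s' \<in> ?S" "s < s'" for s s'
  proof -
    have "(1, m' s) \<bullet> ((t s', p + s' *\<^sub>R d) - (t s, p + s *\<^sub>R d)) \<le> 0"
      using S[OF s(1)] S[OF s(2)] unfolding supports_def by blast
    moreover have "(1, m s') \<bullet> ((t s, p + s *\<^sub>R d) - (t s', p + s' *\<^sub>R d)) \<le> 0"
      using S[OF s(1)] S[OF s(2)] unfolding supports_def by blast
    ultimately have "(s' - s) * (m' s \<bullet> d) \<le> (s' - s) * (m s' \<bullet> d)"
      by (simp add: inner_diff_right inner_add_right algebra_simps)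
    then have "m' s \<bullet> d \<le> m s' \<bullet> d" using s(3) by simp
    then show ?thesis using S[OF s(1)] S[OF s(2)] by linarith
  qed
  then have "inj_on r ?S" by (intro inj_onI) (metis less_irrefl linorder_neqE)
  moreover have "countable (r ` ?S)" by (rule countable_subset[OF _ countable_rat]) (use S in auto)
  ultimately show ?thesis by (simp add: countable_image_inj_eq)
qed

text \<open>Fubini along the lines parallel to a coordinate axis, each of which meets the kinks in a
  countable set.\<close>

lemma null_kinks:
  fixes K :: "(real \<times> real \<times> real) set"
  assumes K: "compact K"
  shows "kinks K (1, 0) \<in> null_sets lborel" "kinks K (0, 1) \<in> null_sets lborel"
proof -
  have b: "kinks K d \<in> sets (lborel \<Otimes>\<^sub>M lborel)" for d
    by (subst lborel_prod) (use kinks_borel[OF K] in simp)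
  have "emeasure (lborel \<Otimes>\<^sub>M lborel) (kinks K (0, 1)) = (\<integral>\<^sup>+a. emeasure lborel (Pair a -` kinks K (0, 1)) \<partial>lborel)"
    by (rule lborel.emeasure_pair_measure_alt[OF b])
  also have "\<dots> = (\<integral>\<^sup>+a. 0 \<partial>(lborel :: real measure))"
  proof (rule nn_integral_cong)
    fix a :: real
    have "Pair a -` kinks K (0, 1) = {s. (a, 0) + s *\<^sub>R (0, 1) \<in> kinks K (0, 1)}" by auto
    then have "countable (Pair a -` kinks K (0, 1))" using countable_kinks_line by metis
    then show "emeasure lborel (Pair a -` kinks K (0, 1)) = 0" by (rule emeasure_lborel_countable)
  qed
  finally show "kinks K (0, 1) \<in> null_sets lborel"
    using kinks_borel[OF K] by (simp add: null_sets_def lborel_prod)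
  have "emeasure (lborel \<Otimes>\<^sub>M lborel) (kinks K (1, 0)) =
      (\<integral>\<^sup>+b. emeasure lborel ((\<lambda>a. (a, b)) -` kinks K (1, 0)) \<partial>lborel)"
    by (rule lborel_pair.emeasure_pair_measure_alt2[OF b])
  also have "\<dots> = (\<integral>\<^sup>+a. 0 \<partial>(lborel :: real measure))"
  proof (rule nn_integral_cong)
    fix b :: real
    have "(\<lambda>a. (a, b)) -` kinks K (1, 0) = {s. (0, b) + s *\<^sub>R (1, 0) \<in> kinks K (1, 0)}" by auto
    then have "countable ((\<lambda>a. (a, b)) -` kinks K (1, 0))" using countable_kinks_line by metis
    then show "emeasure lborel ((\<lambda>a. (a, b)) -` kinks K (1, 0)) = 0" by (rule emeasure_lborel_countable)
  qed
  finally show "kinks K (1, 0) \<in> null_sets lborel"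
    using kinks_borel[OF K] by (simp add: null_sets_def lborel_prod)
qed

lemma interior_inner_less:
  fixes k :: "'a::real_inner"
  assumes k: "k \<in> interior K" and u: "u \<noteq> 0"
  obtains z where "z \<in> K" "u \<bullet> k < u \<bullet> z"
proof -
  obtain e where e: "e > 0" "ball k e \<subseteq> K" using k by (auto simp: mem_interior)
  let ?z = "k + (e / (2 * norm u)) *\<^sub>R u"
  have "?z \<in> ball k e" using e(1) u by (simp add: dist_norm)
  moreover have "0 < (e / (2 * norm u)) * (u \<bullet> u)" using e(1) u by simp
  then have "u \<bullet> k < u \<bullet> ?z" by (simp add: inner_add_right)
  ultimately show ?thesis using that e(2) by blast
qed

lemma supporting_normal_exists:
  fixes K :: "(real^3) set"
  assumes K: "convex K" "closed K" "interior K \<noteq> {}" and y: "y \<in> frontier K"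
  obtains w where "outer_unit_normal K y w"
proof -
  have "y \<in> K" using y K(2) by (metis frontier_subset_closed subsetD)
  moreover have "y \<notin> rel_interior K" using y K(3) by (simp add: frontier_def rel_interior_nonempty_interior)
  ultimately obtain a where a: "a \<noteq> 0" "\<And>z. z \<in> K \<Longrightarrow> a \<bullet> y \<le> a \<bullet> z"
    using supporting_hyperplane_rel_boundary[OF K(1)] by metis
  have "outer_unit_normal K y (- (a /\<^sub>R norm a))"
    unfolding outer_unit_normal_def
  proof (intro conjI ballI)
    show "norm (- (a /\<^sub>R norm a)) = 1" using a(1) by simp
    fix z assume "z \<in> K"
    then have "0 \<le> a \<bullet> (z - y)" using a(2) by (simp add: inner_diff_right)
    then show "- (a /\<^sub>R norm a) \<bullet> (z - y) \<le> 0" by (simp add: zero_le_mult_iff)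
  qed
  then show ?thesis using that by blast
qed

text \<open>If some point \<open>y\<close> outside \<open>K\<close> satisfied all the inequalities, the boundary points of \<open>K\<close> seen
  from near \<open>y\<close> would have no normal in \<open>X\<close>. They project onto a disc, and almost all of them are
  regular.\<close>

lemma discrete_normals_imp_intersection_halfspaces:
  fixes K :: "(real^3) set"
  assumes K: "convex_body K" and X: "finite X" "X \<subseteq> sphere 0 1"
    and null: "area_outer {y \<in> regular_boundary K. normal_map K y \<notin> X} = 0"
  shows "K = {y. \<forall>u\<in>X. u \<bullet> y \<le> Sup ((\<bullet>) u ` K)}"
proof
  have Kc: "compact K" "convex K" "interior K \<noteq> {}" "closed K"
    using K by (auto simp: convex_body_def compact_imp_closed)
  define H where "H u = Sup ((\<bullet>) u ` K)" for u
  have H: "u \<bullet> z \<le> H u" if "z \<in> K" for u z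
    unfolding H_def using that
    by (intro cSUP_upper bounded_imp_bdd_above bounded_linear_image bounded_linear_inner_right compact_imp_bounded Kc)
  show "K \<subseteq> {y. \<forall>u\<in>X. u \<bullet> y \<le> Sup ((\<bullet>) u ` K)}" using H by (auto simp: H_def)
  show "{y. \<forall>u\<in>X. u \<bullet> y \<le> Sup ((\<bullet>) u ` K)} \<subseteq> K"
  proof (rule ccontr)
    assume "\<not> ?thesis"
    then obtain y0 where y0: "y0 \<notin> K" "\<And>u. u \<in> X \<Longrightarrow> u \<bullet> y0 \<le> H u" by (auto simp: H_def)
    obtain k where k: "k \<in> interior K" using Kc by auto
    have "open (- K)" using Kc by auto
    then obtain e where e: "e > 0" "ball y0 e \<subseteq> - K" using y0(1) by (meson ComplI openE)
    \<comment> \<open>Sliding \<open>y0\<close> towards the interior point \<open>k\<close> by less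
      than \<open>e\<close> keeps it outside \<open>K\<close> but makes all inequalities for
      \<open>X\<close> strict.\<close>
    define s where "s = min 1 (e / (2 * (norm (k - y0) + 1)))"
    have s: "0 < s" "s \<le> 1" using e(1) by (auto simp: s_def add_nonneg_pos)
    define y1 where "y1 = y0 + s *\<^sub>R (k - y0)"
    have "s * norm (k - y0) < e"
    proof -
      have "s * (2 * (norm (k - y0) + 1)) \<le> e"
        using pos_le_divide_eq[of "2 * (norm (k - y0) + 1)" s e] by (simp add: s_def add_nonneg_pos)
      moreover have "s * (2 * (norm (k - y0) + 1)) = s * norm (k - y0) + (s * norm (k - y0) + 2 * s)"
        by (simp add: algebra_simps)
      moreover have "0 < s * norm (k - y0) + 2 * s" using s by (simp add: add_nonneg_pos)
      ultimately show ?thesis by linarith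
    qed
    then have "y1 \<in> ball y0 e" using s by (simp add: y1_def dist_norm)
    then have y1: "y1 \<notin> K" using e(2) by auto
    have y1_less: "u \<bullet> y1 < H u" if u: "u \<in> X" for u
    proof -
      have "u \<noteq> 0" using u X(2) by auto
      then obtain z where "z \<in> K" "u \<bullet> k < u \<bullet> z" using interior_inner_less[OF k] by blast
      then have "u \<bullet> k < H u" using H[of z u] by simp
      then have "(1 - s) * (u \<bullet> y0) + s * (u \<bullet> k) < (1 - s) * H u + s * H u"
        using s y0(2)[OF u] by (intro add_le_less_mono mult_left_mono mult_strict_left_mono) auto
      then show ?thesis by (simp add: y1_def inner_add_right inner_diff_right algebra_simps)
    qed
    define l where "l = norm (y1 - k)"
    have "k \<in> K" using k interior_subset by blast
    then have l: "l > 0" using y1 by (auto simp: l_def)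
    define u0 where "u0 = (y1 - k) /\<^sub>R l"
    have "norm u0 = 1" using l by (simp add: u0_def l_def)
    then obtain T where T: "frame T" "T (1, 0, 0) = u0" by (rule frame_exists)
    have T_eq: "T (t, p) = t *\<^sub>R u0 + T (0, p)" for t p
    proof -
      have "(t, p) = t *\<^sub>R (1, 0, 0) + (0, p)" by (simp add: zero_prod_def)
      then show ?thesis
        by (metis T linear_add[OF frame_linear[OF T(1)]] linear_scale[OF frame_linear[OF T(1)]])
    qed
    have y1_eq: "y1 = k + l *\<^sub>R u0" using l by (simp add: u0_def)
    \<comment> \<open>Offsets \<open>p\<close> for which the segment in direction \<open>u0\<close>
      still starts inside \<open>K\<close>, ends outside it, and ends strictly within all halfspaces
      of \<open>X\<close>.\<close>
    define W where "W = {p. k + T (0, p) \<in> interior K} \<inter> {p. y1 + T (0, p) \<in> - K}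
      \<inter> (\<Inter>u\<in>X. {p. u \<bullet> (y1 + T (0, p)) < H u})"
    have cont: "continuous_on UNIV (\<lambda>p. z + T (0, p))" for z
      by (intro continuous_intros continuous_on_compose2[OF frame_continuous[OF T(1), of UNIV]]) auto
    have "W = (\<lambda>p. k + T (0, p)) -` interior K \<inter> (\<lambda>p. y1 + T (0, p)) -` (- K)
        \<inter> (\<Inter>u\<in>X. {p. u \<bullet> (y1 + T (0, p)) < H u})"
      by (auto simp: W_def)
    moreover have "open {p. u \<bullet> (y1 + T (0, p)) < H u}" for u
      by (rule open_Collect_less) (intro continuous_on_inner continuous_on_const cont)+
    ultimately have "open W"
      using X(1) Kc(4) cont by (auto intro!: open_Int open_INT open_vimage)
    moreover have "T (0, 0) = 0" using linear_0[OF frame_linear[OF T(1)]] by (simp add: zero_prod_def)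
    then have "0 \<in> W" using k y1 y1_less by (auto simp: W_def zero_prod_def)
    ultimately obtain r where r: "r > 0" "ball 0 r \<subseteq> W" by (meson openE)
    define K' where "K' = inv T ` (\<lambda>y. y - k) ` K"
    have K': "compact K'" unfolding K'_def using Kc(1)
      by (intro compact_continuous_image frame_inv_continuous[OF T(1)] continuous_intros)
    define G where "G = {y \<in> regular_boundary K. normal_map K y \<notin> X}"
    have key: "p \<in> kinks K' (1, 0) \<union> kinks K' (0, 1) \<union> {p. \<exists>t. T (t, p) \<in> (\<lambda>y. y - k) ` G}" if "p \<in> ball 0 r" for p
    proof (rule ccontr)
      assume n: "\<not> ?thesis"
      have p: "k + T (0, p) \<in> interior K" "y1 + T (0, p) \<notin> K" "\<And>u. u \<in> X \<Longrightarrow> u \<bullet> (y1 + T (0, p)) < H u"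
        using r(2) that by (auto simp: W_def)
      let ?S = "(\<lambda>t. k + T (t, p)) ` {0..l}"
      have "connected ?S"
        by (intro connected_continuous_image continuous_intros continuous_on_compose2[OF frame_continuous[OF T(1), of UNIV]]) auto
      moreover have "k + T (0, p) \<in> ?S \<inter> K" using l p(1) interior_subset by auto
      moreover have "k + T (l, p) \<in> ?S - K" 
      proof
        show "k + T (l, p) \<in> ?S" using l by (intro image_eqI[of _ _ l]) auto
        show "k + T (l, p) \<notin> K" using p(2) by (simp add: T_eq[of l] y1_eq add.assoc)
      qed
      ultimately have "?S \<inter> frontier K \<noteq> {}" by (intro connected_Int_frontier) auto
      then obtain t where t: "0 \<le> t" "t \<le> l" "k + T (t, p) \<in> frontier K" by auto
      define y where "y = k + T (t, p)"
      have y: "y \<in> frontier K" "y \<in> K" using t(3) Kc(4) by (auto simp: y_def frontier_def)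
      \<comment> \<open>The segment comes from an interior point, so a normal \<open>w\<close> where
        it leaves \<open>K\<close> has a positive component along \<open>u0\<close>. Further along,
        \<open>w \<bullet> y\<close> cannot decrease; for \<open>w\<close> in \<open>X\<close> this
        contradicts the strict inequality at the far end.\<close>
      have pos: "0 < w \<bullet> u0" "w \<notin> X" if w: "outer_unit_normal K y w" for w
      proof -
        have "w \<noteq> 0" using w by (auto simp: outer_unit_normal_def)
        then obtain z where z: "z \<in> K" "w \<bullet> (k + T (0, p)) < w \<bullet> z" using interior_inner_less[OF p(1)] by blast
        have "w \<bullet> z \<le> w \<bullet> y" using w z(1) by (auto simp: outer_unit_normal_def inner_diff_right)
        also have "w \<bullet> y = w \<bullet> (k + T (0, p)) + t * (w \<bullet> u0)"
          by (simp add: y_def T_eq[of t] inner_add_right)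
        finally have "0 < t * (w \<bullet> u0)" using z(2) by linarith
        then show wu: "0 < w \<bullet> u0" using t(1) by (simp add: zero_less_mult_iff)
        show "w \<notin> X"
        proof
          assume wX: "w \<in> X"
          have "H w \<le> w \<bullet> y" unfolding H_def
            using w Kc(3) by (intro cSUP_least) (auto simp: outer_unit_normal_def inner_diff_right)
          also have "\<dots> \<le> w \<bullet> y + (l - t) * (w \<bullet> u0)" using t(2) wu by simp
          also have "\<dots> = w \<bullet> (y1 + T (0, p))"
            by (simp add: y_def y1_eq T_eq[of t] inner_add_right algebra_simps)
          finally show False using p(3)[OF wX] by simp
        qed
      qed
      obtain w where w: "outer_unit_normal K y w" using supporting_normal_exists[OF Kc(2,4,3) y(1)] .
      have "w' = w" if w': "outer_unit_normal K y w'" for w'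
      proof -
        \<comment> \<open>The planar part of a normal rescaled to first coordinate 1, as required by
          \<open>supports\<close>; positivity of \<open>w \<bullet> u0\<close> makes this
          possible.\<close>
        define m where "m w = snd (inv T w) /\<^sub>R (w \<bullet> u0)" for w
        have fst_inv: "fst (inv T w) = w \<bullet> u0" for w
        proof -
          have "w \<bullet> u0 = inv T w \<bullet> (1, 0, 0)"
            using frame_inner[OF T(1), of "inv T w" "(1, 0, 0)"] by (simp only: frame_inv[OF T(1)] T(2))
          then show ?thesis by (simp add: inner_prod_def)
        qed
        have inv_eq: "inv T v = (v \<bullet> u0) *\<^sub>R (1, m v)" if "outer_unit_normal K y v" for v
          using pos(1)[OF that] by (intro prod_eqI) (simp_all add: fst_inv m_def)
        have tp: "(t, p) \<in> K'" using y(2) frame_inv(2)[OF T(1), of "(t, p)"]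
          by (auto simp: K'_def y_def image_iff intro!: bexI[of _ "k + T (t, p)"])
        have sup: "supports K' (t, p) (1, m v)" if v: "outer_unit_normal K y v" for v
          unfolding supports_def
        proof
          fix z' assume "z' \<in> K'"
          then obtain z where z: "z \<in> K" "z' = inv T (z - k)" by (auto simp: K'_def)
          have "(v \<bullet> u0) * ((1, m v) \<bullet> (z' - (t, p))) = inv T v \<bullet> (z' - (t, p))"
            unfolding inv_eq[OF v] by (rule inner_scaleR_left[symmetric])
          also have "\<dots> = v \<bullet> T (z' - (t, p))"
            using frame_inner[OF T(1), of "inv T v"] by (simp only: frame_inv[OF T(1)])
          also have "T (z' - (t, p)) = z - y"
            by (simp only: linear_diff[OF frame_linear[OF T(1)]] z(2) frame_inv[OF T(1)]) (simp add: y_def)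
          also have "v \<bullet> (z - y) \<le> 0" using v z(1) by (auto simp: outer_unit_normal_def)
          finally show "(1, m v) \<bullet> (z' - (t, p)) \<le> 0" using pos(1)[OF v] by (simp add: mult_le_0_iff)
        qed
        \<comment> \<open>With no kink in either coordinate direction, the rescaled normals agree,
          and unit length then fixes the normal itself.\<close>
        have "m w \<bullet> d = m w' \<bullet> d" if "d = (1, 0) \<or> d = (0, 1)" for d
        proof (rule ccontr)
          assume "m w \<bullet> d \<noteq> m w' \<bullet> d"
          then have "m w \<bullet> d < m w' \<bullet> d \<or> m w' \<bullet> d < m w \<bullet> d" by linarith
          then have "p \<in> kinks K' d" using tp sup[OF w] sup[OF w'] unfolding kinks_def by blast
          then show False using n that by auto
        qed
        from this[of "(1, 0)"] this[of "(0, 1)"] have "m w = m w'" by (intro prod_eqI) (auto simp: inner_prod_def)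
        then have par: "inv T w = (w \<bullet> u0) *\<^sub>R (1, m w)" "inv T w' = (w' \<bullet> u0) *\<^sub>R (1, m w)"
          using inv_eq[OF w] inv_eq[OF w'] by simp_all
        have "norm (inv T v) = 1" if "outer_unit_normal K y v" for v
          using that frame_norm[OF T(1), of "inv T v"] by (simp add: frame_inv[OF T(1)] outer_unit_normal_def)
        then have "(w \<bullet> u0) * norm (1::real, m w) = (w' \<bullet> u0) * norm (1::real, m w)"
          using par w w' pos(1) by (metis abs_of_pos norm_scaleR)
        moreover have "norm (1::real, m w) \<noteq> 0" by (simp add: zero_prod_def)
        ultimately have "inv T w' = inv T w" using par by simp
        then show ?thesis by (metis frame_inv(1)[OF T(1)])
      qed
      then have reg: "y \<in> regular_boundary K" using w y(1) by (auto simp: regular_boundary_def)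
      then have "normal_map K y \<notin> X" using pos(2)[of "normal_map K y"] normal_map_eq[OF reg, of "normal_map K y"] by simp
      then have "y \<in> G" using reg by (simp add: G_def)
      then have "T (t, p) \<in> (\<lambda>y. y - k) ` G" by (auto simp: y_def image_iff intro!: bexI[of _ "k + T (t, p)"])
      then show False using n by auto
    qed
    have "area_outer ((\<lambda>y. y - k) ` G) = 0"
      using null area_outer_isometric_image[of G "\<lambda>y. y - k"] by (simp add: G_def dist_norm)
    then have "negligible {p. \<exists>t. T (t, p) \<in> (\<lambda>y. y - k) ` G}" by (rule negligible_frame_projection[OF T(1)])
    moreover have "negligible (kinks K' (1, 0))" "negligible (kinks K' (0, 1))"
      using null_kinks[OF K'] by (auto simp: negligible_iff_null_sets null_sets_completionI)
    ultimately have "negligible (kinks K' (1, 0) \<union> kinks K' (0, 1) \<union> {p. \<exists>t. T (t, p) \<in> (\<lambda>y. y - k) ` G})"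
      by (intro negligible_Un)
    then have "negligible (ball (0 :: real \<times> real) r)" by (rule negligible_subset) (use key in blast)
    then show False using r(1) open_not_negligible[of "ball (0 :: real \<times> real) r"] by simp
  qed
qed

section \<open>Surface area measure of polytopes\<close>

lemma normal_map_preimage_sets:
  assumes A: "A \<in> sets borel_sphere"
  shows "{y \<in> regular_boundary K. normal_map K y \<in> A} \<in> sets area_measure"
proof -
  have "normal_map K -` A \<inter> space (restrict_space area_measure (regular_boundary K))
      \<in> sets (restrict_space area_measure (regular_boundary K))"
    by (rule measurable_sets[OF normal_map_measurable A])
  moreover have "normal_map K -` A \<inter> space (restrict_space area_measure (regular_boundary K)) =
      {y \<in> regular_boundary K. normal_map K y \<in> A}"
    by (auto simp: space_restrict_space space_area_measure)
  ultimately show ?thesis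
    using regular_boundary_borel by (auto simp: sets_restrict_space sets_area_measure)
qed

context normal_system begin

definition face :: "'i \<Rightarrow> ('i \<Rightarrow> real) \<Rightarrow> (real^3) set" where
  "face i h = body h \<inter> {y. x i \<bullet> y = h i}"

lemma chart_plane:
  assumes i: "i \<in> I"
  shows "y = chart i (x i \<bullet> y, snd (inv (chart i) y))"
proof -
  have "fst (inv (chart i) y) = x i \<bullet> y"
    using inner_chart_self[OF i, of "fst (inv (chart i) y)" "snd (inv (chart i) y)"]
    by (simp add: frame_inv[OF frame_chart[OF i]])
  then show ?thesis using frame_inv(1)[OF frame_chart[OF i], of y] by (metis prod.collapse)
qed

lemma face_eq_chart: "i \<in> I \<Longrightarrow> face i h = chart i ` ({h i} \<times> sect i h)"
proof
  assume i: "i \<in> I"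
  show "face i h \<subseteq> chart i ` ({h i} \<times> sect i h)"
  proof
    fix y assume "y \<in> face i h"
    then have "y = chart i (h i, snd (inv (chart i) y))" "y \<in> body h"
      using chart_plane[OF i, of y] by (auto simp: face_def)
    then show "y \<in> chart i ` ({h i} \<times> sect i h)" by (auto simp: sect_def)
  qed
  show "chart i ` ({h i} \<times> sect i h) \<subseteq> face i h"
    using inner_chart_self[OF i] by (auto simp: face_def sect_def)
qed

lemma compact_face: "compact (face i h)"
  unfolding face_def by (intro compact_Int_closed compact_body closed_Collect_eq continuous_intros)

lemma convex_face: "convex (face i h)"
  unfolding face_def by (intro convex_Int body_convex convex_hyperplane)

lemma compact_sect: "i \<in> I \<Longrightarrow> compact (sect i h)"
proof -
  assume i: "i \<in> I"
  obtain r where "body h \<subseteq> cball 0 r" using bounded_body[of h] by (auto simp: bounded_iff subset_iff)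
  then have "sect i h \<subseteq> cball 0 r" by (rule sect_subset_cball[OF i])
  then show ?thesis using closed_sect[OF i] bounded_subset[OF bounded_cball] by (auto simp: compact_eq_bounded_closed)
qed

lemma emeasure_sect: "i \<in> I \<Longrightarrow> emeasure lborel (sect i h) = ennreal (area i h)"
  unfolding area_def by (intro emeasure_compact compact_sect)

lemma interior_body:
  "interior (body h) \<noteq> {} \<Longrightarrow> y \<in> interior (body h) \<longleftrightarrow> (\<forall>i\<in>I. x i \<bullet> y < h i)"
proof
  assume "\<forall>i\<in>I. x i \<bullet> y < h i"
  then have y: "y \<in> (\<Inter>i\<in>I. {y. x i \<bullet> y < h i})" by simp
  have "open (\<Inter>i\<in>I. {y. x i \<bullet> y < h i})"
    using fin by (intro open_INT ballI open_Collect_less continuous_intros)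
  moreover have "(\<Inter>i\<in>I. {y. x i \<bullet> y < h i}) \<subseteq> body h" by (auto simp: body_def intro: less_imp_le)
  ultimately show "y \<in> interior (body h)" using y interior_maximal by blast
qed (use interior_body_strict in blast)

lemma frontier_body:
  assumes "interior (body h) \<noteq> {}"
  shows "frontier (body h) = (\<Union>i\<in>I. face i h)"
proof -
  have "frontier (body h) = body h - interior (body h)" by (simp add: frontier_def closed_body)
  also have "\<dots> = (\<Union>i\<in>I. face i h)"
    using interior_body[OF assms] by (force simp: face_def body_def not_less)
  finally show ?thesis .
qed

lemma outer_unit_normal_face_self:
  "i \<in> I \<Longrightarrow> y \<in> face i h \<Longrightarrow> outer_unit_normal (body h) y (x i)"
  using unit by (auto simp: outer_unit_normal_def face_def body_def inner_diff_right)

text \<open>Near such a point all other constraints are slack, so every direction \<open>v\<close>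
  with \<open>x i \<bullet> v \<le> 0\<close> leads into the body. A unit vector that is nonpositive
  on this whole halfspace can only be \<open>x i\<close>.\<close>

lemma outer_unit_normal_face:
  assumes i: "i \<in> I" and y: "y \<in> face i h" and only: "\<And>k. k \<in> I \<Longrightarrow> k \<noteq> i \<Longrightarrow> y \<notin> face k h"
  shows "outer_unit_normal (body h) y u \<longleftrightarrow> u = x i"
proof
  assume "u = x i"
  then show "outer_unit_normal (body h) y u" using outer_unit_normal_face_self[OF i y] by simp
next
  assume u: "outer_unit_normal (body h) y u"
  have yb: "y \<in> body h" "x i \<bullet> y = h i" using y by (auto simp: face_def)
  define W where "W = (\<Inter>k\<in>I - {i}. {z. x k \<bullet> z < h k})"
  have "open W" unfolding W_def using fin by (intro open_INT ballI open_Collect_less continuous_intros) auto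
  moreover have "y \<in> W" using only yb by (fastforce simp: W_def face_def body_def)
  ultimately obtain e where e: "e > 0" "ball y e \<subseteq> W" by (meson openE)
  have move: "u \<bullet> v \<le> 0" if v: "x i \<bullet> v \<le> 0" for v
  proof -
    define s where "s = e / (2 * (norm v + 1))"
    have s: "s > 0" using e(1) by (simp add: s_def add_nonneg_pos)
    have "s * norm v < s * (2 * (norm v + 1))" using s by (intro mult_strict_left_mono) (auto intro: add_nonneg_pos)
    also have "\<dots> = e"
    proof -
      have "norm v + 1 \<noteq> 0" using norm_ge_zero[of v] by linarith
      then show ?thesis by (simp add: s_def)
    qed
    finally have "y + s *\<^sub>R v \<in> ball y e" using s by (simp add: dist_norm)
    then have "y + s *\<^sub>R v \<in> W" using e(2) by blast
    moreover have "x i \<bullet> (y + s *\<^sub>R v) \<le> h i" using yb v s by (simp add: inner_add_right mult_nonneg_nonpos)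
    ultimately have "y + s *\<^sub>R v \<in> body h" by (force simp: W_def body_def intro: less_imp_le)
    then have "u \<bullet> (s *\<^sub>R v) \<le> 0" using u by (force simp: outer_unit_normal_def)
    then show ?thesis using s by (simp add: mult_le_0_iff)
  qed
  define c where "c = u \<bullet> x i"
  have uu: "u \<bullet> u = 1" and xx: "x i \<bullet> x i = 1"
    using u unit[OF i] by (simp_all add: outer_unit_normal_def dot_square_norm)
  \<comment> \<open>The component of \<open>u\<close> orthogonal to \<open>x i\<close> gives
    \<open>1 \<le> c\<^sup>2\<close>, and the direction \<open>- x i\<close> gives the sign of
    \<open>c\<close>.\<close>
  have "u \<bullet> (u - c *\<^sub>R x i) \<le> 0" by (rule move) (simp add: inner_diff_right xx c_def inner_commute)
  then have "1 \<le> c\<^sup>2" by (simp add: inner_diff_right uu c_def[symmetric] power2_eq_square)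
  moreover have "u \<bullet> (- x i) \<le> 0" by (rule move) (simp add: xx)
  then have "0 \<le> c" by (simp add: c_def)
  ultimately have "1 \<le> c" using power2_le_imp_le[of 1 c] by simp
  moreover have "(u - x i) \<bullet> (u - x i) = 2 - 2 * c"
    by (simp add: inner_diff_left inner_diff_right uu xx c_def inner_commute)
  ultimately have "(u - x i) \<bullet> (u - x i) = 0" using inner_ge_zero[of "u - x i"] by linarith
  then show "u = x i" by simp
qed

section \<open>Facets\<close>

lemma polytope_body: "polytope (body h)"
proof -
  have "body h = \<Inter> ((\<lambda>i. {y. x i \<bullet> y \<le> h i}) ` I)" by (auto simp: body_def)
  then have "polyhedron (body h)"
    using fin by (auto intro!: polyhedron_Inter polyhedron_halfspace_le)
  then show ?thesis by (simp add: polytope_eq_bounded_polyhedron bounded_body)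
qed

lemma face_face_of: "i \<in> I \<Longrightarrow> face i h face_of body h"
  unfolding face_def
  by (intro face_of_Int_supporting_hyperplane_le body_convex) (auto simp: body_def)

lemma aff_dim_body: "interior (body h) \<noteq> {} \<Longrightarrow> aff_dim (body h) = 3"
  by (simp add: aff_dim_nonempty_interior)

lemma convex_sect: "i \<in> I \<Longrightarrow> convex (sect i h)"
proof -
  assume i: "i \<in> I"
  have "sect i h = (\<Inter>k\<in>I. {p. snd (inv (chart i) (x k)) \<bullet> p \<le> h k - fst (inv (chart i) (x k)) * h i})"
    unfolding sect_eq[OF i] by (auto simp: algebra_simps)
  then show ?thesis by (auto intro!: convex_INT convex_halfspace_le)
qed

text \<open>A planar section of positive measure has interior points, hence dimension 2, which its
  injective affine image in space inherits.\<close>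

lemma face_facet_of:
  assumes i: "i \<in> I" and int: "interior (body h) \<noteq> {}" and a: "0 < area i h"
  shows "face i h facet_of body h"
proof -
  have "interior (sect i h) \<noteq> {}"
    using a by (intro compact_convex_interior_of_measure compact_sect convex_sect i) (simp add: area_def)
  then have d: "aff_dim (sect i h) = 2" by (simp add: aff_dim_nonempty_interior)
  define f where "f p = chart i (0, p)" for p
  have lin: "linear (chart i)" and inj: "inj (chart i)"
    using frame_linear[OF frame_chart[OF i]] frame_bij[OF frame_chart[OF i]] by (auto simp: bij_is_inj)
  have "linear (\<lambda>p :: real \<times> real. (0 :: real, p))" by (rule linearI) auto
  from linear_compose[OF this lin] have "linear f" by (simp only: f_def[abs_def] comp_def)
  moreover have "inj f" using inj by (auto simp: f_def inj_def)
  ultimately have "aff_dim (f ` sect i h) = 2" using d by (simp add: aff_dim_injective_linear_image)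
  moreover have "face i h = (+) (chart i (h i, 0)) ` f ` sect i h"
  proof -
    have add: "chart i (h i, p) = chart i (h i, 0) + f p" for p
      using linear_add[OF lin, of "(h i, 0)" "(0, p)"] by (simp add: f_def)
    have "(+) (chart i (h i, 0)) ` f ` sect i h = (\<lambda>p. chart i (h i, 0) + f p) ` sect i h"
      by (simp only: image_image)
    also have "\<dots> = (\<lambda>p. chart i (h i, p)) ` sect i h"
      by (intro image_cong refl) (rule add[symmetric])
    also have "\<dots> = face i h" unfolding face_eq_chart[OF i] by blast
    finally show ?thesis ..
  qed
  ultimately have "aff_dim (face i h) = 2" by (simp add: aff_dim_translation_eq)
  moreover obtain y where "y \<in> body h" "x i \<bullet> y = h i" by (rule face_nonempty[OF i a])
  then have "face i h \<noteq> {}" by (auto simp: face_def)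
  ultimately show ?thesis
    unfolding facet_of_def using face_face_of[OF i] aff_dim_body[OF int] by simp
qed

text \<open>A relative interior point of a facet lies on some \<open>face i h\<close>; this face
  then contains the whole facet, and equal dimensions make them coincide.\<close>

lemma facet_of_body_iff:
  assumes int: "interior (body h) \<noteq> {}" and a: "\<And>i. i \<in> I \<Longrightarrow> 0 < area i h"
  shows "S facet_of body h \<longleftrightarrow> (\<exists>i\<in>I. S = face i h)"
proof
  assume S: "S facet_of body h"
  then have Sf: "S face_of body h" and Sd: "aff_dim S = 2" and ne: "S \<noteq> {}"
    using aff_dim_body[OF int] by (auto simp: facet_of_def)
  have Sc: "convex S" using Sf face_of_imp_convex by blast
  obtain y where y: "y \<in> rel_interior S" using rel_interior_eq_empty[OF Sc] ne by auto
  have yS: "y \<in> S" using y rel_interior_subset by blast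
  have "S \<noteq> body h" using Sd aff_dim_body[OF int] by auto
  then have "S \<inter> rel_interior (body h) = {}" by (rule face_of_disjoint_rel_interior[OF Sf])
  then have "y \<notin> interior (body h)" using yS by (auto simp: rel_interior_nonempty_interior[OF int])
  moreover have yb: "y \<in> body h" using yS face_of_imp_subset[OF Sf] by blast
  ultimately have "y \<in> frontier (body h)" by (simp add: frontier_def closed_body)
  then obtain i where i: "i \<in> I" "y \<in> face i h" using frontier_body[OF int] by auto
  have "S \<subseteq> face i h"
    using subset_of_face_of[OF face_face_of[OF i(1)] face_of_imp_subset[OF Sf]] y i(2) by blast
  then have "S face_of face i h"
    using face_of_subset[OF Sf] face_def by blast
  moreover have "aff_dim (face i h) = 2"
    using face_facet_of[OF i(1) int a[OF i(1)]] aff_dim_body[OF int] by (simp add: facet_of_def)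
  ultimately have "S = face i h"
    using face_of_aff_dim_lt[OF convex_face] Sd by force
  then show "\<exists>i\<in>I. S = face i h" using i(1) by blast
qed (use face_facet_of[OF _ int] a in blast)

end

text \<open>The planar constant enters as an assumption because it depends on the finiteness of the
  area of the sphere, which is later obtained from the design.\<close>

locale planar_normal_system = normal_system I x c
  for I :: "'i set" and x :: "'i \<Rightarrow> real^3" and c :: real +
  fixes \<kappa> :: real
  assumes \<kappa>_pos: "0 < \<kappa>"
    and planar: "\<And>T s A. frame T \<Longrightarrow> A \<in> sets borel \<Longrightarrow> area_outer (T ` ({s} \<times> A)) = ennreal \<kappa> * emeasure lborel A"
begin

lemma emeasure_face: "i \<in> I \<Longrightarrow> emeasure area_measure (face i h) = ennreal (\<kappa> * area i h)"
  using \<kappa>_pos compact_face[of i h]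
  by (subst emeasure_area_measure)
    (auto simp: borel_compact face_eq_chart planar frame_chart sect_borel emeasure_sect ennreal_mult')

definition overlap :: "('i \<Rightarrow> real) \<Rightarrow> (real^3) set" where
  "overlap h = (\<Union>i\<in>I. \<Union>k\<in>I - {i}. face i h \<inter> face k h)"

text \<open>Two faces with independent normals meet within a line, and antipodal ones are disjoint
  by \<open>nondeg\<close>.\<close>

lemma null_overlap:
  assumes nd: "nondeg h"
  shows "overlap h \<in> null_sets area_measure"
  unfolding overlap_def
proof (intro null_sets.finite_UN fin finite_Diff)
  fix i k assume i: "i \<in> I" and k: "k \<in> I - {i}"
  define w where "w = inv (chart i) (x k)"
  have b: "face i h \<inter> face k h \<in> sets borel" by (intro borel_compact compact_Int compact_face)
  have "area_outer (face i h \<inter> face k h) = 0"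
  proof (cases "snd w = 0")
    case True
    then have "x k = - x i" using inv_chart_planar[OF i, of k] k by (auto simp: w_def)
    moreover from this have "0 < h i + h k" using nd i k by (auto simp: nondeg_def)
    ultimately have "face i h \<inter> face k h = {}" by (auto simp: face_def)
    then show ?thesis by (simp add: area_outer_empty)
  next
    case False
    let ?L = "{p. snd w \<bullet> p = h k - fst w * h i}"
    have "negligible ?L" using False by (intro negligible_hyperplane) simp
    moreover have "closed ?L" by (intro closed_Collect_eq continuous_intros)
    ultimately have L: "emeasure lborel ?L = 0" "?L \<in> sets borel"
      by (auto simp: negligible_iff_null_sets null_sets_completion_iff dest: null_setsD1)
    have "face i h \<inter> face k h \<subseteq> chart i ` ({h i} \<times> ?L)"
    proof
      fix y assume y: "y \<in> face i h \<inter> face k h"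
      then obtain p where p: "y = chart i (h i, p)" using chart_plane[OF i, of y] by (auto simp: face_def)
      have "x k \<bullet> chart i (h i, p) = h k" using y p by (auto simp: face_def)
      then have "p \<in> ?L" by (simp add: inner_chart[OF i] w_def inner_prod_def)
      then show "y \<in> chart i ` ({h i} \<times> ?L)" using p by auto
    qed
    then have "area_outer (face i h \<inter> face k h) \<le> area_outer (chart i ` ({h i} \<times> ?L))" by (rule area_outer_mono)
    also have "\<dots> = 0" using L planar[OF frame_chart[OF i] L(2)] by simp
    finally show ?thesis by simp
  qed
  then show "face i h \<inter> face k h \<in> null_sets area_measure"
    using b by (simp add: null_sets_def sets_area_measure emeasure_area_measure)
qed

lemma face_area_sets: "face i h \<in> sets area_measure"
  unfolding sets_area_measure by (intro borel_compact compact_face)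

lemma emeasure_faces_Diff:
  assumes nd: "nondeg h" and J: "J \<subseteq> I"
  shows "emeasure area_measure ((\<Union>i\<in>J. face i h) - overlap h) = (\<Sum>i\<in>J. ennreal (\<kappa> * area i h))"
proof -
  note Z = null_overlap[OF nd]
  have "(\<Union>i\<in>J. face i h) - overlap h = (\<Union>i\<in>J. face i h - overlap h)" by auto
  also have "emeasure area_measure \<dots> = (\<Sum>i\<in>J. emeasure area_measure (face i h - overlap h))"
  proof (rule sum_emeasure[symmetric])
    show "(\<lambda>i. face i h - overlap h) ` J \<subseteq> sets area_measure"
      using face_area_sets null_setsD2[OF Z] by auto
    show "disjoint_family_on (\<lambda>i. face i h - overlap h) J"
      using J by (auto simp: disjoint_family_on_def overlap_def)
    show "finite J" using J fin finite_subset by blast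
  qed
  also have "\<dots> = (\<Sum>i\<in>J. ennreal (\<kappa> * area i h))"
    using J by (intro sum.cong) (auto simp: emeasure_Diff_null_set[OF Z face_area_sets] emeasure_face)
  finally show ?thesis .
qed

text \<open>A null set cannot cover a face of positive area. The point obtained has
  \<open>x i\<close> as its only normal, which distinguishes the faces.\<close>

lemma face_not_subset_overlap:
  assumes nd: "nondeg h" and i: "i \<in> I" and a: "0 < area i h"
  obtains y where "y \<in> face i h" "\<And>k. k \<in> I \<Longrightarrow> k \<noteq> i \<Longrightarrow> y \<notin> face k h"
proof -
  have "emeasure area_measure (face i h - overlap h) = ennreal (\<kappa> * area i h)"
    using emeasure_Diff_null_set[OF null_overlap[OF nd] face_area_sets] emeasure_face[OF i] by simp
  moreover have "ennreal (\<kappa> * area i h) \<noteq> 0" using mult_pos_pos[OF \<kappa>_pos a] by (simp add: ennreal_eq_0_iff not_le)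
  ultimately have "face i h - overlap h \<noteq> {}" by (metis emeasure_empty)
  then obtain y where "y \<in> face i h - overlap h" by blast
  then show ?thesis using i by (intro that[of y]) (auto simp: overlap_def)
qed

lemma emeasure_frontier_body:
  assumes int: "interior (body h) \<noteq> {}"
  shows "emeasure area_measure (frontier (body h)) = (\<Sum>i\<in>I. ennreal (\<kappa> * area i h))"
proof -
  have nd: "nondeg h" using int vol_pos_iff_interior vol_pos_imp_nondeg by blast
  have "(\<Union>i\<in>I. face i h) \<in> sets area_measure" using fin face_area_sets by (intro sets.finite_UN) auto
  from emeasure_Diff_null_set[OF null_overlap[OF nd] this] show ?thesis
    using emeasure_faces_Diff[OF nd order_refl] frontier_body[OF int] by simp
qed

text \<open>Off the null set \<open>overlap h\<close>, every boundary point is regular and its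
  normal is that of the unique face through it.\<close>

lemma emeasure_surface_area_body:
  assumes int: "interior (body h) \<noteq> {}" and A: "A \<in> sets borel_sphere"
  shows "emeasure (surface_area_measure (body h)) A = (\<Sum>i\<in>I. ennreal (\<kappa> * area i h) * indicator A (x i))"
proof -
  have nd: "nondeg h" using int vol_pos_iff_interior vol_pos_imp_nondeg by blast
  define J where "J = {i \<in> I. x i \<in> A}"
  define E where "E = {y \<in> regular_boundary (body h). normal_map (body h) y \<in> A}"
  have J: "J \<subseteq> I" by (auto simp: J_def)
  have reg: "y \<in> regular_boundary (body h) \<and> normal_map (body h) y = x i"
    if y: "i \<in> I" "y \<in> face i h" "y \<notin> overlap h" for i y
  proof -
    have only: "y \<notin> face k h" if "k \<in> I" "k \<noteq> i" for k
      using y that unfolding overlap_def by blast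
    have n: "outer_unit_normal (body h) y u \<longleftrightarrow> u = x i" for u
      by (rule outer_unit_normal_face[OF y(1,2)]) (rule only)
    have "y \<in> frontier (body h)" unfolding frontier_body[OF int] using y by blast
    moreover have "\<exists>!u. outer_unit_normal (body h) y u"
      by (simp add: n)
    ultimately have r: "y \<in> regular_boundary (body h)" by (simp add: regular_boundary_def)
    then show ?thesis using normal_map_eq[OF r, of "x i"] n[of "x i"] by simp
  qed
  have E_eq: "E - overlap h = (\<Union>i\<in>J. face i h) - overlap h"
  proof
    show "E - overlap h \<subseteq> (\<Union>i\<in>J. face i h) - overlap h"
    proof
      fix y assume y: "y \<in> E - overlap h"
      then have "y \<in> frontier (body h)" by (auto simp: E_def regular_boundary_def)
      then obtain i where i: "i \<in> I" "y \<in> face i h" unfolding frontier_body[OF int] by blast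
      then have "x i \<in> A" using y reg[OF i] by (auto simp: E_def)
      then show "y \<in> (\<Union>i\<in>J. face i h) - overlap h" using i y by (auto simp: J_def)
    qed
    show "(\<Union>i\<in>J. face i h) - overlap h \<subseteq> E - overlap h"
      using reg by (auto simp: E_def J_def)
  qed
  have "E \<in> sets area_measure" unfolding E_def by (rule normal_map_preimage_sets[OF A])
  then have "emeasure area_measure E = emeasure area_measure (E - overlap h)"
    by (rule emeasure_Diff_null_set[OF null_overlap[OF nd], symmetric])
  also have "\<dots> = (\<Sum>i\<in>J. ennreal (\<kappa> * area i h))"
    unfolding E_eq by (rule emeasure_faces_Diff[OF nd J])
  also have "\<dots> = (\<Sum>i\<in>I. ennreal (\<kappa> * area i h) * indicator A (x i))"
    unfolding J_def using fin by (intro sum.mono_neutral_cong_left) (auto simp: indicator_def)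
  finally show ?thesis by (simp add: emeasure_surface_area_measure[OF A] E_def)
qed

end

section \<open>Moments of spherical designs\<close>

lemma monomial_in_polynomials3:
  assumes "i + j + k \<le> t"
  shows "(\<lambda>y. (y $ 1) ^ i * (y $ 2) ^ j * (y $ 3) ^ k) \<in> polynomials3 t"
proof -
  let ?S = "{(i, j, k). i + j + k \<le> t}"
  let ?c = "\<lambda>a b d. if (a, b, d) = (i, j, k) then 1 else 0 :: real"
  have "(\<Sum>(a, b, d)\<in>?S. ?c a b d * (y $ 1) ^ a * (y $ 2) ^ b * (y $ 3) ^ d) = (y $ 1) ^ i * (y $ 2) ^ j * (y $ 3) ^ k"
    for y :: "real^3"
  proof -
    have "(\<Sum>(a, b, d)\<in>?S. ?c a b d * (y $ 1) ^ a * (y $ 2) ^ b * (y $ 3) ^ d) =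
      (\<Sum>(a, b, d)\<in>{(i, j, k)}. ?c a b d * (y $ 1) ^ a * (y $ 2) ^ b * (y $ 3) ^ d)"
      using assms by (intro sum.mono_neutral_right finite_exponents3) (auto split: if_splits)
    then show ?thesis by simp
  qed
  then have eq: "(\<lambda>y :: real^3. (y $ 1) ^ i * (y $ 2) ^ j * (y $ 3) ^ k) =
      (\<lambda>y. \<Sum>(a, b, d)\<in>?S. ?c a b d * (y $ 1) ^ a * (y $ 2) ^ b * (y $ 3) ^ d)"
    by (intro ext) (rule sym)
  show ?thesis
    unfolding polynomials3_def by (rule image_eqI[where x = ?c]) (simp only: eq, rule UNIV_I)
qed

lemma coordinates_in_polynomials3:
  assumes "2 \<le> t"
  shows "(\<lambda>_. 1) \<in> polynomials3 t" "(\<lambda>y. y $ i) \<in> polynomials3 t" "(\<lambda>y. y $ i * y $ j) \<in> polynomials3 t"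
proof -
  note m = monomial_in_polynomials3[of _ _ _ t]
  show "(\<lambda>_. 1) \<in> polynomials3 t" using m[of 0 0 0] by simp
  show "(\<lambda>y. y $ i) \<in> polynomials3 t"
    using exhaust_3[of i] m[of 1 0 0] m[of 0 1 0] m[of 0 0 1] assms by auto
  show "(\<lambda>y. y $ i * y $ j) \<in> polynomials3 t"
    using exhaust_3[of i] exhaust_3[of j] m[of 2 0 0] m[of 0 2 0] m[of 0 0 2] m[of 1 1 0] m[of 1 0 1] m[of 0 1 1] assms
    by (auto simp: power2_eq_square mult.commute)
qed

lemma space_sphere_sigma: "space sphere_sigma = sphere 0 1"
  by (simp add: sphere_sigma_def sphere_area_def space_scale_measure space_restrict_space space_area_measure)

lemma sets_sphere_sigma: "sets sphere_sigma = sets borel_sphere"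
  by (simp add: sphere_sigma_def sphere_area_def sets_restrict_space sets_area_measure)

lemma emeasure_sphere_sigma:
  assumes "A \<in> sets borel_sphere"
  shows "emeasure sphere_sigma A = ennreal (1 / (4 * pi)) * area_outer A"
proof -
  have "sphere 0 1 \<in> sets (borel :: (real^3) measure)" by simp
  then have "A \<in> sets borel" "A \<subseteq> sphere 0 1" using assms by (auto simp: sets_restrict_space)
  then show ?thesis
    by (simp add: sphere_sigma_def sphere_area_def emeasure_scale_measure emeasure_restrict_space
        space_area_measure sets_area_measure emeasure_area_measure)
qed

lemma design_average:
  assumes "spherical_design t X" and p: "p \<in> polynomials3 t"
  shows "(\<Sum>y\<in>X. p y) / real (card X) = (\<integral>y. p y \<partial>sphere_sigma)"
proof -
  have X: "X \<subseteq> sphere 0 1" using assms(1) by (auto simp: spherical_design_def)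
  have "restrict p (sphere 0 1) \<in> sphere_polynomials t" using p by (auto simp: sphere_polynomials_def)
  then have "(\<Sum>y\<in>X. restrict p (sphere 0 1) y) / real (card X) = (\<integral>y. restrict p (sphere 0 1) y \<partial>sphere_sigma)"
    using assms(1) by (auto simp: spherical_design_def)
  moreover have "(\<Sum>y\<in>X. restrict p (sphere 0 1) y) = (\<Sum>y\<in>X. p y)" using X by (intro sum.cong) auto
  moreover have "(\<integral>y. restrict p (sphere 0 1) y \<partial>sphere_sigma) = (\<integral>y. p y \<partial>sphere_sigma)"
    by (intro Bochner_Integration.integral_cong) (auto simp: space_sphere_sigma)
  ultimately show ?thesis by simp
qed

text \<open>For infinite area the integral of the constant 1 would be 0, since
  \<open>measure\<close> sends infinite values to 0, but the design property makes it 1.\<close>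

lemma design_area_sphere_finite:
  assumes X: "spherical_design t X" and t: "2 \<le> t"
  shows "area_outer (sphere 0 1) < top"
proof (rule ccontr)
  assume "\<not> ?thesis"
  then have top: "area_outer (sphere 0 1) = top" by (metis top.not_eq_extremum)
  have "sphere 0 1 \<in> sets borel_sphere" by (auto simp: sets_restrict_space)
  then have "emeasure sphere_sigma (space sphere_sigma) = top"
    by (simp add: space_sphere_sigma emeasure_sphere_sigma top ennreal_mult_top)
  then have "(\<integral>y. 1 \<partial>sphere_sigma) = (0::real)" by (simp add: measure_def)
  moreover have "0 < card X" using X by (auto simp: spherical_design_def card_gt_0_iff)
  ultimately show False using design_average[OF X coordinates_in_polynomials3(1)[OF t]] by simp
qed

text \<open>Covers the two symmetries needed for the moments: reversing one coordinate and swapping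
  two.\<close>

definition signed_permutation :: "(3 \<Rightarrow> real) \<Rightarrow> (3 \<Rightarrow> 3) \<Rightarrow> real^3 \<Rightarrow> real^3" where
  "signed_permutation e \<pi> y = (\<chi> j. e j * y $ \<pi> j)"

lemma signed_permutation_orthogonal:
  assumes e: "\<And>j. (e j)\<^sup>2 = 1" and \<pi>: "bij \<pi>"
  shows "orthogonal_transformation (signed_permutation e \<pi>)"
proof -
  have "linear (signed_permutation e \<pi>)"
    by (auto intro!: linearI simp: signed_permutation_def vec_eq_iff algebra_simps)
  moreover have "norm (signed_permutation e \<pi> y) = norm y" for y
  proof -
    have "(\<Sum>j\<in>UNIV. (e j * y $ \<pi> j)\<^sup>2) = (\<Sum>j\<in>UNIV. (y $ \<pi> j)\<^sup>2)" by (simp add: power_mult_distrib e)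
    also have "\<dots> = (\<Sum>j\<in>UNIV. (y $ j)\<^sup>2)" by (rule sum.reindex_bij_betw[OF \<pi>])
    finally show ?thesis by (simp add: norm_vec_def L2_set_def signed_permutation_def)
  qed
  ultimately show ?thesis by (simp add: orthogonal_transformation)
qed

text \<open>Area is preserved by isometries, so \<open>sphere_sigma\<close> is its own push-forward
  under \<open>R\<close>.\<close>

lemma integral_sphere_sigma_orthogonal:
  fixes p :: "real^3 \<Rightarrow> real"
  assumes R: "orthogonal_transformation R" and p: "continuous_on UNIV p"
  shows "(\<integral>y. p (R y) \<partial>sphere_sigma) = (\<integral>y. p y \<partial>sphere_sigma)"
proof -
  have norm_R: "norm (R y) = norm y" for y using R by (simp add: orthogonal_transformation)
  have lin: "linear R" using R by (simp add: orthogonal_transformation)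
  have dist_R: "dist (R a) (R b) = dist a b" for a b
    using norm_R[of "a - b"] by (simp add: dist_norm linear_diff[OF lin])
  have "continuous_on UNIV R" using lin by (simp add: linear_continuous_on linear_conv_bounded_linear)
  then have "R \<in> borel_measurable borel" by (rule borel_measurable_continuous_onI)
  then have "R \<in> measurable borel_sphere borel_sphere"
    by (intro measurable_restrict_space2 measurable_restrict_space1) (auto simp: space_restrict_space norm_R)
  then have mR: "R \<in> measurable sphere_sigma sphere_sigma"
    by (simp add: measurable_cong_sets[OF sets_sphere_sigma sets_sphere_sigma])
  have "distr sphere_sigma sphere_sigma R = sphere_sigma"
  proof (rule measure_eqI)
    fix A assume "A \<in> sets (distr sphere_sigma sphere_sigma R)"
    then have A: "A \<in> sets sphere_sigma" by simp
    have B: "R -` A \<inter> sphere 0 1 \<in> sets sphere_sigma"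
      using measurable_sets[OF mR A] by (simp add: space_sphere_sigma)
    have "R ` (R -` A \<inter> sphere 0 1) = A"
    proof -
      have "A \<subseteq> sphere 0 1" using sets.sets_into_space[OF A] by (simp add: space_sphere_sigma)
      moreover have "surj R" using orthogonal_transformation_surj[OF R] .
      ultimately show ?thesis using norm_R by (force simp: image_iff surj_def)
    qed
    moreover have "area_outer (R ` (R -` A \<inter> sphere 0 1)) = area_outer (R -` A \<inter> sphere 0 1)"
      by (rule area_outer_isometric_image) (rule dist_R)
    ultimately have "area_outer (R -` A \<inter> sphere 0 1) = area_outer A" by simp
    then show "emeasure (distr sphere_sigma sphere_sigma R) A = emeasure sphere_sigma A"
      using A B by (simp add: emeasure_distr[OF mR A] space_sphere_sigma emeasure_sphere_sigma sets_sphere_sigma)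
  qed simp
  moreover have "p \<in> borel_measurable sphere_sigma"
    using borel_measurable_continuous_onI[OF p]
    by (simp add: measurable_cong_sets[OF sets_sphere_sigma refl] measurable_restrict_space1)
  ultimately show ?thesis using integral_distr[OF mR, of p] by simp
qed

text \<open>Reversing coordinate \<open>i\<close> changes the sign of the first and mixed moments.
  Swapping coordinates makes the three pure second moments equal, and they sum to
  \<open>card X\<close> because the points have norm 1.\<close>

lemma design_moments:
  assumes X: "spherical_design t X" and t: "2 \<le> t"
  shows "(\<Sum>y\<in>X. y $ i) = 0" "i \<noteq> j \<Longrightarrow> (\<Sum>y\<in>X. y $ i * y $ j) = 0"
    "(\<Sum>y\<in>X. y $ i * y $ i) = real (card X) / 3"
proof -
  let ?n = "real (card X)"
  have n: "?n > 0" using X by (auto simp: spherical_design_def card_gt_0_iff)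
  note poly = coordinates_in_polynomials3[OF t]
  have reflection: "orthogonal_transformation (signed_permutation (\<lambda>j. if j = i then -1 else 1) id)" for i
    by (rule signed_permutation_orthogonal) auto
  have "(\<integral>y. signed_permutation (\<lambda>j. if j = i then -1 else 1) id y $ i \<partial>sphere_sigma) = (\<integral>y. y $ i \<partial>sphere_sigma)"
    by (rule integral_sphere_sigma_orthogonal[OF reflection]) (intro continuous_intros)
  then have "(\<integral>y. y $ i \<partial>sphere_sigma) = 0" by (simp add: signed_permutation_def)
  then show "(\<Sum>y\<in>X. y $ i) = 0" using design_average[OF X poly(2)[of i]] n by simp
  show "(\<Sum>y\<in>X. y $ i * y $ j) = 0" if "i \<noteq> j"
  proof -
    have "(\<integral>y. signed_permutation (\<lambda>j. if j = i then -1 else 1) id y $ i *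
        signed_permutation (\<lambda>j. if j = i then -1 else 1) id y $ j \<partial>sphere_sigma) = (\<integral>y. y $ i * y $ j \<partial>sphere_sigma)"
      by (rule integral_sphere_sigma_orthogonal[OF reflection]) (intro continuous_intros)
    then have "(\<integral>y. y $ i * y $ j \<partial>sphere_sigma) = 0" using that by (simp add: signed_permutation_def)
    then show ?thesis using design_average[OF X poly(3)[of i j]] n by simp
  qed
  have eq: "(\<Sum>y\<in>X. y $ k * y $ k) = (\<Sum>y\<in>X. y $ i * y $ i)" for k
  proof -
    have o: "orthogonal_transformation (signed_permutation (\<lambda>_. 1) (Transposition.transpose i k))"
      by (rule signed_permutation_orthogonal) auto
    have "(\<integral>y. signed_permutation (\<lambda>_. 1) (Transposition.transpose i k) y $ i *
        signed_permutation (\<lambda>_. 1) (Transposition.transpose i k) y $ i \<partial>sphere_sigma) = (\<integral>y. y $ i * y $ i \<partial>sphere_sigma)"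
      by (rule integral_sphere_sigma_orthogonal[OF o]) (intro continuous_intros)
    then have "(\<integral>y. y $ k * y $ k \<partial>sphere_sigma) = (\<integral>y. y $ i * y $ i \<partial>sphere_sigma)"
      by (simp add: signed_permutation_def)
    then have "(\<Sum>y\<in>X. y $ k * y $ k) / ?n = (\<Sum>y\<in>X. y $ i * y $ i) / ?n"
      using design_average[OF X poly(3)[of i i]] design_average[OF X poly(3)[of k k]] by simp
    then show ?thesis using n by simp
  qed
  have "(\<Sum>k\<in>UNIV. \<Sum>y\<in>X. y $ k * y $ k) = (\<Sum>y\<in>X. \<Sum>k\<in>UNIV. y $ k * y $ k)" by (rule sum.swap)
  also have "\<dots> = (\<Sum>y\<in>X. 1)"
  proof (rule sum.cong)
    fix y assume "y \<in> X"
    then have "norm y = 1" using X by (auto simp: spherical_design_def)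
    then have "y \<bullet> y = 1" by (simp add: dot_square_norm)
    then show "(\<Sum>k\<in>UNIV. y $ k * y $ k) = 1" by (simp add: inner_vec_def)
  qed simp
  also have "\<dots> = ?n" by simp
  also have "(\<Sum>k\<in>UNIV. \<Sum>y\<in>X. y $ k * y $ k) = (\<Sum>k\<in>(UNIV :: 3 set). \<Sum>y\<in>X. y $ i * y $ i)"
    by (rule sum.cong[OF refl eq])
  also have "\<dots> = 3 * (\<Sum>y\<in>X. y $ i * y $ i)" by simp
  finally show "(\<Sum>y\<in>X. y $ i * y $ i) = ?n / 3" by simp
qed

text \<open>Expand the squares and insert the second moments. The constant becomes the frame bound
  \<open>real N / 3\<close> of the locale.\<close>

lemma design_tight_frame:
  assumes X: "spherical_design t X" and t: "2 \<le> t"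
  shows "(\<Sum>z\<in>X. (z \<bullet> y)\<^sup>2) = real (card X) / 3 * (norm y)\<^sup>2"
proof -
  have "(\<Sum>z\<in>X. (z \<bullet> y)\<^sup>2) = (\<Sum>z\<in>X. \<Sum>i\<in>UNIV. \<Sum>j\<in>UNIV. (y $ i * y $ j) * (z $ i * z $ j))"
    by (simp add: inner_vec_def power2_eq_square sum_product mult_ac)
  also have "\<dots> = (\<Sum>i\<in>UNIV. \<Sum>z\<in>X. \<Sum>j\<in>UNIV. (y $ i * y $ j) * (z $ i * z $ j))" by (rule sum.swap)
  also have "\<dots> = (\<Sum>i\<in>UNIV. \<Sum>j\<in>UNIV. (y $ i * y $ j) * (\<Sum>z\<in>X. z $ i * z $ j))"
    unfolding sum_distrib_left by (intro sum.cong refl) (rule sum.swap)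
  also have "\<dots> = (\<Sum>i\<in>UNIV. \<Sum>j\<in>UNIV. if i = j then y $ i * y $ i * (real (card X) / 3) else 0)"
    using design_moments[OF X t] by (intro sum.cong refl) auto
  also have "\<dots> = real (card X) / 3 * (y \<bullet> y)" by (simp add: inner_vec_def sum_distrib_left mult_ac)
  finally show ?thesis by (simp add: dot_square_norm)
qed

lemma design_planar_normal_system:
  fixes x :: "nat \<Rightarrow> real^3"
  assumes t: "2 \<le> t" and inj: "inj_on x {1..N}" and X: "spherical_design t (x ` {1..N})"
  obtains \<kappa> where "planar_normal_system {1..N} x (real N / 3) \<kappa>" "0 < N"
proof -
  obtain \<kappa> :: real where \<kappa>: "\<kappa> > 0"
    "\<And>T s A. frame T \<Longrightarrow> A \<in> sets borel \<Longrightarrow> area_outer (T ` ({s} \<times> A)) = ennreal \<kappa> * emeasure lborel A"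
    using area_outer_planar[OF design_area_sphere_finite[OF X t]] by blast
  have card: "card (x ` {1..N}) = N" using card_image[OF inj] by simp
  have N: "0 < N"
  proof (rule ccontr)
    assume "\<not> 0 < N"
    then show False using X by (simp add: spherical_design_def)
  qed
  have "planar_normal_system {1..N} x (real N / 3) \<kappa>"
  proof
    show "norm (x i) = 1" if "i \<in> {1..N}" for i
    proof -
      have "x i \<in> sphere 0 1" using X that unfolding spherical_design_def by blast
      then show ?thesis by simp
    qed
    have "(\<Sum>i\<in>{1..N}. x i) $ k = (\<Sum>y\<in>x ` {1..N}. y $ k)" for k
      using sum.reindex[OF inj, of "\<lambda>y. y $ k"] by (simp add: comp_def)
    then have "(\<Sum>i\<in>{1..N}. x i) $ k = 0" for k
      using design_moments(1)[OF X t, of k] by simp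
    then show "(\<Sum>i\<in>{1..N}. x i) = 0" by (simp add: vec_eq_iff)
    show "real N / 3 * (norm y)\<^sup>2 \<le> (\<Sum>i\<in>{1..N}. (x i \<bullet> y)\<^sup>2)" for y
    proof -
      have "(\<Sum>i\<in>{1..N}. (x i \<bullet> y)\<^sup>2) = (\<Sum>z\<in>x ` {1..N}. (z \<bullet> y)\<^sup>2)"
        using sum.reindex[OF inj, of "\<lambda>z. (z \<bullet> y)\<^sup>2"] by (simp only: comp_def)
      then show ?thesis using design_tight_frame[OF X t, of y] by (simp only: card order_refl)
    qed
  qed (use inj N \<kappa> in auto)
  then show ?thesis using that N by blast
qed

theorem theorem3p1:
  fixes t N :: nat and x :: "nat \<Rightarrow> real^3"
  assumes "t \<ge> 2"
    and "inj_on x {1..N}"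
    and "spherical_design t (x ` {1..N})"
  shows "\<exists>P. polytope P \<and> interior P \<noteq> {} \<and>
    surface_area_measure P = scale_measure (ennreal (4 * pi)) (empirical_measure (x ` {1..N})) \<and>
    (\<forall>K. convex_body K \<and>
         surface_area_measure K = scale_measure (ennreal (4 * pi)) (empirical_measure (x ` {1..N}))
       \<longrightarrow> (\<exists>a. K = (+) a ` P)) \<and>
    (\<exists>F. bij_betw F {1..N} {S. S facet_of P} \<and>
      (\<forall>j\<in>{1..N}. (\<forall>u. (\<forall>y\<in>F j. outer_unit_normal P y u) \<longleftrightarrow> u = x j) \<and>
                   emeasure area_measure (F j) = ennreal (4 * pi / real N))) \<and>
    emeasure area_measure (frontier P) = ennreal (4 * pi)"
proof -
  define X where "X = x ` {1..N}"
  have X: "finite X" "X \<subseteq> sphere 0 1" "card X = N"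
    using assms(3) card_image[OF assms(2)] by (auto simp: X_def spherical_design_def)
  obtain \<kappa> where sys: "planar_normal_system {1..N} x (real N / 3) \<kappa>" and N: "0 < N"
    using design_planar_normal_system[OF assms] by blast
  interpret planar_normal_system "{1..N}" x "real N / 3" \<kappa> by fact
  define \<mu> where "\<mu> = scale_measure (ennreal (4 * pi)) (empirical_measure X)"
  \<comment> \<open>The face area in chart coordinates that corresponds to area
    \<open>4 * pi / real N\<close> after multiplication by \<open>\<kappa>\<close>.\<close>
  define \<alpha> where "\<alpha> = 4 * pi / (real N * \<kappa>)"
  have \<alpha>: "0 < \<alpha>" "\<kappa> * \<alpha> = 4 * pi / real N" using N \<kappa>_pos by (simp_all add: \<alpha>_def)
  have \<mu>: "emeasure \<mu> A = (\<Sum>i\<in>{1..N}. ennreal (4 * pi / real N) * indicator A (x i))" if "A \<in> sets borel_sphere" for A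
  proof -
    have "emeasure \<mu> A = ennreal (4 * pi) * (\<Sum>y\<in>X. ennreal (1 / real N) * indicator A y)"
      using emeasure_empirical_measure[OF X(1,2) that] X(3) by (simp add: \<mu>_def emeasure_scale_measure)
    also have "\<dots> = (\<Sum>y\<in>X. ennreal (4 * pi / real N) * indicator A y)"
      by (simp add: sum_distrib_left mult.assoc[symmetric] flip: ennreal_mult')
    also have "\<dots> = (\<Sum>i\<in>{1..N}. ennreal (4 * pi / real N) * indicator A (x i))"
      unfolding X_def by (rule sum.reindex_cong[OF assms(2)]) auto
    finally show ?thesis .
  qed
  have sets_\<mu>: "sets \<mu> = sets borel_sphere"
    by (simp add: \<mu>_def empirical_measure_def)
  obtain g0 a where g0: "0 < a" "\<And>i. i \<in> {1..N} \<Longrightarrow> area i g0 = a" "0 < vol g0"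
    "\<And>h. (\<Sum>i\<in>{1..N}. h i) \<le> (\<Sum>i\<in>{1..N}. g0 i) \<Longrightarrow> vol h \<le> vol g0"
    by (rule exists_equal_areas) blast
  \<comment> \<open>Face areas scale quadratically, so this factor turns the common area
    \<open>a\<close> into \<open>\<alpha>\<close>.\<close>
  define r where "r = sqrt (\<alpha> / a)"
  have r: "0 < r" "r\<^sup>2 * a = \<alpha>" using \<alpha> g0(1) by (simp_all add: r_def)
  define g where "g i = r * g0 i" for i
  have g_area: "area i g = \<alpha>" if "i \<in> {1..N}" for i
    using area_scale[OF that r(1), of g0] g0(2)[OF that] r(2) by (simp add: g_def[abs_def])
  have g_vol: "0 < vol g" "vol g = r ^ 3 * vol g0"
    using vol_scale[OF r(1), of g0] g0(3) r(1) by (simp_all add: g_def[abs_def])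
  \<comment> \<open>Maximality survives scaling: \<open>h\<close> divided by \<open>r\<close>
    competes with \<open>g0\<close>, and volumes scale by the cube of \<open>r\<close>.\<close>
  have g_max: "vol h \<le> vol g" if "(\<Sum>i\<in>{1..N}. h i) \<le> (\<Sum>i\<in>{1..N}. g i)" for h
  proof -
    have "(\<Sum>i\<in>{1..N}. (1 / r) * h i) = (1 / r) * (\<Sum>i\<in>{1..N}. h i)"
      by (rule sum_distrib_left[symmetric])
    also have "\<dots> \<le> (1 / r) * (\<Sum>i\<in>{1..N}. g i)"
      using that r(1) by (intro mult_left_mono) auto
    also have "\<dots> = (\<Sum>i\<in>{1..N}. g0 i)" using r(1) by (simp add: g_def flip: sum_distrib_left)
    finally have "vol (\<lambda>i. (1 / r) * h i) \<le> vol g0" by (rule g0(4))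
    then have "r ^ 3 * vol (\<lambda>i. (1 / r) * h i) \<le> vol g" using r(1) g_vol(2) by simp
    moreover have "vol (\<lambda>i. r * ((1 / r) * h i)) = r ^ 3 * vol (\<lambda>i. (1 / r) * h i)" by (rule vol_scale[OF r(1)])
    moreover have "(\<lambda>i. r * ((1 / r) * h i)) = h" using r(1) by auto
    ultimately show ?thesis by simp
  qed
  define P where "P = body g"
  have int: "interior P \<noteq> {}" using g_vol(1) vol_pos_iff_interior by (simp add: P_def)
  have SP: "surface_area_measure P = \<mu>"
  proof (rule measure_eqI)
    show "sets (surface_area_measure P) = sets \<mu>" by (simp add: sets_\<mu> surface_area_measure_def)
    fix A assume "A \<in> sets (surface_area_measure P)"
    then have A: "A \<in> sets borel_sphere" by (simp add: surface_area_measure_def)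
    show "emeasure (surface_area_measure P) A = emeasure \<mu> A"
      unfolding P_def emeasure_surface_area_body[OF int[unfolded P_def] A] \<mu>[OF A]
      by (rule sum.cong[OF refl]) (simp only: g_area \<alpha>(2))
  qed
  have unique: "\<exists>b. K = (+) b ` P" if K: "convex_body K" "surface_area_measure K = \<mu>" for K
  proof -
    have sing: "A \<in> sets borel_sphere" if "finite A" "A \<subseteq> sphere 0 1" for A
    proof -
      have "A \<in> sets borel" using that(1) by (intro borel_closed finite_imp_closed)
      then show ?thesis using that(2) by (auto simp: sets_restrict_space)
    qed
    have cX: "sphere 0 1 - X \<in> sets borel_sphere"
      using sets.compl_sets[OF sing[OF X(1,2)]] by (simp add: space_restrict_space)
    have "normal_map K y \<in> sphere 0 1" if "y \<in> regular_boundary K" for y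
      using normal_map_eq[OF that, of "normal_map K y"] by (simp add: outer_unit_normal_def)
    then have E: "{y \<in> regular_boundary K. normal_map K y \<notin> X} = {y \<in> regular_boundary K. normal_map K y \<in> sphere 0 1 - X}"
      by auto
    \<comment> \<open>\<open>\<mu>\<close> has no mass off \<open>X\<close>, so the regular boundary
      points with normal outside \<open>X\<close> form a set of area zero.\<close>
    have "emeasure area_measure {y \<in> regular_boundary K. normal_map K y \<in> sphere 0 1 - X} = emeasure \<mu> (sphere 0 1 - X)"
      using emeasure_surface_area_measure[OF cX, of K] K(2) by simp
    also have "\<dots> = 0" unfolding \<mu>[OF cX] by (auto simp: X_def)
    finally have "area_outer {y \<in> regular_boundary K. normal_map K y \<notin> X} = 0"
      unfolding E using normal_map_preimage_sets[OF cX, of K] by (simp add: emeasure_area_measure sets_area_measure)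
    then have "K = {y. \<forall>u\<in>X. u \<bullet> y \<le> Sup ((\<bullet>) u ` K)}"
      using discrete_normals_imp_intersection_halfspaces[OF K(1) X(1,2)] by blast
    also have "\<dots> = body (\<lambda>i. Sup ((\<bullet>) (x i) ` K))" unfolding body_def X_def by auto
    finally obtain h where h: "K = body h" by blast
    have hint: "interior (body h) \<noteq> {}" using K(1) h by (simp add: convex_body_def)
    \<comment> \<open>Evaluating both measures on the singleton of \<open>x i\<close> isolates one
      face, as the normals are distinct; cancelling \<open>\<kappa>\<close> leaves the chart
      area.\<close>
    have h_area: "area i h = \<alpha>" if i: "i \<in> {1..N}" for i
    proof -
      have A: "{x i} \<in> sets borel_sphere" using i unit by (intro sing) auto
      have delta: "(\<Sum>k\<in>{1..N}. f k * indicator {x i} (x k)) = f i" for f :: "nat \<Rightarrow> ennreal"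
      proof -
        have "(\<Sum>k\<in>{1..N}. f k * indicator {x i} (x k)) = (\<Sum>k\<in>{1..N}. if k = i then f k else 0)"
        proof (rule sum.cong[OF refl])
          fix k assume "k \<in> {1..N}"
          then have "x k = x i \<longleftrightarrow> k = i" using inj_on_eq_iff[OF assms(2)] i by blast
          then show "f k * indicator {x i} (x k) = (if k = i then f k else 0)" by (simp add: indicator_def)
        qed
        then show ?thesis using i by simp
      qed
      have "ennreal (\<kappa> * area i h) = emeasure (surface_area_measure K) {x i}"
        unfolding h emeasure_surface_area_body[OF hint A] by (rule delta[symmetric])
      also have "\<dots> = ennreal (\<kappa> * \<alpha>)"
        unfolding K(2) \<mu>[OF A] \<alpha>(2) by (rule delta)
      finally have eq: "ennreal (\<kappa> * area i h) = ennreal (\<kappa> * \<alpha>)" .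
      have "0 \<le> area i h" unfolding area_def by (rule measure_nonneg)
      then have "\<kappa> * area i h = \<kappa> * \<alpha>"
        using eq \<kappa>_pos \<alpha>(1) by (subst (asm) ennreal_inj) auto
      then show ?thesis using \<kappa>_pos by simp
    qed
    have "0 < vol h" using hint vol_pos_iff_interior by simp
    then obtain b where "body h = (+) b ` body g"
      using equal_areas_unique[OF \<alpha>(1) g_area g_vol(1) g_max h_area] by blast
    then show ?thesis using h P_def by blast
  qed
  have facets: "bij_betw (\<lambda>j. face j g) {1..N} {S. S facet_of P}"
  proof (rule bij_betw_imageI)
    have nd: "nondeg g" using g_vol(1) by (rule vol_pos_imp_nondeg)
    show "inj_on (\<lambda>j. face j g) {1..N}"
    proof (rule inj_onI, rule ccontr)
      fix i k assume ik: "i \<in> {1..N}" "k \<in> {1..N}" "face i g = face k g" "i \<noteq> k"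
      obtain y where "y \<in> face i g" "\<And>k. k \<in> {1..N} \<Longrightarrow> k \<noteq> i \<Longrightarrow> y \<notin> face k g"
        using face_not_subset_overlap[OF nd ik(1)] g_area[OF ik(1)] \<alpha>(1) by metis
      then show False using ik by metis
    qed
    show "(\<lambda>j. face j g) ` {1..N} = {S. S facet_of P}"
      using facet_of_body_iff[OF int[unfolded P_def]] g_area \<alpha>(1) by (auto simp: P_def)
  qed
  \<comment> \<open>A point of the face that lies on no other face excludes every normal except
    \<open>x j\<close>.\<close>
  have normals: "(\<forall>y\<in>face j g. outer_unit_normal P y u) \<longleftrightarrow> u = x j" if j: "j \<in> {1..N}" for j u
  proof
    assume "\<forall>y\<in>face j g. outer_unit_normal P y u"
    moreover obtain y where "y \<in> face j g" "\<And>k. k \<in> {1..N} \<Longrightarrow> k \<noteq> j \<Longrightarrow> y \<notin> face k g"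
      using face_not_subset_overlap[OF vol_pos_imp_nondeg[OF g_vol(1)] j] g_area[OF j] \<alpha>(1) by metis
    ultimately show "u = x j" using outer_unit_normal_face[OF j, of y g u] by (auto simp: P_def)
  next
    assume "u = x j"
    then show "\<forall>y\<in>face j g. outer_unit_normal P y u"
      using outer_unit_normal_face_self[OF j] unfolding P_def by blast
  qed
  have face_area: "emeasure area_measure (face j g) = ennreal (4 * pi / real N)" if "j \<in> {1..N}" for j
    using emeasure_face[OF that, of g] g_area[OF that] \<alpha>(2) by simp
  have "emeasure area_measure (frontier P) = (\<Sum>i\<in>{1..N}. ennreal (4 * pi / real N))"
    unfolding P_def emeasure_frontier_body[OF int[unfolded P_def]]
    by (rule sum.cong[OF refl]) (simp only: g_area \<alpha>(2))
  also have "\<dots> = ennreal (4 * pi)"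
    using N by (simp add: ennreal_of_nat_eq_real_of_nat flip: ennreal_mult')
  finally have front: "emeasure area_measure (frontier P) = ennreal (4 * pi)" .
  have "polytope P" unfolding P_def by (rule polytope_body)
  then show ?thesis
    using int SP unique facets normals face_area front unfolding \<mu>_def X_def by blast
qed

end
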